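(* Let $(X,\Sigma_X,\mu_X)$ and $(Y,\Sigma_Y,\mu_Y)$ be $\sigma$-finite measure spaces, $\varphi\colon Y\to X$ a measurable map with $\varphi_*\mu_Y\ll\mu_X$, $p,q\in(1,\infty)$ with $\frac1p+\frac1q=1$, and $\mathscr M$ an $L^p(\mu_X)$-normed module. Then the map $\mathrm I\colon(\varphi^*\mathscr M)^*\to\mathrm{Hom}_{\rm loc}(\mathscr M;L^1(\mu_Y))$ given by $$\mathrm I(L)(v):=L(\varphi^*v)\in L^1(\mu_Y)\qquad\text{for every }L\in(\varphi^*\mathscr M)^*\text{ and }v\in\mathscr M$$ is an isomorphism of $L^q(\mu_Y)$-normed modules.
   Context: **Normed modules.** For a $\sigma$-finite measure $\mu$ and $p\in(1,\infty)$, an $L^p(\mu)$-normed module is a Banach space $\mathscr M$ which is a module over $L^\infty(\mu)$ and has a pointwise norm $|\cdot|\colon\mathscr M\to L^p(\mu)^+$ with $\|v\|_{\mathscr M}=\||v|\|_{L^p(\mu)}$ and $|fv|=|f||v|$ $\mu$-a.e. for $f\in L^\infty(\mu)$, $v\in\mathscr M$. An isomorphism is an $L^\infty(\mu)$-linear bijection preserving the pointwise norm. A set generates $\mathscr M$ if its $L^\infty(\mu)$-linear combinations are dense in $\mathscr M$. **Dual.** The dual $\mathscr M^*$ of an $L^p(\mu)$-normed module is the space of $L^\infty(\mu)$-linear continuous maps $L\colon\mathscr M\to L^1(\mu)$, with the operator norm, the obvious multiplication by $L^\infty(\mu)$-functions and pointwise norm $|L|:=\operatorname{ess\,sup}\{L(v):v\in\mathscr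 M,\ |v|\le1\ \mu\text{-a.e.}\}$; it is an $L^q(\mu)$-normed module. **Pullback.** The pullback $(\varphi^*\mathscr M,\varphi^* )$ is the couple, unique up to unique isomorphism, where $\varphi^*\mathscr M$ is an $L^p(\mu_Y)$-normed module and $\varphi^*\colon\mathscr M\to\varphi^*\mathscr M$ is linear, with $|\varphi^*v|=|v|\circ\varphi$ for all $v$, and $\{\varphi^*v:v\in\mathscr M\}$ generates $\varphi^*\mathscr M$. **Local maps.** $\mathrm{Hom}_{\rm loc}(\mathscr M;L^1(\mu_Y))$ is the space of all linear operators $T\colon\mathscr M\to L^1(\mu_Y)$ for which there is $g\in L^q(\mu_Y)^+$ with $|T(v)|\le g\,|v|\circ\varphi$ $\mu_Y$-a.e. for every $v\in\mathscr M$. For such $T$, $|T|\in L^q(\mu_Y)$ denotes the essential infimum of such $g$'s, equivalently $|T|=\operatorname{ess\,sup}\{T(v):v\in\mathscr M,\ |v|\le1\ \mu_X\text{-a.e.}\}$. With this pointwise norm, pointwise sum, and $(f\cdot T)(v):=f\,T(v)$ for $f\in L^\infty(\mu_Y)$, it is an $L^q(\mu_Y)$-normed module. *)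

theory Defs
  imports "HOL-Analysis.Analysis" "HOL-Algebra.Module"
begin

section \<open>Measurable functions up to almost everywhere equality\<close>

type_synonym 'a fclass = "('a \<Rightarrow> real) set"

definition ae_rel :: "'a measure \<Rightarrow> (('a \<Rightarrow> real) \<times> ('a \<Rightarrow> real)) set" where
  "ae_rel \<mu> = {(f, g). f \<in> borel_measurable \<mu> \<and> g \<in> borel_measurable \<mu> \<and> (AE x in \<mu>. f x = g x)}"

definition L0 :: "'a measure \<Rightarrow> 'a fclass set" where
  "L0 \<mu> = borel_measurable \<mu> // ae_rel \<mu>"

definition cls :: "'a measure \<Rightarrow> ('a \<Rightarrow> real) \<Rightarrow> 'a fclass" where
  "cls \<mu> f = ae_rel \<mu> `` {f}"

definition rep :: "'a fclass \<Rightarrow> 'a \<Rightarrow> real" where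
  "rep F = (SOME f. f \<in> F)"

text \<open>Everything below is invariant under changing the representatives on null sets, so the
  choice made by \<^const>\<open>rep\<close> is immaterial.\<close>

definition add_cls :: "'a measure \<Rightarrow> 'a fclass \<Rightarrow> 'a fclass \<Rightarrow> 'a fclass" where
  "add_cls \<mu> F G = cls \<mu> (\<lambda>x. rep F x + rep G x)"

definition mult_cls :: "'a measure \<Rightarrow> 'a fclass \<Rightarrow> 'a fclass \<Rightarrow> 'a fclass" where
  "mult_cls \<mu> F G = cls \<mu> (\<lambda>x. rep F x * rep G x)"

definition abs_cls :: "'a measure \<Rightarrow> 'a fclass \<Rightarrow> 'a fclass" where
  "abs_cls \<mu> F = cls \<mu> (\<lambda>x. \<bar>rep F x\<bar>)"

definition const_cls :: "'a measure \<Rightarrow> real \<Rightarrow> 'a fclass" where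
  "const_cls \<mu> c = cls \<mu> (\<lambda>_. c)"

definition le_cls :: "'a measure \<Rightarrow> 'a fclass \<Rightarrow> 'a fclass \<Rightarrow> bool" where
  "le_cls \<mu> F G \<longleftrightarrow> (AE x in \<mu>. rep F x \<le> rep G x)"

text \<open>The class of \<open>f \<circ> \<phi>\<close>; it does not depend on the representative \<open>f\<close> when \<open>\<phi>\<close> is measurable
  and the image measure of \<open>\<nu>\<close> is absolutely continuous.\<close>

definition comp_cls :: "'b measure \<Rightarrow> ('b \<Rightarrow> 'a) \<Rightarrow> 'a fclass \<Rightarrow> 'b fclass" where
  "comp_cls \<nu> \<phi> F = cls \<nu> (\<lambda>y. rep F (\<phi> y))"

text \<open>Essential suprema and infima as least upper and greatest lower bounds in \<^const>\<open>L0\<close>.\<close>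

definition ess_sup :: "'a measure \<Rightarrow> 'a fclass set \<Rightarrow> 'a fclass" where
  "ess_sup \<mu> S = (THE G. G \<in> L0 \<mu> \<and> (\<forall>F\<in>S. le_cls \<mu> F G) \<and>
     (\<forall>H\<in>L0 \<mu>. (\<forall>F\<in>S. le_cls \<mu> F H) \<longrightarrow> le_cls \<mu> G H))"

definition ess_inf :: "'a measure \<Rightarrow> 'a fclass set \<Rightarrow> 'a fclass" where
  "ess_inf \<mu> S = (THE G. G \<in> L0 \<mu> \<and> (\<forall>F\<in>S. le_cls \<mu> G F) \<and>
     (\<forall>H\<in>L0 \<mu>. (\<forall>F\<in>S. le_cls \<mu> H F) \<longrightarrow> le_cls \<mu> H G))"

definition Lp_set :: "real \<Rightarrow> 'a measure \<Rightarrow> 'a fclass set" where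
  "Lp_set p \<mu> = {F \<in> L0 \<mu>. integrable \<mu> (\<lambda>x. \<bar>rep F x\<bar> powr p)}"

definition Lp_pos :: "real \<Rightarrow> 'a measure \<Rightarrow> 'a fclass set" where
  "Lp_pos p \<mu> = {F \<in> Lp_set p \<mu>. le_cls \<mu> (const_cls \<mu> 0) F}"

definition Lp_norm :: "real \<Rightarrow> 'a measure \<Rightarrow> 'a fclass \<Rightarrow> real" where
  "Lp_norm p \<mu> F = (\<integral>x. \<bar>rep F x\<bar> powr p \<partial>\<mu>) powr (1 / p)"

definition Linf :: "'a measure \<Rightarrow> 'a fclass ring" where
  "Linf \<mu> = \<lparr>carrier = {F \<in> L0 \<mu>. \<exists>C. AE x in \<mu>. \<bar>rep F x\<bar> \<le> C},
     mult = mult_cls \<mu>, one = const_cls \<mu> 1, zero = const_cls \<mu> 0, add = add_cls \<mu>\<rparr>"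

section \<open>Normed modules\<close>

text \<open>As usual for modules in HOL-Algebra, the inherited fields \<open>mult\<close> and \<open>one\<close> play no role.\<close>

record ('s, 'm) normed_mod = "('s, 'm) module" +
  nrm :: "'m \<Rightarrow> real"
  pnorm :: "'m \<Rightarrow> 's"

text \<open>The real scalars act through the constant functions. No generality is lost by not having
  a second, independent real scaling: an additive \<open>c \<mapsto> cls c \<odot> v\<close> that is continuous, as it is in
  a normed module, is real linear.\<close>

definition rscale :: "'a measure \<Rightarrow> ('a fclass, 'm) normed_mod \<Rightarrow> real \<Rightarrow> 'm \<Rightarrow> 'm" where
  "rscale \<mu> V c v = const_cls \<mu> c \<odot>\<^bsub>V\<^esub> v"

locale banach_Linf_module = Module.module "Linf \<mu>" V
  for \<mu> :: "'a measure" and V :: "('a fclass, 'm) normed_mod" +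
  assumes nrm_eq_0_iff: "v \<in> carrier V \<Longrightarrow> nrm V v = 0 \<longleftrightarrow> v = \<zero>\<^bsub>V\<^esub>"
    and nrm_triangle: "v \<in> carrier V \<Longrightarrow> w \<in> carrier V \<Longrightarrow> nrm V (v \<oplus>\<^bsub>V\<^esub> w) \<le> nrm V v + nrm V w"
    and nrm_rscale: "v \<in> carrier V \<Longrightarrow> nrm V (rscale \<mu> V c v) = \<bar>c\<bar> * nrm V v"
    and complete: "range u \<subseteq> carrier V \<Longrightarrow>
      (\<And>e. e > 0 \<Longrightarrow> \<exists>N. \<forall>m\<ge>N. \<forall>n\<ge>N. nrm V (u m \<ominus>\<^bsub>V\<^esub> u n) < e) \<Longrightarrow>
      \<exists>l\<in>carrier V. (\<lambda>n::nat. nrm V (u n \<ominus>\<^bsub>V\<^esub> l)) \<longlonglongrightarrow> 0"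

locale Lp_normed_module = banach_Linf_module \<mu> V
  for p :: real and \<mu> :: "'a measure" and V :: "('a fclass, 'm) normed_mod" +
  assumes pnorm_in: "v \<in> carrier V \<Longrightarrow> pnorm V v \<in> Lp_pos p \<mu>"
    and nrm_eq: "v \<in> carrier V \<Longrightarrow> nrm V v = Lp_norm p \<mu> (pnorm V v)"
    and pnorm_smult: "f \<in> carrier (Linf \<mu>) \<Longrightarrow> v \<in> carrier V \<Longrightarrow>
      pnorm V (f \<odot>\<^bsub>V\<^esub> v) = mult_cls \<mu> (abs_cls \<mu> f) (pnorm V v)"

definition Lp :: "real \<Rightarrow> 'a measure \<Rightarrow> ('a fclass, 'a fclass) normed_mod" where
  "Lp p \<mu> = \<lparr>carrier = Lp_set p \<mu>, mult = undefined, one = undefined,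
     zero = const_cls \<mu> 0, add = add_cls \<mu>, smult = mult_cls \<mu>,
     nrm = Lp_norm p \<mu>, pnorm = abs_cls \<mu>\<rparr>"

definition additive_map :: "('s, 'm) normed_mod \<Rightarrow> ('t, 'n) normed_mod \<Rightarrow> ('m \<Rightarrow> 'n) \<Rightarrow> bool" where
  "additive_map V W T \<longleftrightarrow> T \<in> carrier V \<rightarrow> carrier W \<and>
     (\<forall>v\<in>carrier V. \<forall>w\<in>carrier V. T (v \<oplus>\<^bsub>V\<^esub> w) = T v \<oplus>\<^bsub>W\<^esub> T w)"

definition real_linear_map ::
  "'a measure \<Rightarrow> ('a fclass, 'm) normed_mod \<Rightarrow> 'b measure \<Rightarrow> ('b fclass, 'n) normed_mod \<Rightarrow> ('m \<Rightarrow> 'n) \<Rightarrow> bool" where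
  "real_linear_map \<mu> V \<nu> W T \<longleftrightarrow> additive_map V W T \<and>
     (\<forall>c. \<forall>v\<in>carrier V. T (rscale \<mu> V c v) = rscale \<nu> W c (T v))"

definition Linf_linear_map ::
  "'a measure \<Rightarrow> ('a fclass, 'm) normed_mod \<Rightarrow> ('a fclass, 'n) normed_mod \<Rightarrow> ('m \<Rightarrow> 'n) \<Rightarrow> bool" where
  "Linf_linear_map \<mu> V W T \<longleftrightarrow> additive_map V W T \<and>
     (\<forall>f\<in>carrier (Linf \<mu>). \<forall>v\<in>carrier V. T (f \<odot>\<^bsub>V\<^esub> v) = f \<odot>\<^bsub>W\<^esub> T v)"

definition continuous_map_nrm :: "('s, 'm) normed_mod \<Rightarrow> ('t, 'n) normed_mod \<Rightarrow> ('m \<Rightarrow> 'n) \<Rightarrow> bool" where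
  "continuous_map_nrm V W T \<longleftrightarrow> (\<forall>v\<in>carrier V. \<forall>e>0. \<exists>d>0. \<forall>w\<in>carrier V.
     nrm V (w \<ominus>\<^bsub>V\<^esub> v) < d \<longrightarrow> nrm W (T w \<ominus>\<^bsub>W\<^esub> T v) < e)"

text \<open>Isomorphisms of \<open>L\<^sup>p\<close>-normed modules; that both sides are such modules is part of the notion.\<close>

definition normed_module_iso ::
  "real \<Rightarrow> 'a measure \<Rightarrow> ('a fclass, 'm) normed_mod \<Rightarrow> ('a fclass, 'n) normed_mod \<Rightarrow> ('m \<Rightarrow> 'n) \<Rightarrow> bool" where
  "normed_module_iso p \<mu> V W J \<longleftrightarrow> Lp_normed_module p \<mu> V \<and> Lp_normed_module p \<mu> W \<and>
     Linf_linear_map \<mu> V W J \<and> bij_betw J (carrier V) (carrier W) \<and>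
     (\<forall>v\<in>carrier V. pnorm W (J v) = pnorm V v)"

definition generates :: "'a measure \<Rightarrow> ('a fclass, 'm) normed_mod \<Rightarrow> 'm set \<Rightarrow> bool" where
  "generates \<mu> V S \<longleftrightarrow> S \<subseteq> carrier V \<and>
     (\<forall>v\<in>carrier V. \<forall>e>0. \<exists>A a. finite A \<and> A \<subseteq> S \<and> a \<in> A \<rightarrow> carrier (Linf \<mu>) \<and>
        nrm V (v \<ominus>\<^bsub>V\<^esub> finsum V (\<lambda>s. a s \<odot>\<^bsub>V\<^esub> s) A) < e)"

section \<open>Dual, pullback and local maps\<close>

text \<open>Maps defined on a carrier are made extensional, so that equality of maps is equality on the
  carrier.\<close>

definition dual_module :: "'a measure \<Rightarrow> ('a fclass, 'm) normed_mod \<Rightarrow> ('a fclass, 'm \<Rightarrow> 'a fclass) normed_mod" where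
  "dual_module \<mu> V =
    \<lparr>carrier = {L \<in> extensional (carrier V). Linf_linear_map \<mu> V (Lp 1 \<mu>) L \<and> continuous_map_nrm V (Lp 1 \<mu>) L},
     mult = undefined, one = undefined,
     zero = (\<lambda>v\<in>carrier V. \<zero>\<^bsub>Lp 1 \<mu>\<^esub>),
     add = (\<lambda>L L'. \<lambda>v\<in>carrier V. L v \<oplus>\<^bsub>Lp 1 \<mu>\<^esub> L' v),
     smult = (\<lambda>f L. \<lambda>v\<in>carrier V. f \<odot>\<^bsub>Lp 1 \<mu>\<^esub> L v),
     nrm = (\<lambda>L. SUP v\<in>{v \<in> carrier V. nrm V v \<le> 1}. nrm (Lp 1 \<mu>) (L v)),
     pnorm = (\<lambda>L. ess_sup \<mu> {L v | v. v \<in> carrier V \<and> le_cls \<mu> (pnorm V v) (const_cls \<mu> 1)})\<rparr>"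

definition is_pullback ::
  "real \<Rightarrow> 'x measure \<Rightarrow> 'y measure \<Rightarrow> ('y \<Rightarrow> 'x) \<Rightarrow> ('x fclass, 'm) normed_mod \<Rightarrow>
   ('y fclass, 'n) normed_mod \<Rightarrow> ('m \<Rightarrow> 'n) \<Rightarrow> bool" where
  "is_pullback p \<mu>X \<mu>Y \<phi> M N \<Phi> \<longleftrightarrow> Lp_normed_module p \<mu>Y N \<and>
     real_linear_map \<mu>X M \<mu>Y N \<Phi> \<and>
     (\<forall>v\<in>carrier M. pnorm N (\<Phi> v) = comp_cls \<mu>Y \<phi> (pnorm M v)) \<and>
     generates \<mu>Y N (\<Phi> ` carrier M)"

definition local_bounds ::
  "real \<Rightarrow> 'y measure \<Rightarrow> ('y \<Rightarrow> 'x) \<Rightarrow> ('x fclass, 'm) normed_mod \<Rightarrow> ('m \<Rightarrow> 'y fclass) \<Rightarrow> 'y fclass set" where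
  "local_bounds q \<mu>Y \<phi> M T = {g \<in> Lp_pos q \<mu>Y. \<forall>v\<in>carrier M.
     le_cls \<mu>Y (abs_cls \<mu>Y (T v)) (mult_cls \<mu>Y g (comp_cls \<mu>Y \<phi> (pnorm M v)))}"

definition Hom_loc ::
  "real \<Rightarrow> 'x measure \<Rightarrow> 'y measure \<Rightarrow> ('y \<Rightarrow> 'x) \<Rightarrow> ('x fclass, 'm) normed_mod \<Rightarrow>
   ('y fclass, 'm \<Rightarrow> 'y fclass) normed_mod" where
  "Hom_loc q \<mu>X \<mu>Y \<phi> M =
    \<lparr>carrier = {T \<in> extensional (carrier M). real_linear_map \<mu>X M \<mu>Y (Lp 1 \<mu>Y) T \<and> local_bounds q \<mu>Y \<phi> M T \<noteq> {}},
     mult = undefined, one = undefined,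
     zero = (\<lambda>v\<in>carrier M. \<zero>\<^bsub>Lp 1 \<mu>Y\<^esub>),
     add = (\<lambda>T T'. \<lambda>v\<in>carrier M. T v \<oplus>\<^bsub>Lp 1 \<mu>Y\<^esub> T' v),
     smult = (\<lambda>f T. \<lambda>v\<in>carrier M. f \<odot>\<^bsub>Lp 1 \<mu>Y\<^esub> T v),
     nrm = (\<lambda>T. Lp_norm q \<mu>Y (ess_inf \<mu>Y (local_bounds q \<mu>Y \<phi> M T))),
     pnorm = (\<lambda>T. ess_inf \<mu>Y (local_bounds q \<mu>Y \<phi> M T))\<rparr>"

end

theory Submission
  imports Defs
begin

text \<open>An \<open>L\<^sup>\<infinity>\<close>-linear \<open>L\<close> on the pullback can only take the value \<open>\<Sum> f\<^sub>i T v\<^sub>i\<close> at \<open>\<Sum> f\<^sub>i \<Phi> v\<^sub>i\<close>, where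
\<open>T = L \<circ> \<Phi>\<close>; as these combinations are dense, restricting along \<open>\<Phi>\<close> is injective. For surjectivity, let
\<open>T\<close> be local with \<open>\<bar>T v\<bar> \<le> g \<bar>v\<bar> \<circ> \<phi>\<close>. Everything rests on the estimate
\<open>\<bar>\<Sum> f\<^sub>i T v\<^sub>i\<bar> \<le> g \<bar>\<Sum> f\<^sub>i \<Phi> v\<^sub>i\<bar>\<close>, which makes the only possible definition of \<open>L\<close> consistent and
extends it by density. For constant coefficients \<open>c\<^sub>i\<close> the estimate is the hypothesis on \<open>T\<close> at
\<open>\<Sum> c\<^sub>i v\<^sub>i\<close>. Almost every point satisfies it for all rational coefficients at once, and both sides are
Lipschitz in the coefficients, so at such a point \<open>y\<close> the rational \<open>c\<^sub>i\<close> may tend to \<open>f\<^sub>i(y)\<close>.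
Lemma \<open>span_graph_bound_shifted\<close> carries this out one coefficient at a time, and \<open>extension\<close> passes
to limits. The extension obeys the same bound \<open>g\<close>, so \<open>T\<close> and \<open>L\<close> have the same local bounds. The
pointwise norms are the least local bounds, whence they agree.

That the local maps form an \<open>L\<^sup>q\<close>-normed module (\<open>Hom_loc_normed_module\<close>) needs a least local bound,
obtained from a countable infimum over the \<open>\<sigma>\<close>-finite measure, and completeness, where a sequence with
geometrically small increments is dominated by one function of \<open>L\<^sup>q\<close>.

The dual of a module \<open>V\<close> is the module of local maps of \<open>V\<close> for \<open>\<phi> = id\<close>. A local map is
\<open>L\<^sup>\<infinity>\<close>-linear by the same rational approximation (\<open>D_Linf_linear\<close>). Conversely, a continuous
\<open>L\<^sup>\<infinity>\<close>-linear \<open>L\<close> has the local bound \<open>g = ess sup {L v. \<bar>v\<bar> \<le> 1}\<close>: it is the limit of an increasing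
sequence \<open>L v\<^sub>n\<close>, and \<open>\<integral> h L v\<^sub>n = \<integral> L (h v\<^sub>n) \<le> C \<parallel>h\<parallel>\<^sub>p\<close> for bounded \<open>h \<ge> 0\<close> in \<open>L\<^sup>p\<close>, so that
\<open>\<parallel>g\<parallel>\<^sub>q \<le> C\<close> by duality (\<open>dual_representing_bound\<close>).\<close>

section \<open>Inequalities and limits in \<open>L\<^sup>p\<close>\<close>

lemma convex_powr_weighted:
  fixes t x y q :: real
  assumes "1 \<le> q" "0 \<le> t" "t \<le> 1" "0 \<le> x" "0 \<le> y"
  shows "(t * x + (1 - t) * y) powr q \<le> t * x powr q + (1 - t) * y powr q"
proof -
  have small: "s powr q \<le> s" if "0 \<le> s" "s \<le> 1" for s :: real
    using powr_mono'[of 1 q s] that assms(1) by (cases "s = 0") auto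
  consider "x = 0" | "y = 0" | "x > 0" "y > 0" using assms by linarith
  then show ?thesis
  proof cases
    case 1
    then show ?thesis
      using mult_right_mono[OF small[of "1 - t"], of "y powr q"] assms
      by (simp add: powr_mult)
  next
    case 2
    then show ?thesis
      using mult_right_mono[OF small[of t], of "x powr q"] assms
      by (simp add: powr_mult)
  next
    case 3
    show ?thesis
      using convex_onD[OF powr_convex[OF assms(1)], of "1 - t" x y] assms 3 by simp
  qed
qed

definition lp_norm :: "real \<Rightarrow> 'a measure \<Rightarrow> ('a \<Rightarrow> real) \<Rightarrow> real" where
  "lp_norm p \<mu> f = (\<integral>x. \<bar>f x\<bar> powr p \<partial>\<mu>) powr (1 / p)"

definition lp_fun :: "real \<Rightarrow> 'a measure \<Rightarrow> ('a \<Rightarrow> real) \<Rightarrow> bool" where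
  "lp_fun p \<mu> f \<longleftrightarrow> f \<in> borel_measurable \<mu> \<and> integrable \<mu> (\<lambda>x. \<bar>f x\<bar> powr p)"

lemma lp_norm_nonneg: "0 \<le> lp_norm p \<mu> f"
  by (simp add: lp_norm_def)

lemma lp_norm_powr: "p > 0 \<Longrightarrow> lp_norm p \<mu> f powr p = (\<integral>x. \<bar>f x\<bar> powr p \<partial>\<mu>)"
  by (simp add: lp_norm_def powr_powr)

lemma lp_fun_meas: "lp_fun p \<mu> f \<Longrightarrow> f \<in> borel_measurable \<mu>"
  by (simp add: lp_fun_def)

lemma lp_fun_mono:
  assumes "lp_fun p \<mu> g" "f \<in> borel_measurable \<mu>" "AE x in \<mu>. \<bar>f x\<bar> \<le> \<bar>g x\<bar>" "p > 0"
  shows "lp_fun p \<mu> f" "lp_norm p \<mu> f \<le> lp_norm p \<mu> g"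
proof -
  have le: "AE x in \<mu>. \<bar>f x\<bar> powr p \<le> \<bar>g x\<bar> powr p"
    using assms(3) by eventually_elim (use assms(4) in \<open>auto intro: powr_mono2\<close>)
  have g: "integrable \<mu> (\<lambda>x. \<bar>g x\<bar> powr p)" using assms(1) by (simp add: lp_fun_def)
  have f: "integrable \<mu> (\<lambda>x. \<bar>f x\<bar> powr p)"
    by (rule Bochner_Integration.integrable_bound[OF g]) (use assms(2) le in auto)
  show "lp_fun p \<mu> f" using f assms by (simp add: lp_fun_def)
  show "lp_norm p \<mu> f \<le> lp_norm p \<mu> g"
    unfolding lp_norm_def
    by (rule powr_mono2) (use assms integral_mono_AE[OF f g le] in \<open>auto intro!: integral_nonneg_AE\<close>)
qed

lemma lp_norm_cong:
  assumes "f \<in> borel_measurable \<mu>" "g \<in> borel_measurable \<mu>" "AE x in \<mu>. f x = g x"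
  shows "lp_norm p \<mu> f = lp_norm p \<mu> g"
  unfolding lp_norm_def
  using assms by (intro arg_cong[where f="\<lambda>s. s powr (1/p)"] integral_cong_AE) auto

lemma lp_fun_cong:
  assumes "lp_fun p \<mu> f" "g \<in> borel_measurable \<mu>" "AE x in \<mu>. f x = g x"
  shows "lp_fun p \<mu> g"
  using assms unfolding lp_fun_def
  by (auto intro!: integrable_cong_AE_imp[of \<mu> "\<lambda>x. \<bar>f x\<bar> powr p"])

lemma lp_norm_eq_0:
  assumes "lp_fun p \<mu> f" "p > 0"
  shows "lp_norm p \<mu> f = 0 \<longleftrightarrow> (AE x in \<mu>. f x = 0)"
proof -
  have "lp_norm p \<mu> f = 0 \<longleftrightarrow> (\<integral>x. \<bar>f x\<bar> powr p \<partial>\<mu>) = 0"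
    by (simp add: lp_norm_def)
  also have "\<dots> \<longleftrightarrow> (AE x in \<mu>. \<bar>f x\<bar> powr p = 0)"
    using assms by (intro integral_nonneg_eq_0_iff_AE) (auto simp: lp_fun_def)
  finally show ?thesis by simp
qed

lemma lp_scale:
  assumes "lp_fun p \<mu> f" "p > 0"
  shows "lp_fun p \<mu> (\<lambda>x. c * f x)" "lp_norm p \<mu> (\<lambda>x. c * f x) = \<bar>c\<bar> * lp_norm p \<mu> f"
  using assms by (auto simp: lp_fun_def lp_norm_def abs_mult powr_mult powr_powr)

text \<open>Convexity of \<open>t \<mapsto> t\<^sup>q\<close> is applied to \<open>\<bar>f\<bar> / a\<close> and \<open>\<bar>g\<bar> / b\<close> with weights \<open>a / (a + b)\<close> and
\<open>b / (a + b)\<close>. The choice \<open>a = b = 1\<close> gives integrability, the choice of the two norms gives the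
inequality.\<close>

lemma Minkowski:
  assumes f: "lp_fun q \<mu> f" and g: "lp_fun q \<mu> g" and q: "1 \<le> q"
  shows "lp_fun q \<mu> (\<lambda>x. f x + g x)"
    "lp_norm q \<mu> (\<lambda>x. f x + g x) \<le> lp_norm q \<mu> f + lp_norm q \<mu> g"
proof -
  have [measurable]: "f \<in> borel_measurable \<mu>" "g \<in> borel_measurable \<mu>"
    using f g by (auto simp: lp_fun_def)
  have If: "integrable \<mu> (\<lambda>x. \<bar>f x\<bar> powr q)" and Ig: "integrable \<mu> (\<lambda>x. \<bar>g x\<bar> powr q)"
    using f g by (auto simp: lp_fun_def)
  have key: "\<bar>f x + g x\<bar> powr q \<le>
      (a + b) powr q * (a / (a + b) * (\<bar>f x\<bar> / a) powr q + b / (a + b) * (\<bar>g x\<bar> / b) powr q)"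
    if ab: "a > 0" "b > 0" for a b x
  proof -
    have t: "1 - a / (a + b) = b / (a + b)" using ab by (simp add: field_simps)
    have eq: "a / (a + b) * (\<bar>f x\<bar> / a) + b / (a + b) * (\<bar>g x\<bar> / b) = (\<bar>f x\<bar> + \<bar>g x\<bar>) / (a + b)"
      using ab by (simp add: add_divide_distrib)
    have "\<bar>f x + g x\<bar> powr q \<le> (\<bar>f x\<bar> + \<bar>g x\<bar>) powr q"
      using q by (intro powr_mono2) auto
    also have "\<dots> = (a + b) powr q * ((\<bar>f x\<bar> + \<bar>g x\<bar>) / (a + b)) powr q"
      using ab by (simp add: powr_mult[symmetric])
    also have "\<dots> \<le> (a + b) powr q * (a / (a + b) * (\<bar>f x\<bar> / a) powr q + b / (a + b) * (\<bar>g x\<bar> / b) powr q)"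
      using convex_powr_weighted[OF q, of "a / (a + b)" "\<bar>f x\<bar> / a" "\<bar>g x\<bar> / b"] ab
      unfolding t eq by (intro mult_left_mono) auto
    finally show ?thesis .
  qed
  have I: "integrable \<mu> (\<lambda>x. (a + b) powr q * (a / (a + b) * (\<bar>f x\<bar> / a) powr q + b / (a + b) * (\<bar>g x\<bar> / b) powr q))"
    if "a > 0" "b > 0" for a b
    using that If Ig by (auto simp: powr_divide)
  show fg: "lp_fun q \<mu> (\<lambda>x. f x + g x)"
    unfolding lp_fun_def
  proof
    show "integrable \<mu> (\<lambda>x. \<bar>f x + g x\<bar> powr q)"
      by (rule Bochner_Integration.integrable_bound[OF I[of 1 1]])
        (use key[of 1 1] in \<open>auto intro!: AE_I2 intro: order_trans\<close>)
  qed measurable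
  define a b where "a = lp_norm q \<mu> f" and "b = lp_norm q \<mu> g"
  have "a \<ge> 0" "b \<ge> 0" by (auto simp: a_def b_def lp_norm_nonneg)
  then consider "a = 0" | "b = 0" | "a > 0" "b > 0" by linarith
  then show "lp_norm q \<mu> (\<lambda>x. f x + g x) \<le> lp_norm q \<mu> f + lp_norm q \<mu> g"
  proof cases
    case 1
    then have "AE x in \<mu>. f x = 0" using lp_norm_eq_0[OF f] q by (auto simp: a_def)
    then have "lp_norm q \<mu> (\<lambda>x. f x + g x) = lp_norm q \<mu> g"
      by (intro lp_norm_cong) auto
    then show ?thesis using \<open>a \<ge> 0\<close> by (simp add: a_def)
  next
    case 2
    then have "AE x in \<mu>. g x = 0" using lp_norm_eq_0[OF g] q by (auto simp: b_def)
    then have "lp_norm q \<mu> (\<lambda>x. f x + g x) = lp_norm q \<mu> f"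
      by (intro lp_norm_cong) auto
    then show ?thesis using \<open>b \<ge> 0\<close> by (simp add: b_def)
  next
    case 3
    have af: "(\<integral>x. (\<bar>f x\<bar> / a) powr q \<partial>\<mu>) = 1"
      using 3 q lp_norm_powr[of q \<mu> f, symmetric] by (simp add: powr_divide a_def[symmetric])
    have bg: "(\<integral>x. (\<bar>g x\<bar> / b) powr q \<partial>\<mu>) = 1"
      using 3 q lp_norm_powr[of q \<mu> g, symmetric] by (simp add: powr_divide b_def[symmetric])
    have "(\<integral>x. \<bar>f x + g x\<bar> powr q \<partial>\<mu>) \<le>
        (\<integral>x. (a + b) powr q * (a / (a + b) * (\<bar>f x\<bar> / a) powr q + b / (a + b) * (\<bar>g x\<bar> / b) powr q) \<partial>\<mu>)"
      by (rule integral_mono[OF _ I]) (use key 3 fg in \<open>auto simp: lp_fun_def\<close>)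
    also have "\<dots> = (a + b) powr q * (a / (a + b) * (\<integral>x. (\<bar>f x\<bar> / a) powr q \<partial>\<mu>) + b / (a + b) * (\<integral>x. (\<bar>g x\<bar> / b) powr q \<partial>\<mu>))"
      using If Ig 3 by (subst integral_mult_right_zero, subst Bochner_Integration.integral_add) (auto simp: powr_divide)
    also have "\<dots> = (a + b) powr q" unfolding af bg using 3 by (simp add: add_divide_distrib[symmetric])
    finally have "(\<integral>x. \<bar>f x + g x\<bar> powr q \<partial>\<mu>) powr (1 / q) \<le> ((a + b) powr q) powr (1 / q)"
      using q by (intro powr_mono2) (auto intro!: integral_nonneg_AE)
    then show ?thesis using 3 q by (simp add: lp_norm_def[symmetric] powr_powr a_def b_def)
  qed
qed

text \<open>Young's inequality for \<open>\<bar>f\<bar> / a\<close> and \<open>\<bar>g\<bar> / b\<close>, with \<open>a = b = 1\<close> for integrability and with the two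
norms for the inequality.\<close>

lemma Holder:
  assumes f: "lp_fun q \<mu> f" and g: "lp_fun p \<mu> g" and pq: "1 < p" "1 < q" "1 / p + 1 / q = 1"
  shows "integrable \<mu> (\<lambda>x. f x * g x)"
    "(\<integral>x. \<bar>f x * g x\<bar> \<partial>\<mu>) \<le> lp_norm q \<mu> f * lp_norm p \<mu> g"
proof -
  have [measurable]: "f \<in> borel_measurable \<mu>" "g \<in> borel_measurable \<mu>"
    using f g by (auto simp: lp_fun_def)
  have If: "integrable \<mu> (\<lambda>x. \<bar>f x\<bar> powr q)" and Ig: "integrable \<mu> (\<lambda>x. \<bar>g x\<bar> powr p)"
    using f g by (auto simp: lp_fun_def)
  have key: "\<bar>f x * g x\<bar> \<le> a * b * ((\<bar>f x\<bar> / a) powr q / q + (\<bar>g x\<bar> / b) powr p / p)"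
    if ab: "a > 0" "b > 0" for a b x
  proof -
    have "(\<bar>f x\<bar> / a) * (\<bar>g x\<bar> / b) \<le> (\<bar>f x\<bar> / a) powr q / q + (\<bar>g x\<bar> / b) powr p / p"
      using ab pq by (intro Youngs_inequality) auto
    from mult_left_mono[OF this, of "a * b"] ab show ?thesis by (simp add: abs_mult)
  qed
  have I: "integrable \<mu> (\<lambda>x. a * b * ((\<bar>f x\<bar> / a) powr q / q + (\<bar>g x\<bar> / b) powr p / p))"
    if "a > 0" "b > 0" for a b
    using that If Ig by (auto simp: powr_divide)
  show fg: "integrable \<mu> (\<lambda>x. f x * g x)"
    by (rule Bochner_Integration.integrable_bound[OF I[of 1 1]])
        (use key[of 1 1] in \<open>auto intro!: AE_I2 intro: order_trans[OF _ abs_ge_self]\<close>)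
  define a b where "a = lp_norm q \<mu> f" and "b = lp_norm p \<mu> g"
  have "a \<ge> 0" "b \<ge> 0" by (auto simp: a_def b_def lp_norm_nonneg)
  then consider "a = 0" | "b = 0" | "a > 0" "b > 0" by linarith
  then show "(\<integral>x. \<bar>f x * g x\<bar> \<partial>\<mu>) \<le> lp_norm q \<mu> f * lp_norm p \<mu> g"
  proof cases
    case 1
    then have "AE x in \<mu>. f x = 0" using lp_norm_eq_0[OF f] pq by (auto simp: a_def)
    then have "(\<integral>x. \<bar>f x * g x\<bar> \<partial>\<mu>) = 0" by (intro integral_eq_zero_AE) auto
    then show ?thesis by (simp add: lp_norm_nonneg)
  next
    case 2
    then have "AE x in \<mu>. g x = 0" using lp_norm_eq_0[OF g] pq by (auto simp: b_def)
    then have "(\<integral>x. \<bar>f x * g x\<bar> \<partial>\<mu>) = 0" by (intro integral_eq_zero_AE) auto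
    then show ?thesis by (simp add: lp_norm_nonneg)
  next
    case 3
    have af: "(\<integral>x. (\<bar>f x\<bar> / a) powr q \<partial>\<mu>) = 1"
      using 3 pq lp_norm_powr[of q \<mu> f, symmetric] by (simp add: powr_divide a_def[symmetric])
    have bg: "(\<integral>x. (\<bar>g x\<bar> / b) powr p \<partial>\<mu>) = 1"
      using 3 pq lp_norm_powr[of p \<mu> g, symmetric] by (simp add: powr_divide b_def[symmetric])
    have "(\<integral>x. \<bar>f x * g x\<bar> \<partial>\<mu>) \<le> (\<integral>x. a * b * ((\<bar>f x\<bar> / a) powr q / q + (\<bar>g x\<bar> / b) powr p / p) \<partial>\<mu>)"
      by (rule integral_mono[OF _ I]) (use key 3 fg in auto)
    also have "\<dots> = a * b * ((\<integral>x. (\<bar>f x\<bar> / a) powr q \<partial>\<mu>) / q + (\<integral>x. (\<bar>g x\<bar> / b) powr p \<partial>\<mu>) / p)"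
      using If Ig 3 by (subst integral_mult_right_zero, subst Bochner_Integration.integral_add) (auto simp: powr_divide)
    also have "\<dots> = a * b" unfolding af bg using pq by (simp add: add.commute)
    finally show ?thesis by (simp add: a_def b_def)
  qed
qed

text \<open>The rate \<open>(1 / 4)\<^sup>n\<close> leaves room for a factor \<open>2\<^sup>n\<close>: the series of the \<open>\<bar>2\<^sup>n f\<^sub>n\<bar>\<^sup>p\<close> still has a finite
integral, and \<open>G\<close> is the \<open>p\<close>-th root of its sum. One function thus controls the pointwise decay and
the \<open>L\<^sup>p\<close> decay at once.\<close>

lemma geometric_decay_dominated:
  fixes f :: "nat \<Rightarrow> 'a \<Rightarrow> real"
  assumes f: "\<And>n. lp_fun p \<mu> (f n)" and p: "1 \<le> p"
    and le: "\<And>n. lp_norm p \<mu> (f n) \<le> (1 / 4) ^ n"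
  obtains G where "lp_fun p \<mu> G" "AE x in \<mu>. 0 \<le> G x \<and> (\<forall>n. \<bar>f n x\<bar> \<le> (1 / 2) ^ n * G x)"
proof -
  define k where "k n x = 2 ^ n * f n x" for n x
  have k: "lp_fun p \<mu> (k n)" for n unfolding k_def using lp_scale[OF f] p by auto
  have kn: "lp_norm p \<mu> (k n) \<le> (1 / 2) ^ n" for n
  proof -
    have "lp_norm p \<mu> (k n) = 2 ^ n * lp_norm p \<mu> (f n)"
      unfolding k_def using lp_scale(2)[OF f] p by simp
    also have "\<dots> \<le> 2 ^ n * (1 / 4) ^ n" using le by simp
    also have "\<dots> = (1 / 2) ^ n" by (simp flip: power_mult_distrib)
    finally show ?thesis .
  qed
  have [measurable]: "k n \<in> borel_measurable \<mu>" for n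
    using k by (auto simp: lp_fun_def)
  have int: "integrable \<mu> (\<lambda>x. \<bar>k n x\<bar> powr p)" for n using k by (simp add: lp_fun_def)
  have b: "(\<integral>\<^sup>+x. ennreal (\<bar>k n x\<bar> powr p) \<partial>\<mu>) \<le> ennreal ((1/2) ^ n)" for n
  proof -
    have "(\<integral>x. \<bar>k n x\<bar> powr p \<partial>\<mu>) = lp_norm p \<mu> (k n) powr p"
      using p by (simp add: lp_norm_powr)
    also have "\<dots> \<le> ((1/2) ^ n) powr p"
      using p kn lp_norm_nonneg by (intro powr_mono2) auto
    also have "\<dots> \<le> (1/2)^n"
      using powr_mono'[of 1 p "(1/2::real)^n"] p by (simp add: power_le_one)
    finally show ?thesis
      using nn_integral_eq_integral[OF int] by (simp add: ennreal_leI)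
  qed
  have "(\<integral>\<^sup>+x. (\<Sum>n. ennreal (\<bar>k n x\<bar> powr p)) \<partial>\<mu>) = (\<Sum>n. (\<integral>\<^sup>+x. ennreal (\<bar>k n x\<bar> powr p) \<partial>\<mu>))"
    by (intro nn_integral_suminf) auto
  also have "\<dots> \<le> (\<Sum>n. ennreal ((1/2)^n))"
    by (intro suminf_le) (use b in auto)
  also have "\<dots> = ennreal (\<Sum>n. (1/2)^n)"
    by (intro suminf_ennreal2) (auto intro: summable_geometric)
  also have "\<dots> < \<infinity>" by simp
  finally have fin: "(\<integral>\<^sup>+x. (\<Sum>n. ennreal (\<bar>k n x\<bar> powr p)) \<partial>\<mu>) < \<infinity>" .
  then have "AE x in \<mu>. (\<Sum>n. ennreal (\<bar>k n x\<bar> powr p)) \<noteq> \<infinity>"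
    by (intro nn_integral_PInf_AE) auto
  then have sm: "AE x in \<mu>. summable (\<lambda>n. \<bar>k n x\<bar> powr p)"
    by eventually_elim (auto intro!: summable_suminf_not_top simp: infinity_ennreal_def)
  define W where "W x = (\<Sum>n. \<bar>k n x\<bar> powr p)" for x
  have [measurable]: "W \<in> borel_measurable \<mu>" unfolding W_def by measurable
  have W0: "AE x in \<mu>. 0 \<le> W x" using sm by eventually_elim (simp add: W_def suminf_nonneg)
  have Wint: "integrable \<mu> W"
  proof (rule integrableI_nonneg)
    have "AE x in \<mu>. ennreal (W x) = (\<Sum>n. ennreal (\<bar>k n x\<bar> powr p))"
      using sm by eventually_elim (simp add: W_def suminf_ennreal2)
    then show "(\<integral>\<^sup>+x. ennreal (W x) \<partial>\<mu>) < \<infinity>"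
      using fin by (subst nn_integral_cong_AE)
  qed (use W0 in auto)
  define G where "G x = W x powr (1 / p)" for x
  show thesis
  proof
    have "AE x in \<mu>. W x = \<bar>G x\<bar> powr p"
      using W0 by eventually_elim (use p in \<open>simp add: G_def powr_powr\<close>)
    then have "integrable \<mu> (\<lambda>x. \<bar>G x\<bar> powr p)"
      using Wint by (rule integrable_cong_AE_imp[rotated 2]) (simp add: G_def)
    then show "lp_fun p \<mu> G" by (simp add: lp_fun_def G_def[abs_def])
    show "AE x in \<mu>. 0 \<le> G x \<and> (\<forall>n. \<bar>f n x\<bar> \<le> (1 / 2) ^ n * G x)"
      using sm
    proof eventually_elim
      case (elim x)
      have "\<bar>f n x\<bar> \<le> (1 / 2) ^ n * G x" for n
      proof -
        have "\<bar>k n x\<bar> powr p \<le> W x"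
          unfolding W_def using sum_le_suminf[OF elim, of "{n}"] by simp
        then have "(\<bar>k n x\<bar> powr p) powr (1 / p) \<le> G x"
          unfolding G_def using p by (intro powr_mono2) auto
        then have "\<bar>k n x\<bar> \<le> G x" using p by (simp add: powr_powr)
        then show ?thesis by (simp add: k_def abs_mult field_simps)
      qed
      then show ?case by (simp add: G_def)
    qed
  qed
qed

lemma geometric_decay_AE_tendsto_0:
  fixes f :: "nat \<Rightarrow> 'a \<Rightarrow> real"
  assumes f: "\<And>n. lp_fun p \<mu> (f n)" and p: "1 \<le> p"
    and le: "\<And>n. lp_norm p \<mu> (f n) \<le> (1 / 4) ^ n"
  shows "AE x in \<mu>. (\<lambda>n. f n x) \<longlonglongrightarrow> 0"
proof -
  obtain G where "AE x in \<mu>. 0 \<le> G x \<and> (\<forall>n. \<bar>f n x\<bar> \<le> (1 / 2) ^ n * G x)"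
    using geometric_decay_dominated[OF f p le] by blast
  then show ?thesis
  proof eventually_elim
    case (elim x)
    have "(\<lambda>n. (1 / 2) ^ n * G x) \<longlonglongrightarrow> 0 * G x"
      by (intro tendsto_mult tendsto_const LIMSEQ_power_zero) simp
    then have "(\<lambda>n. (1 / 2) ^ n * G x) \<longlonglongrightarrow> 0" by simp
    with _ show ?case
      by (rule Lim_null_comparison) (use elim in simp)
  qed
qed

section \<open>Suprema over a \<open>\<sigma>\<close>-finite measure\<close>

text \<open>The essential supremum of a directed family is reached along a sequence. Integrating \<open>arctan \<circ> f\<close>
against an integrable positive weight \<open>w\<close> gives a strictly monotone bounded functional \<open>I\<close>; an
increasing sequence that maximises \<open>I\<close> cannot be exceeded on a set of positive measure by a member
of the family, since then a larger member would exceed the maximum.\<close>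

lemma (in sigma_finite_measure) directed_sup_sequence:
  fixes F :: "('a \<Rightarrow> real) set"
  assumes ne: "F \<noteq> {}" and meas: "F \<subseteq> borel_measurable M"
    and dir: "\<And>f g. f \<in> F \<Longrightarrow> g \<in> F \<Longrightarrow> \<exists>h\<in>F. AE x in M. f x \<le> h x \<and> g x \<le> h x"
  obtains u :: "nat \<Rightarrow> 'a \<Rightarrow> real" where "range u \<subseteq> F" "AE x in M. incseq (\<lambda>n. u n x)"
    "\<And>f. f \<in> F \<Longrightarrow> AE x in M. ereal (f x) \<le> (SUP n. ereal (u n x))"
proof -
  obtain w0 where w0[measurable]: "w0 \<in> borel_measurable M" "integral\<^sup>N M w0 \<noteq> \<infinity>"
    and w0pos: "\<And>x. x \<in> space M \<Longrightarrow> 0 < w0 x \<and> w0 x < \<infinity>"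
    using Ex_finite_integrable_function by blast
  define w where "w x = enn2real (w0 x)" for x
  have [measurable]: "w \<in> borel_measurable M" unfolding w_def by measurable
  have wpos: "w x > 0" if "x \<in> space M" for x
    using w0pos[OF that] by (simp add: w_def enn2real_positive_iff less_top)
  have wn: "w x \<ge> 0" for x by (simp add: w_def)
  have wint: "integrable M w"
  proof (rule integrableI_nonneg)
    have "(\<integral>\<^sup>+x. ennreal (w x) \<partial>M) = integral\<^sup>N M w0"
      by (intro nn_integral_cong) (use w0pos in \<open>auto simp: w_def less_top\<close>)
    then show "(\<integral>\<^sup>+x. ennreal (w x) \<partial>M) < \<infinity>" using w0(2) by (simp add: less_top)
  qed (use wn in auto)
  define I where "I f = (\<integral>x. w x * arctan (f x) \<partial>M)" for f
  have int: "integrable M (\<lambda>x. w x * arctan (f x))" if [measurable]: "f \<in> borel_measurable M" for f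
  proof (rule Bochner_Integration.integrable_bound[of _ "\<lambda>x. w x * 2"])
    have "\<bar>arctan r\<bar> \<le> 2" for r using arctan_ubound[of r] arctan_lbound[of r] pi_half_less_two by linarith
    then show "AE x in M. norm (w x * arctan (f x)) \<le> norm (w x * 2)"
      using wn by (auto simp: abs_mult intro!: AE_I2 mult_left_mono)
  qed (use wint in auto)
  have mono: "I f \<le> I g" if "f \<in> borel_measurable M" "g \<in> borel_measurable M" "AE x in M. f x \<le> g x" for f g
    unfolding I_def
    by (rule integral_mono_AE[OF int int]) (use that wn in \<open>auto elim!: eventually_mono intro!: mult_left_mono simp: arctan_le_iff\<close>)
  have bdd: "bdd_above (I ` F)"
  proof (rule bdd_aboveI2)
    fix f assume "f \<in> F"
    then have f: "f \<in> borel_measurable M" using meas by auto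
    show "I f \<le> (\<integral>x. w x * 2 \<partial>M)"
      unfolding I_def
    proof (rule integral_mono[OF int[OF f]])
      fix x show "w x * arctan (f x) \<le> w x * 2"
        using wn arctan_ubound[of "f x"] pi_half_less_two by (intro mult_left_mono) linarith+
    qed (use wint in auto)
  qed
  define s where "s = (SUP f\<in>F. I f)"
  have "\<exists>f\<in>F. s - 1 / Suc n < I f" for n
    using less_cSUP_iff[OF ne bdd, of "s - 1 / Suc n"] by (simp add: s_def)
  then obtain f where fF: "\<And>n. f n \<in> F" and fs: "\<And>n. s - 1 / Suc n < I (f n)" by metis
  define j where "j g h = (SOME k. k \<in> F \<and> (AE x in M. g x \<le> k x \<and> h x \<le> k x))" for g h
  have j: "j g h \<in> F" "AE x in M. g x \<le> j g h x \<and> h x \<le> j g h x" if "g \<in> F" "h \<in> F" for g h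
    using someI_ex[of "\<lambda>k. k \<in> F \<and> (AE x in M. g x \<le> k x \<and> h x \<le> k x)"] dir[OF that]
    unfolding j_def by blast+
  define u where "u = rec_nat (f 0) (\<lambda>n k. j k (f (Suc n)))"
  have u0: "u 0 = f 0" and uS: "u (Suc n) = j (u n) (f (Suc n))" for n by (simp_all add: u_def)
  have uF: "u n \<in> F" for n by (induction n) (auto simp: u0 uS fF j)
  have um[measurable]: "u n \<in> borel_measurable M" for n using uF meas by auto
  have "AE x in M. \<forall>n. u n x \<le> u (Suc n) x"
    unfolding AE_all_countable using j(2)[OF uF fF] by (auto simp: uS elim!: eventually_mono)
  then have inc: "AE x in M. incseq (\<lambda>n. u n x)"
    by eventually_elim (auto intro: incseq_SucI)
  have fu: "AE x in M. f n x \<le> u n x" for n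
    by (cases n) (use j(2)[OF uF fF] in \<open>auto simp: u0 uS elim!: eventually_mono\<close>)
  have fm: "f n \<in> borel_measurable M" for n using fF meas by auto
  have Iu: "s - 1 / Suc n < I (u n)" for n
    using mono[OF fm um fu, of n] fs[of n] by linarith
  have Iu_le: "I (u n) \<le> s" for n unfolding s_def by (rule cSUP_upper[OF uF bdd])
  have lim: "(\<lambda>n. I (u n)) \<longlonglongrightarrow> s"
  proof (rule tendsto_sandwich[OF _ _ _ tendsto_const])
    show "(\<lambda>n. s - 1 / real (Suc n)) \<longlonglongrightarrow> s"
      using tendsto_diff[OF tendsto_const[of s] LIMSEQ_Suc[OF lim_1_over_n]] by simp
  qed (use Iu Iu_le in \<open>auto intro!: always_eventually less_imp_le\<close>)
  show thesis
  proof
    show "range u \<subseteq> F" using uF by auto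
    show "AE x in M. incseq (\<lambda>n. u n x)" by (rule inc)
    fix h assume h: "h \<in> F"
    then have hm[measurable]: "h \<in> borel_measurable M" using meas by auto
    define m where "m n x = max (u n x) (h x)" for n x
    have [measurable]: "m n \<in> borel_measurable M" for n unfolding m_def by measurable
    have Im: "I (m n) \<le> s" for n
    proof -
      have "I (m n) \<le> I (j (u n) h)"
        by (rule mono) (use j[OF uF h] meas in \<open>auto simp: m_def elim!: eventually_mono\<close>)
      also have "\<dots> \<le> s" unfolding s_def by (rule cSUP_upper[OF j(1)[OF uF h] bdd])
      finally show ?thesis .
    qed
    define d where "d n x = w x * (arctan (m n x) - arctan (u n x))" for n x
    have [measurable]: "d n \<in> borel_measurable M" for n unfolding d_def by measurable
    have dn: "d n x \<ge> 0" for n x unfolding d_def m_def using wn by (simp add: arctan_le_iff)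
    have dint: "integrable M (d n)" for n
      unfolding d_def right_diff_distrib using int by auto
    have dI: "(\<integral>x. d n x \<partial>M) = I (m n) - I (u n)" for n
      unfolding d_def right_diff_distrib I_def using int by (intro Bochner_Integration.integral_diff) auto
    \<comment> \<open>At a point where \<open>h\<close> exceeds the supremum, every \<open>d n\<close> is at least one positive number, so
    \<open>e\<close> is positive there; but \<open>e\<close> has integral zero.\<close>
    define e where "e x = (INF n. ennreal (d n x))" for x
    have [measurable]: "e \<in> borel_measurable M" unfolding e_def by measurable
    have "(\<integral>\<^sup>+x. e x \<partial>M) \<le> ennreal (1 / Suc n)" for n
    proof -
      have "(\<integral>\<^sup>+x. e x \<partial>M) \<le> (\<integral>\<^sup>+x. ennreal (d n x) \<partial>M)"
        unfolding e_def by (intro nn_integral_mono INF_lower) auto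
      also have "\<dots> = ennreal (I (m n) - I (u n))"
        using nn_integral_eq_integral[OF dint] dn dI by simp
      also have "\<dots> \<le> ennreal (1 / Suc n)" using Im[of n] Iu[of n] by (intro ennreal_leI) linarith
      finally show ?thesis .
    qed
    then have "(\<integral>\<^sup>+x. e x \<partial>M) \<le> 0"
      by (intro tendsto_lowerbound[of "\<lambda>n. ennreal (1 / Suc n)"])
        (use tendsto_ennrealI[OF LIMSEQ_Suc[OF lim_1_over_n]] in auto)
    then have "AE x in M. e x = 0" by (simp add: nn_integral_0_iff_AE)
    then show "AE x in M. ereal (h x) \<le> (SUP n. ereal (u n x))"
      using inc AE_space
    proof eventually_elim
      case (elim x)
      show ?case
      proof (rule ccontr)
        assume "\<not> ?thesis"
        then have lt: "(SUP n. ereal (u n x)) < ereal (h x)" by simp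
        have ul: "ereal (u n x) \<le> (SUP n. ereal (u n x))" for n by (rule SUP_upper) auto
        then obtain r where r: "(SUP n. ereal (u n x)) = ereal r"
          using lt ul[of 0] by (cases "SUP n. ereal (u n x)") auto
        have ur: "u n x \<le> r" for n using ul[of n] r by simp
        have rh: "r < h x" using lt r by simp
        have "ennreal (w x * (arctan (h x) - arctan r)) \<le> e x"
          unfolding e_def
        proof (rule INF_greatest)
          fix n
          have "m n x = h x" using ur[of n] rh by (simp add: m_def)
          then show "ennreal (w x * (arctan (h x) - arctan r)) \<le> ennreal (d n x)"
            unfolding d_def using ur[of n] wn by (intro ennreal_leI mult_left_mono) (auto simp: arctan_le_iff)
        qed
        then have "w x * (arctan (h x) - arctan r) \<le> 0" using elim by (simp only: ennreal_eq_0_iff le_zero_eq)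
        moreover have "w x * (arctan (h x) - arctan r) > 0"
          using wpos[of x] elim rh by (simp add: arctan_less_iff)
        ultimately show False by simp
      qed
    qed
  qed
qed

text \<open>The converse of Hoelder's inequality for an increasing sequence, testing only with bounded
nonnegative functions. The test function for \<open>u\<^sub>k\<close> is \<open>m\<^sub>k\<^sup>q\<^sup>-\<^sup>1\<close>, where \<open>m\<^sub>k\<close> truncates \<open>u\<^sub>k\<close> in value and to
a set of finite measure: it yields \<open>I\<^sub>k \<le> C I\<^sub>k\<^bsup>1/p\<^esup>\<close> for the finite number \<open>I\<^sub>k = \<integral> m\<^sub>k\<^sup>q\<close>. The last
conclusion says that \<open>g\<close> is the least nonnegative pointwise upper bound.\<close>

lemma (in sigma_finite_measure) Lq_limit_by_duality:
  fixes u :: "nat \<Rightarrow> 'a \<Rightarrow> real"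
  assumes pq: "1 < p" "1 < q" "1 / p + 1 / q = 1" and C: "0 \<le> C"
    and um: "\<And>n. u n \<in> borel_measurable M" and inc: "AE x in M. incseq (\<lambda>n. u n x)"
    and test: "\<And>n h K. lp_fun p M h \<Longrightarrow> (\<forall>x. 0 \<le> h x \<and> h x \<le> K) \<Longrightarrow>
      integrable M (\<lambda>x. h x * u n x) \<and> (\<integral>x. h x * u n x \<partial>M) \<le> C * lp_norm p M h"
  obtains g where "lp_fun q M g" "lp_norm q M g \<le> C" "\<forall>x. 0 \<le> g x"
    "AE x in M. (\<forall>n. u n x \<le> g x) \<and> (\<forall>b\<ge>0. (\<forall>n. u n x \<le> b) \<longrightarrow> g x \<le> b)"
proof -
  note [measurable] = um
  obtain B :: "nat \<Rightarrow> 'a set" where B: "range B \<subseteq> sets M" "(\<Union>i. B i) = space M"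
    "\<And>i. emeasure M (B i) \<noteq> \<infinity>" "incseq B"
    using sigma_finite_incseq by metis
  have [measurable]: "B k \<in> sets M" for k using B(1) by auto
  \<comment> \<open>Using \<open>u\<^sub>k\<close> at the same index as the truncation avoids a separate limit in \<open>k\<close>.\<close>
  define m where "m k x = indicator (B k) x * min (max (u k x) 0) (real k)" for k x
  have [measurable]: "m k \<in> borel_measurable M" for k unfolding m_def by measurable
  have m0: "0 \<le> m k x" for k x by (simp add: m_def)
  have mk: "m k x \<le> k" for k x by (auto simp: m_def indicator_def)
  have qq: "(q - 1) * p = q" using pq by (simp add: field_simps)
  have mq_int: "integrable M (\<lambda>x. m k x powr q)" for k
  proof (rule Bochner_Integration.integrable_bound[of _ "\<lambda>x. real k powr q * indicator (B k) x"])
    show "integrable M (\<lambda>x. real k powr q * indicator (B k) x)"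
      using B(3)[of k] by (simp add: less_top)
    show "AE x in M. norm (m k x powr q) \<le> norm (real k powr q * indicator (B k) x)"
      using mk m0 pq by (auto intro!: AE_I2 powr_mono2 simp: indicator_def m_def)
  qed measurable
  define I where "I k = (\<integral>x. m k x powr q \<partial>M)" for k
  have I0: "0 \<le> I k" for k by (simp add: I_def)
  have I_le: "I k \<le> C powr q" for k
  proof -
    define h where "h x = m k x powr (q - 1)" for x
    have hp: "\<bar>h x\<bar> powr p = m k x powr q" for x by (simp add: h_def powr_powr qq)
    have h: "lp_fun p M h" unfolding lp_fun_def hp using mq_int by (simp add: h_def[abs_def])
    have hK: "\<forall>x. 0 \<le> h x \<and> h x \<le> real k powr (q - 1)"
      unfolding h_def using mk m0 pq by (auto intro: powr_mono2)
    have le: "m k x powr q \<le> h x * u k x" for x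
    proof (cases "m k x = 0")
      case False
      then have pos: "m k x > 0" using m0[of k x] by linarith
      then have mu: "m k x \<le> u k x" by (auto simp: m_def indicator_def split: if_splits)
      have "m k x powr q = h x * m k x" using pos powr_mult_base[of "m k x" "q - 1"] by (simp add: h_def mult.commute)
      also have "\<dots> \<le> h x * u k x" using mu hK by (intro mult_left_mono) auto
      finally show ?thesis .
    qed (use pq in \<open>simp add: h_def\<close>)
    have "I k \<le> (\<integral>x. h x * u k x \<partial>M)"
      unfolding I_def using test[OF h hK] mq_int le by (intro integral_mono) auto
    also have "\<dots> \<le> C * lp_norm p M h" using test[OF h hK] by blast
    also have "lp_norm p M h = I k powr (1 / p)" by (simp add: lp_norm_def hp I_def)
    finally have *: "I k \<le> C * I k powr (1 / p)" .
    show ?thesis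
    proof (cases "I k = 0")
      case False
      then have pos: "I k > 0" using I0[of k] by linarith
      have "1 / q = 1 - 1 / p" using pq by simp
      then have "I k powr (1 / q) = I k / I k powr (1 / p)" using pos by (simp add: powr_diff)
      also have "\<dots> \<le> C" using * pos by (simp add: divide_le_eq)
      finally have "(I k powr (1 / q)) powr q \<le> C powr q" using pq by (intro powr_mono2) auto
      then show ?thesis using pq pos by (simp add: powr_powr)
    qed simp
  qed
  \<comment> \<open>Finiteness of \<open>W\<close> almost everywhere is what shows that \<open>u\<close> is bounded at almost every point.\<close>
  define W where "W x = (SUP k. ennreal (m k x powr q))" for x
  have [measurable]: "W \<in> borel_measurable M" unfolding W_def by measurable
  have m_mono: "AE x in M. \<forall>k. m k x \<le> m (Suc k) x"
    using inc
  proof eventually_elim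
    case (elim x)
    show ?case
    proof
      fix k
      have "u k x \<le> u (Suc k) x" using incseq_SucD[OF elim, of k] by simp
      moreover have "B k \<subseteq> B (Suc k)" using B(4) by (simp add: incseq_SucD)
      ultimately show "m k x \<le> m (Suc k) x" by (auto simp: m_def indicator_def)
    qed
  qed
  have "(\<integral>\<^sup>+x. W x \<partial>M) = (SUP k. \<integral>\<^sup>+x. ennreal (m k x powr q) \<partial>M)"
    unfolding W_def
  proof (rule nn_integral_monotone_convergence_SUP_AE)
    show "AE x in M. ennreal (m k x powr q) \<le> ennreal (m (Suc k) x powr q)" for k
      using m_mono by eventually_elim (use m0 pq in \<open>auto intro!: ennreal_leI powr_mono2\<close>)
  qed measurable
  also have "\<dots> \<le> ennreal (C powr q)"
  proof (rule SUP_least)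
    fix k
    have "(\<integral>\<^sup>+x. ennreal (m k x powr q) \<partial>M) = ennreal (I k)"
      unfolding I_def by (rule nn_integral_eq_integral[OF mq_int]) simp
    then show "(\<integral>\<^sup>+x. ennreal (m k x powr q) \<partial>M) \<le> ennreal (C powr q)"
      using I_le[of k] by (simp add: ennreal_leI)
  qed
  finally have W_int: "(\<integral>\<^sup>+x. W x \<partial>M) \<le> ennreal (C powr q)" .
  then have "(\<integral>\<^sup>+x. W x \<partial>M) \<noteq> \<infinity>" by (metis ennreal_less_top infinity_ennreal_def leD)
  then have W_fin: "AE x in M. W x \<noteq> \<infinity>" by (rule nn_integral_PInf_AE[rotated]) measurable
  define g where "g x = max (lim (\<lambda>n. max (u n x) 0)) 0" for x
  have [measurable]: "g \<in> borel_measurable M" unfolding g_def by measurable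
  have key: "AE x in M. ennreal (g x powr q) \<le> W x \<and> (\<forall>n. u n x \<le> g x) \<and> (\<forall>b\<ge>0. (\<forall>n. u n x \<le> b) \<longrightarrow> g x \<le> b)"
    using W_fin inc AE_space
  proof eventually_elim
    case (elim x)
    then obtain r where r: "W x = ennreal r" "0 \<le> r" by (cases "W x") auto
    have mr: "m k x \<le> r powr (1 / q)" for k
    proof -
      have "ennreal (m k x powr q) \<le> ennreal r" unfolding r(1)[symmetric] W_def by (rule SUP_upper) simp
      then have "(m k x powr q) powr (1 / q) \<le> r powr (1 / q)" using r(2) pq by (intro powr_mono2) auto
      then show ?thesis using pq m0 by (simp add: powr_powr)
    qed
    obtain k0 where k0: "x \<in> B k0" using elim(3) B(2) by blast
    obtain k1 :: nat where k1: "r powr (1 / q) < k1" using reals_Archimedean2 by blast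
    have mu: "m k x = max (u k x) 0" if "k \<ge> max k0 k1" for k
    proof -
      have "x \<in> B k" using k0 incseqD[OF B(4), of k0 k] that by auto
      then have "m k x = min (max (u k x) 0) (real k)" by (simp add: m_def)
      moreover have "m k x < k" using mr[of k] k1 that by simp
      ultimately show ?thesis by (simp add: min_def split: if_splits)
    qed
    have uinc: "incseq (\<lambda>n. max (u n x) 0)" using elim(2) by (auto simp: incseq_def intro: max.coboundedI1)
    have ub: "max (u n x) 0 \<le> r powr (1 / q)" for n
    proof -
      have "max (u n x) 0 \<le> max (u (max n (max k0 k1)) x) 0" using incseqD[OF uinc] by simp
      also have "\<dots> \<le> r powr (1 / q)" using mu[of "max n (max k0 k1)"] mr[of "max n (max k0 k1)"] by simp
      finally show ?thesis .
    qed
    obtain l where l: "(\<lambda>n. max (u n x) 0) \<longlonglongrightarrow> l" "\<And>n. max (u n x) 0 \<le> l"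
      using incseq_convergent[OF uinc, of "r powr (1 / q)"] ub by blast
    have l0: "0 \<le> l" using l(2)[of 0] by simp
    have gl: "g x = l" unfolding g_def limI[OF l(1)] using l0 by simp
    have "g x \<le> r powr (1 / q)"
      unfolding gl using l(1) ub by (intro LIMSEQ_le_const2) auto
    then have "g x powr q \<le> (r powr (1 / q)) powr q"
      using l0 pq gl by (intro powr_mono2) auto
    then have "ennreal (g x powr q) \<le> W x" using r pq by (simp add: powr_powr ennreal_leI)
    moreover have "u n x \<le> g x" for n using l(2)[of n] by (simp add: gl)
    moreover have "g x \<le> b" if "0 \<le> b" "\<forall>n. u n x \<le> b" for b
      unfolding gl using l(1) that by (intro LIMSEQ_le_const2) auto
    ultimately show ?case by blast
  qed
  have g0: "0 \<le> g x" for x by (simp add: g_def)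
  have gi: "(\<integral>\<^sup>+x. ennreal (g x powr q) \<partial>M) \<le> ennreal (C powr q)"
  proof -
    have "(\<integral>\<^sup>+x. ennreal (g x powr q) \<partial>M) \<le> (\<integral>\<^sup>+x. W x \<partial>M)"
      by (intro nn_integral_mono_AE eventually_mono[OF key]) blast
    then show ?thesis using W_int by (rule order_trans)
  qed
  have int: "integrable M (\<lambda>x. g x powr q)"
    by (rule integrableI_nonneg) (use gi in \<open>auto intro: le_less_trans\<close>)
  have "lp_norm q M g \<le> (C powr q) powr (1 / q)"
  proof -
    have "ennreal (\<integral>x. g x powr q \<partial>M) \<le> ennreal (C powr q)"
      using gi nn_integral_eq_integral[OF int] by simp
    then have "(\<integral>x. g x powr q \<partial>M) \<le> C powr q" by (simp add: ennreal_le_iff)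
    then show ?thesis unfolding lp_norm_def using g0 pq by (intro powr_mono2) auto
  qed
  then have le: "lp_norm q M g \<le> C" using C pq by (simp add: powr_powr)
  have lp: "lp_fun q M g" using int g0 by (simp add: lp_fun_def)
  have "AE x in M. (\<forall>n. u n x \<le> g x) \<and> (\<forall>b\<ge>0. (\<forall>n. u n x \<le> b) \<longrightarrow> g x \<le> b)"
    using key by eventually_elim blast
  then show thesis by (rule that[OF lp le allI[OF g0]])
qed

section \<open>Classes of measurable functions\<close>

lemma ae_rel_equiv: "equiv (borel_measurable \<mu>) (ae_rel \<mu>)"
proof (rule equivI)
  show "sym (ae_rel \<mu>)" by (auto simp: ae_rel_def sym_on_def intro: AE_symmetric)
  show "trans (ae_rel \<mu>)"
  proof (rule transI)
    fix f g h assume "(f, g) \<in> ae_rel \<mu>" "(g, h) \<in> ae_rel \<mu>"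
    moreover from this have "AE x in \<mu>. f x = g x" "AE x in \<mu>. g x = h x" by (auto simp: ae_rel_def)
    then have "AE x in \<mu>. f x = h x" by eventually_elim simp
    ultimately show "(f, h) \<in> ae_rel \<mu>" by (auto simp: ae_rel_def)
  qed
qed (auto simp: ae_rel_def refl_on_def)

lemma cls_in_L0: "f \<in> borel_measurable \<mu> \<Longrightarrow> cls \<mu> f \<in> L0 \<mu>"
  by (auto simp: L0_def cls_def quotient_def)

lemma rep_mem:
  assumes "F \<in> L0 \<mu>" shows "rep F \<in> F"
proof -
  obtain f where "f \<in> borel_measurable \<mu>" "F = ae_rel \<mu> `` {f}"
    using assms by (auto simp: L0_def quotient_def)
  then have "f \<in> F" by (auto simp: ae_rel_def)
  then show ?thesis unfolding rep_def by (rule someI[of "\<lambda>f. f \<in> F"])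
qed

lemma rep_meas: "F \<in> L0 \<mu> \<Longrightarrow> rep F \<in> borel_measurable \<mu>"
  using rep_mem[of F \<mu>] by (auto simp: L0_def quotient_def ae_rel_def)

lemma cls_rep:
  assumes "F \<in> L0 \<mu>" shows "cls \<mu> (rep F) = F"
proof -
  obtain f where f: "f \<in> borel_measurable \<mu>" "F = ae_rel \<mu> `` {f}"
    using assms by (auto simp: L0_def quotient_def)
  then have "(f, rep F) \<in> ae_rel \<mu>" using rep_mem[OF assms] by auto
  then show ?thesis unfolding cls_def f(2) by (rule equiv_class_eq[OF ae_rel_equiv, symmetric])
qed

lemma cls_eq:
  assumes "f \<in> borel_measurable \<mu>" "g \<in> borel_measurable \<mu>" "AE x in \<mu>. f x = g x"
  shows "cls \<mu> f = cls \<mu> g"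
  unfolding cls_def using assms
  by (intro equiv_class_eq[OF ae_rel_equiv]) (auto simp: ae_rel_def)

lemma L0_eqI:
  assumes "F \<in> L0 \<mu>" "G \<in> L0 \<mu>" "AE x in \<mu>. rep F x = rep G x"
  shows "F = G"
  using cls_eq[OF rep_meas rep_meas, OF assms] assms by (simp add: cls_rep)

lemma AE_rep_cls:
  assumes "f \<in> borel_measurable \<mu>" shows "AE x in \<mu>. rep (cls \<mu> f) x = f x"
  using rep_mem[OF cls_in_L0[OF assms]] by (auto simp: cls_def ae_rel_def elim: eventually_mono)

lemma add_cls_L0: "F \<in> L0 \<mu> \<Longrightarrow> G \<in> L0 \<mu> \<Longrightarrow> add_cls \<mu> F G \<in> L0 \<mu>"
  and mult_cls_L0: "F \<in> L0 \<mu> \<Longrightarrow> G \<in> L0 \<mu> \<Longrightarrow> mult_cls \<mu> F G \<in> L0 \<mu>"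
  and abs_cls_L0: "F \<in> L0 \<mu> \<Longrightarrow> abs_cls \<mu> F \<in> L0 \<mu>"
  and const_cls_L0: "const_cls \<mu> c \<in> L0 \<mu>"
  unfolding add_cls_def mult_cls_def abs_cls_def const_cls_def
  by (auto intro!: cls_in_L0 borel_measurable_add borel_measurable_times borel_measurable_abs rep_meas)

lemma AE_add_cls: "F \<in> L0 \<mu> \<Longrightarrow> G \<in> L0 \<mu> \<Longrightarrow> AE x in \<mu>. rep (add_cls \<mu> F G) x = rep F x + rep G x"
  and AE_mult_cls: "F \<in> L0 \<mu> \<Longrightarrow> G \<in> L0 \<mu> \<Longrightarrow> AE x in \<mu>. rep (mult_cls \<mu> F G) x = rep F x * rep G x"
  and AE_abs_cls: "F \<in> L0 \<mu> \<Longrightarrow> AE x in \<mu>. rep (abs_cls \<mu> F) x = \<bar>rep F x\<bar>"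
  and AE_const_cls: "AE x in \<mu>. rep (const_cls \<mu> c) x = c"
  unfolding add_cls_def mult_cls_def abs_cls_def const_cls_def
  by (intro AE_rep_cls borel_measurable_add borel_measurable_times borel_measurable_abs rep_meas borel_measurable_const; assumption)+

lemma Lp_norm_eq: "Lp_norm p \<mu> F = lp_norm p \<mu> (rep F)"
  by (simp add: Lp_norm_def lp_norm_def)

lemma Lp_set_iff: "F \<in> Lp_set p \<mu> \<longleftrightarrow> F \<in> L0 \<mu> \<and> lp_fun p \<mu> (rep F)"
  by (auto simp: Lp_set_def lp_fun_def rep_meas)

lemma Lp_set_L0: "F \<in> Lp_set p \<mu> \<Longrightarrow> F \<in> L0 \<mu>"
  by (simp add: Lp_set_iff)

lemma AE_cong_AE:
  assumes "AE x in \<mu>. P x \<longleftrightarrow> Q x" shows "(AE x in \<mu>. P x) \<longleftrightarrow> (AE x in \<mu>. Q x)"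
proof
  assume "AE x in \<mu>. P x" with assms show "AE x in \<mu>. Q x" by eventually_elim simp
next
  assume "AE x in \<mu>. Q x" with assms show "AE x in \<mu>. P x" by eventually_elim simp
qed

lemma le_const_cls_iff: "le_cls \<mu> (const_cls \<mu> c) F \<longleftrightarrow> (AE x in \<mu>. c \<le> rep F x)"
  "le_cls \<mu> F (const_cls \<mu> c) \<longleftrightarrow> (AE x in \<mu>. rep F x \<le> c)"
  unfolding le_cls_def using AE_const_cls[of \<mu> c]
  by (auto intro!: AE_cong_AE elim!: eventually_mono)

lemma Lp_pos_iff: "F \<in> Lp_pos p \<mu> \<longleftrightarrow> F \<in> L0 \<mu> \<and> lp_fun p \<mu> (rep F) \<and> (AE x in \<mu>. 0 \<le> rep F x)"
  by (simp add: Lp_pos_def Lp_set_iff le_const_cls_iff conj_assoc)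

lemma Lp_pos_L0: "F \<in> Lp_pos p \<mu> \<Longrightarrow> F \<in> L0 \<mu>"
  by (simp add: Lp_pos_iff)

lemma cls_Lp_set:
  assumes "lp_fun p \<mu> f" shows "cls \<mu> f \<in> Lp_set p \<mu>"
proof -
  have m: "f \<in> borel_measurable \<mu>" using assms by (rule lp_fun_meas)
  have "lp_fun p \<mu> (rep (cls \<mu> f))"
    using assms rep_meas[OF cls_in_L0[OF m]] AE_symmetric[OF AE_rep_cls[OF m]] by (rule lp_fun_cong)
  then show ?thesis using cls_in_L0[OF m] by (simp add: Lp_set_iff)
qed

lemma cls_Lp_pos:
  assumes "lp_fun p \<mu> f" "AE x in \<mu>. 0 \<le> f x" shows "cls \<mu> f \<in> Lp_pos p \<mu>"
proof -
  have "AE x in \<mu>. 0 \<le> rep (cls \<mu> f) x"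
    using AE_rep_cls[OF lp_fun_meas[OF assms(1)]] assms(2) by eventually_elim simp
  then show ?thesis using cls_Lp_set[OF assms(1)] by (simp add: Lp_pos_iff Lp_set_iff)
qed

lemma Linf_carrier: "f \<in> carrier (Linf \<mu>) \<longleftrightarrow> f \<in> L0 \<mu> \<and> (\<exists>C. AE x in \<mu>. \<bar>rep f x\<bar> \<le> C)"
  by (simp add: Linf_def)

lemma Linf_L0: "f \<in> carrier (Linf \<mu>) \<Longrightarrow> f \<in> L0 \<mu>"
  by (simp add: Linf_def)

lemma Linf_simps [simp]: "f \<otimes>\<^bsub>Linf \<mu>\<^esub> g = mult_cls \<mu> f g" "f \<oplus>\<^bsub>Linf \<mu>\<^esub> g = add_cls \<mu> f g"
  "\<one>\<^bsub>Linf \<mu>\<^esub> = const_cls \<mu> 1" "\<zero>\<^bsub>Linf \<mu>\<^esub> = const_cls \<mu> 0"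
  by (simp_all add: Linf_def)

lemma Linf_boundE:
  assumes "f \<in> carrier (Linf \<mu>)"
  obtains C where "C > 0" "AE x in \<mu>. \<bar>rep f x\<bar> \<le> C"
proof -
  obtain C where "AE x in \<mu>. \<bar>rep f x\<bar> \<le> C" using assms by (auto simp: Linf_carrier)
  then have "AE x in \<mu>. \<bar>rep f x\<bar> \<le> max C 1" by eventually_elim auto
  then show thesis by (rule that[rotated]) simp
qed

lemma cls_Linf:
  assumes "f \<in> borel_measurable \<mu>" "AE x in \<mu>. \<bar>f x\<bar> \<le> C"
  shows "cls \<mu> f \<in> carrier (Linf \<mu>)"
proof -
  have "AE x in \<mu>. \<bar>rep (cls \<mu> f) x\<bar> \<le> C"
    using AE_rep_cls[OF assms(1)] assms(2) by eventually_elim simp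
  then show ?thesis using assms by (auto simp: Linf_carrier cls_in_L0)
qed

lemma const_Linf: "const_cls \<mu> c \<in> carrier (Linf \<mu>)"
  unfolding const_cls_def by (rule cls_Linf[of _ _ "\<bar>c\<bar>"]) auto

lemma Lp_simps [simp]: "carrier (Lp p \<mu>) = Lp_set p \<mu>" "\<zero>\<^bsub>Lp p \<mu>\<^esub> = const_cls \<mu> 0"
  "F \<oplus>\<^bsub>Lp p \<mu>\<^esub> G = add_cls \<mu> F G" "f \<odot>\<^bsub>Lp p \<mu>\<^esub> F = mult_cls \<mu> f F" "nrm (Lp p \<mu>) F = Lp_norm p \<mu> F"
  by (simp_all add: Lp_def)

lemma lp_fun_1: "lp_fun 1 \<mu> f \<longleftrightarrow> integrable \<mu> f"
  unfolding lp_fun_def by (auto simp: integrable_abs_iff)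

lemma Lp1_iff: "F \<in> Lp_set 1 \<mu> \<longleftrightarrow> F \<in> L0 \<mu> \<and> integrable \<mu> (rep F)"
  by (simp add: Lp_set_iff lp_fun_1)

lemma lp_norm_1: "lp_norm 1 \<mu> f = (\<integral>x. \<bar>f x\<bar> \<partial>\<mu>)"
  by (simp add: lp_norm_def abs_of_nonneg)

lemma const_0_Lp1: "const_cls \<mu> 0 \<in> Lp_set 1 \<mu>"
  unfolding const_cls_def by (rule cls_Lp_set) (simp add: lp_fun_1)

lemma add_Lp1: "F \<in> Lp_set 1 \<mu> \<Longrightarrow> G \<in> Lp_set 1 \<mu> \<Longrightarrow> add_cls \<mu> F G \<in> Lp_set 1 \<mu>"
  unfolding add_cls_def by (rule cls_Lp_set) (simp add: lp_fun_1 Lp1_iff)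

lemma Lp1_neg:
  assumes "F \<in> Lp_set 1 \<mu>"
  shows "cls \<mu> (\<lambda>x. - rep F x) \<in> Lp_set 1 \<mu>" "add_cls \<mu> (cls \<mu> (\<lambda>x. - rep F x)) F = const_cls \<mu> 0"
proof -
  have L: "F \<in> L0 \<mu>" using assms by (rule Lp_set_L0)
  have m: "(\<lambda>x. - rep F x) \<in> borel_measurable \<mu>" using rep_meas[OF L] by measurable
  show "cls \<mu> (\<lambda>x. - rep F x) \<in> Lp_set 1 \<mu>"
    using assms by (intro cls_Lp_set) (simp add: lp_fun_1 Lp1_iff)
  show "add_cls \<mu> (cls \<mu> (\<lambda>x. - rep F x)) F = const_cls \<mu> 0"
    by (rule L0_eqI[OF add_cls_L0[OF cls_in_L0[OF m] L] const_cls_L0])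
      (use AE_add_cls[OF cls_in_L0[OF m] L] AE_const_cls[of \<mu> 0] AE_rep_cls[OF m] in
        \<open>eventually_elim, simp\<close>)
qed

lemma Lp1_abelian_group: "abelian_group (Lp 1 \<mu>)"
proof (rule abelian_groupI, unfold Lp_simps)
  fix F G H assume F: "F \<in> Lp_set 1 \<mu>"
  show "\<exists>K\<in>Lp_set 1 \<mu>. add_cls \<mu> K F = const_cls \<mu> 0" using Lp1_neg[OF F] by blast
  note L = Lp_set_L0[OF F]
  show "add_cls \<mu> (const_cls \<mu> 0) F = F"
    by (rule L0_eqI[OF add_cls_L0[OF const_cls_L0 L] L])
      (use AE_add_cls[OF const_cls_L0 L, of 0] AE_const_cls[of \<mu> 0] in \<open>eventually_elim, simp\<close>)
  assume G: "G \<in> Lp_set 1 \<mu>"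
  show "add_cls \<mu> F G \<in> Lp_set 1 \<mu>" using F G by (rule add_Lp1)
  show "add_cls \<mu> F G = add_cls \<mu> G F" by (simp add: add_cls_def add.commute)
  assume H: "H \<in> Lp_set 1 \<mu>"
  note L3 = L Lp_set_L0[OF G] Lp_set_L0[OF H]
  show "add_cls \<mu> (add_cls \<mu> F G) H = add_cls \<mu> F (add_cls \<mu> G H)"
    by (rule L0_eqI[OF add_cls_L0[OF add_cls_L0[OF L3(1,2)] L3(3)] add_cls_L0[OF L3(1) add_cls_L0[OF L3(2,3)]]])
      (use AE_add_cls[OF add_cls_L0[OF L3(1,2)] L3(3)] AE_add_cls[OF L3(1) add_cls_L0[OF L3(2,3)]]
          AE_add_cls[OF L3(1,2)] AE_add_cls[OF L3(2,3)] in \<open>eventually_elim, simp\<close>)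
qed (rule const_0_Lp1)

lemma Lp1_minus:
  assumes "F \<in> Lp_set 1 \<mu>" "G \<in> Lp_set 1 \<mu>"
  shows "F \<ominus>\<^bsub>Lp 1 \<mu>\<^esub> G \<in> Lp_set 1 \<mu>" "AE x in \<mu>. rep (F \<ominus>\<^bsub>Lp 1 \<mu>\<^esub> G) x = rep F x - rep G x"
proof -
  interpret A: abelian_group "Lp 1 \<mu>" by (rule Lp1_abelian_group)
  have inv: "\<ominus>\<^bsub>Lp 1 \<mu>\<^esub> G = cls \<mu> (\<lambda>x. - rep G x)"
    by (rule A.minus_equality) (use Lp1_neg[OF assms(2)] assms(2) in auto)
  show "F \<ominus>\<^bsub>Lp 1 \<mu>\<^esub> G \<in> Lp_set 1 \<mu>" using A.minus_closed assms by simp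
  have m: "(\<lambda>x. - rep G x) \<in> borel_measurable \<mu>" using rep_meas[OF Lp_set_L0[OF assms(2)]] by measurable
  show "AE x in \<mu>. rep (F \<ominus>\<^bsub>Lp 1 \<mu>\<^esub> G) x = rep F x - rep G x"
    unfolding a_minus_def inv Lp_simps
    using AE_add_cls[OF Lp_set_L0[OF assms(1)] cls_in_L0[OF m]] AE_rep_cls[OF m]
    by eventually_elim simp
qed

lemma add_const_cls: "add_cls \<mu> (const_cls \<mu> a) (const_cls \<mu> b) = const_cls \<mu> (a + b)"
  by (rule L0_eqI[OF add_cls_L0[OF const_cls_L0 const_cls_L0] const_cls_L0])
    (use AE_add_cls[OF const_cls_L0 const_cls_L0, of \<mu> a b] AE_const_cls[of \<mu> a]
        AE_const_cls[of \<mu> b] AE_const_cls[of \<mu> "a + b"] in \<open>eventually_elim, simp\<close>)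

lemma AE_all_rats:
  assumes "\<And>c. c \<in> \<rat> \<Longrightarrow> AE x in \<mu>. P c x"
  shows "AE x in \<mu>. \<forall>c\<in>\<rat>. P (c :: real) x"
  unfolding AE_ball_countable[OF countable_rat] using assms by blast

text \<open>Together with \<open>AE_all_rats\<close>, this allows a constant coefficient in an almost everywhere
estimate to be replaced by a function: the exceptional set must not depend on the constant, so
countably many constants have to suffice.\<close>

lemma le_rat_approx:
  fixes f a b g :: real
  assumes "\<And>c. c \<in> \<rat> \<Longrightarrow> \<bar>a + c * b\<bar> \<le> d + \<bar>f - c\<bar> * g"
  shows "\<bar>a + f * b\<bar> \<le> d"
proof -
  have "f \<in> closure \<rat>" by (simp add: Rats_closure_real)
  then obtain c where c: "\<forall>n::nat. c n \<in> \<rat>" "c \<longlonglongrightarrow> f"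
    unfolding closure_sequential by (elim exE conjE)
  have "(\<lambda>n. \<bar>a + c n * b\<bar>) \<longlonglongrightarrow> \<bar>a + f * b\<bar>"
    by (intro tendsto_rabs tendsto_add tendsto_mult tendsto_const c(2))
  moreover have "(\<lambda>n. d + \<bar>f - c n\<bar> * g) \<longlonglongrightarrow> d + \<bar>f - f\<bar> * g"
    by (intro tendsto_rabs tendsto_add tendsto_diff tendsto_mult tendsto_const c(2))
  ultimately have "\<bar>a + f * b\<bar> \<le> d + \<bar>f - f\<bar> * g"
    by (rule LIMSEQ_le) (use assms c(1) in blast)
  then show ?thesis by simp
qed

lemma ess_inf_eqI:
  assumes "G \<in> S" "S \<subseteq> L0 \<mu>" "\<And>F. F \<in> S \<Longrightarrow> le_cls \<mu> G F"
  shows "ess_inf \<mu> S = G"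
  unfolding ess_inf_def
proof (rule the_equality)
  show "G \<in> L0 \<mu> \<and> (\<forall>F\<in>S. le_cls \<mu> G F) \<and> (\<forall>H\<in>L0 \<mu>. (\<forall>F\<in>S. le_cls \<mu> H F) \<longrightarrow> le_cls \<mu> H G)"
    using assms by blast
  fix G' assume G': "G' \<in> L0 \<mu> \<and> (\<forall>F\<in>S. le_cls \<mu> G' F) \<and> (\<forall>H\<in>L0 \<mu>. (\<forall>F\<in>S. le_cls \<mu> H F) \<longrightarrow> le_cls \<mu> H G')"
  then have "le_cls \<mu> G' G" "le_cls \<mu> G G'" using assms by blast+
  then have "AE x in \<mu>. rep G' x = rep G x" unfolding le_cls_def by eventually_elim simp
  then show "G' = G" using G' assms by (intro L0_eqI) auto
qed

lemma ess_sup_eqI: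
  assumes "G \<in> L0 \<mu>" "\<And>F. F \<in> S \<Longrightarrow> le_cls \<mu> F G"
    and "\<And>H. H \<in> L0 \<mu> \<Longrightarrow> (\<And>F. F \<in> S \<Longrightarrow> le_cls \<mu> F H) \<Longrightarrow> le_cls \<mu> G H"
  shows "ess_sup \<mu> S = G"
  unfolding ess_sup_def
proof (rule the_equality)
  show "G \<in> L0 \<mu> \<and> (\<forall>F\<in>S. le_cls \<mu> F G) \<and> (\<forall>H\<in>L0 \<mu>. (\<forall>F\<in>S. le_cls \<mu> F H) \<longrightarrow> le_cls \<mu> G H)"
    using assms by blast
  fix G' assume G': "G' \<in> L0 \<mu> \<and> (\<forall>F\<in>S. le_cls \<mu> F G') \<and> (\<forall>H\<in>L0 \<mu>. (\<forall>F\<in>S. le_cls \<mu> F H) \<longrightarrow> le_cls \<mu> G' H)"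
  then have "le_cls \<mu> G' G" "le_cls \<mu> G G'" using assms by blast+
  then have "AE x in \<mu>. rep G' x = rep G x" unfolding le_cls_def by eventually_elim simp
  then show "G' = G" using G' assms(1) by (intro L0_eqI) auto
qed

section \<open>The pointwise norm of a normed module\<close>

context Lp_normed_module
begin

abbreviation pn :: "'m \<Rightarrow> 'a \<Rightarrow> real" where "pn v \<equiv> rep (pnorm V v)"

lemma pn_L0: "v \<in> carrier V \<Longrightarrow> pnorm V v \<in> L0 \<mu>"
  using pnorm_in by (rule Lp_pos_L0)

lemma pn_meas: "v \<in> carrier V \<Longrightarrow> pn v \<in> borel_measurable \<mu>"
  by (rule rep_meas[OF pn_L0])

lemma pn_nonneg: "v \<in> carrier V \<Longrightarrow> AE x in \<mu>. 0 \<le> pn v x"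
  using pnorm_in by (simp add: Lp_pos_iff)

lemma pn_lp: "v \<in> carrier V \<Longrightarrow> lp_fun p \<mu> (pn v)"
  using pnorm_in by (simp add: Lp_pos_iff)

lemma nrm_lp: "v \<in> carrier V \<Longrightarrow> nrm V v = lp_norm p \<mu> (pn v)"
  by (simp add: nrm_eq Lp_norm_eq)

lemma nrm_nonneg: "v \<in> carrier V \<Longrightarrow> 0 \<le> nrm V v"
  by (simp add: nrm_lp lp_norm_nonneg)

lemma pn_smult:
  assumes "f \<in> carrier (Linf \<mu>)" "v \<in> carrier V"
  shows "AE x in \<mu>. pn (f \<odot>\<^bsub>V\<^esub> v) x = \<bar>rep f x\<bar> * pn v x"
  using AE_mult_cls[OF abs_cls_L0[OF Linf_L0[OF assms(1)]] pn_L0[OF assms(2)]]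
    AE_abs_cls[OF Linf_L0[OF assms(1)]]
  unfolding pnorm_smult[OF assms] by eventually_elim simp

lemma pn_zero: "AE x in \<mu>. pn \<zero>\<^bsub>V\<^esub> x = 0"
proof -
  have "AE x in \<mu>. pn (const_cls \<mu> 0 \<odot>\<^bsub>V\<^esub> \<zero>\<^bsub>V\<^esub>) x = 0"
    using pn_smult[OF const_Linf[of \<mu> 0] M.zero_closed] AE_const_cls[of \<mu> 0]
    by eventually_elim simp
  then show ?thesis by (simp add: smult_r_null[OF const_Linf])
qed

lemma eq_zero_if_pn_zero:
  assumes "v \<in> carrier V" "AE x in \<mu>. pn v x = 0" "p > 0"
  shows "v = \<zero>\<^bsub>V\<^esub>"
  using assms lp_norm_eq_0[OF pn_lp[OF assms(1)] assms(3)] nrm_eq_0_iff[OF assms(1)]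
  by (simp add: nrm_lp)

lemma minus_eq_smult:
  assumes "v \<in> carrier V" shows "\<ominus>\<^bsub>V\<^esub> v = const_cls \<mu> (- 1) \<odot>\<^bsub>V\<^esub> v"
proof (rule M.minus_equality)
  have "const_cls \<mu> (- 1) \<odot>\<^bsub>V\<^esub> v \<oplus>\<^bsub>V\<^esub> const_cls \<mu> 1 \<odot>\<^bsub>V\<^esub> v = add_cls \<mu> (const_cls \<mu> (- 1)) (const_cls \<mu> 1) \<odot>\<^bsub>V\<^esub> v"
    using smult_l_distr[OF const_Linf const_Linf assms, of "-1" 1] by simp
  also have "\<dots> = \<zero>\<^bsub>V\<^esub>"
    using smult_l_null[OF assms] by (simp add: add_const_cls)
  finally show "const_cls \<mu> (- 1) \<odot>\<^bsub>V\<^esub> v \<oplus>\<^bsub>V\<^esub> v = \<zero>\<^bsub>V\<^esub>"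
    using smult_one[OF assms] by simp
qed (use assms const_Linf in auto)

lemma pn_uminus:
  assumes "v \<in> carrier V" shows "AE x in \<mu>. pn (\<ominus>\<^bsub>V\<^esub> v) x = pn v x"
  using pn_smult[OF const_Linf assms, of "-1"] AE_const_cls[of \<mu> "-1"]
  unfolding minus_eq_smult[OF assms] by eventually_elim simp

text \<open>The axioms give the triangle inequality for the norm only. Where it fails pointwise there are
rationals with \<open>\<bar>v\<bar> \<le> a\<close>, \<open>\<bar>w\<bar> \<le> b\<close> and \<open>\<bar>v + w\<bar> \<ge> c > a + b\<close>. On the set \<open>E\<close> of these points
\<open>\<bar>v\<bar> \<le> (a / c) \<bar>v + w\<bar>\<close> and likewise for \<open>w\<close>, so the norm inequality for the multiples by the
indicator of \<open>E\<close> forces \<open>E\<close> to be a null set.\<close>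

lemma pn_triangle:
  assumes v: "v \<in> carrier V" and w: "w \<in> carrier V" and p: "p > 0"
  shows "AE x in \<mu>. pn (v \<oplus>\<^bsub>V\<^esub> w) x \<le> pn v x + pn w x"
proof -
  have vw: "v \<oplus>\<^bsub>V\<^esub> w \<in> carrier V" using v w by simp
  note [measurable] = pn_meas[OF v] pn_meas[OF w] pn_meas[OF vw]
  have null: "AE x in \<mu>. \<not> (pn v x \<le> a \<and> pn w x \<le> b \<and> c \<le> pn (v \<oplus>\<^bsub>V\<^esub> w) x)"
    if abc: "0 \<le> a" "0 \<le> b" "a + b < c" for a b c
  proof -
    define E where "E = {x \<in> space \<mu>. pn v x \<le> a \<and> pn w x \<le> b \<and> c \<le> pn (v \<oplus>\<^bsub>V\<^esub> w) x}"
    have [measurable]: "E \<in> sets \<mu>" unfolding E_def by measurable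
    define f where "f = cls \<mu> (indicator E)"
    have f: "f \<in> carrier (Linf \<mu>)" unfolding f_def by (rule cls_Linf[of _ _ 1]) (auto simp: indicator_def)
    have rf: "AE x in \<mu>. rep f x = indicator E x" unfolding f_def by (rule AE_rep_cls) measurable
    have pf: "AE x in \<mu>. pn (f \<odot>\<^bsub>V\<^esub> u) x = indicator E x * pn u x" if "u \<in> carrier V" for u
      using pn_smult[OF f that] rf by eventually_elim (auto simp: indicator_def)
    define h where "h x = indicator E x * pn (v \<oplus>\<^bsub>V\<^esub> w) x" for x
    have [measurable]: "h \<in> borel_measurable \<mu>" unfolding h_def by measurable
    have h: "lp_fun p \<mu> h"
      by (rule lp_fun_cong[OF pn_lp[of "f \<odot>\<^bsub>V\<^esub> (v \<oplus>\<^bsub>V\<^esub> w)"]])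
        (use f vw pf[OF vw] in \<open>auto simp: h_def[abs_def]\<close>)
    have c0: "c > 0" using abc by linarith
    have le: "nrm V (f \<odot>\<^bsub>V\<^esub> u) \<le> d / c * lp_norm p \<mu> h"
      if u: "u \<in> carrier V" and d: "0 \<le> d" and ud: "\<And>x. x \<in> E \<Longrightarrow> pn u x \<le> d" for u d
    proof -
      have fu: "f \<odot>\<^bsub>V\<^esub> u \<in> carrier V" using f u by simp
      have "lp_norm p \<mu> (pn (f \<odot>\<^bsub>V\<^esub> u)) \<le> lp_norm p \<mu> (\<lambda>x. d / c * h x)"
      proof (rule lp_fun_mono(2)[OF lp_scale(1)[OF h p] pn_meas[OF fu] _ p])
        show "AE x in \<mu>. \<bar>pn (f \<odot>\<^bsub>V\<^esub> u) x\<bar> \<le> \<bar>d / c * h x\<bar>"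
          using pf[OF u] pn_nonneg[OF u]
        proof eventually_elim
          case (elim x)
          show ?case
          proof (cases "x \<in> E")
            case True
            then have "d / c * c \<le> d / c * h x"
              using d c0 by (intro mult_left_mono) (auto simp: h_def E_def)
            then have "d \<le> d / c * h x" using c0 by simp
            moreover have "pn (f \<odot>\<^bsub>V\<^esub> u) x = pn u x" using elim True by simp
            ultimately show ?thesis using elim(2) ud[OF True] by linarith
          qed (use elim in auto)
        qed
      qed
      then show ?thesis using lp_scale(2)[OF h p, of "d / c"] d c0 by (simp add: nrm_lp[OF fu])
    qed
    have "lp_norm p \<mu> h = nrm V (f \<odot>\<^bsub>V\<^esub> (v \<oplus>\<^bsub>V\<^esub> w))"
      unfolding nrm_lp[OF smult_closed[OF f vw]]
      by (rule lp_norm_cong) (use pf[OF vw] f vw pn_meas in \<open>auto simp: h_def AE_symmetric\<close>)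
    also have "\<dots> \<le> nrm V (f \<odot>\<^bsub>V\<^esub> v) + nrm V (f \<odot>\<^bsub>V\<^esub> w)"
      using nrm_triangle[of "f \<odot>\<^bsub>V\<^esub> v" "f \<odot>\<^bsub>V\<^esub> w"] smult_r_distr[OF f v w] f v w by simp
    also have "\<dots> \<le> a / c * lp_norm p \<mu> h + b / c * lp_norm p \<mu> h"
      by (intro add_mono le) (use v w abc in \<open>auto simp: E_def\<close>)
    finally have "(1 - (a + b) / c) * lp_norm p \<mu> h \<le> 0" by (simp add: algebra_simps add_divide_distrib)
    moreover have "1 - (a + b) / c > 0" using abc c0 by simp
    ultimately have "lp_norm p \<mu> h = 0"
      using lp_norm_nonneg[of p \<mu> h] by (simp add: mult_le_0_iff)
    then have "AE x in \<mu>. h x = 0" using lp_norm_eq_0[OF h p] by simp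
    then show ?thesis using AE_space
      by eventually_elim (use c0 in \<open>auto simp: h_def E_def indicator_def split: if_splits\<close>)
  qed
  have "AE x in \<mu>. \<forall>a\<in>\<rat>. \<forall>b\<in>\<rat>. \<forall>c\<in>\<rat>. 0 \<le> a \<and> 0 \<le> b \<and> a + b < c \<longrightarrow>
      \<not> (pn v x \<le> a \<and> pn w x \<le> b \<and> c \<le> pn (v \<oplus>\<^bsub>V\<^esub> w) x)"
  proof (intro AE_all_rats)
    fix a b c :: real
    show "AE x in \<mu>. 0 \<le> a \<and> 0 \<le> b \<and> a + b < c \<longrightarrow> \<not> (pn v x \<le> a \<and> pn w x \<le> b \<and> c \<le> pn (v \<oplus>\<^bsub>V\<^esub> w) x)"
      using null[of a b c] by (cases "0 \<le> a \<and> 0 \<le> b \<and> a + b < c") auto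
  qed
  then show ?thesis using pn_nonneg[OF v] pn_nonneg[OF w]
  proof eventually_elim
    case (elim x)
    show ?case
    proof (rule ccontr)
      assume "\<not> ?thesis"
      then have d: "0 < pn (v \<oplus>\<^bsub>V\<^esub> w) x - pn v x - pn w x" (is "0 < ?d") by simp
      obtain a where a: "a \<in> \<rat>" "pn v x < a" "a < pn v x + ?d / 2"
        using Rats_dense_in_real[of "pn v x" "pn v x + ?d / 2"] d by auto
      obtain b where b: "b \<in> \<rat>" "pn w x < b" "b < pn w x + ?d / 2"
        using Rats_dense_in_real[of "pn w x" "pn w x + ?d / 2"] d by auto
      have "a + b < pn (v \<oplus>\<^bsub>V\<^esub> w) x" using a b by argo
      then obtain c where c: "c \<in> \<rat>" "a + b < c" "c < pn (v \<oplus>\<^bsub>V\<^esub> w) x"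
        using Rats_dense_in_real by blast
      have "\<not> (pn v x \<le> a \<and> pn w x \<le> b \<and> c \<le> pn (v \<oplus>\<^bsub>V\<^esub> w) x)"
        using elim(1)[rule_format, OF a(1) b(1) c(1)] c elim(2,3) a(2) b(2) by linarith
      then show False using a b c by simp
    qed
  qed
qed

lemma pn_minus_triangle:
  assumes u: "u \<in> carrier V" and v: "v \<in> carrier V" and w: "w \<in> carrier V" and p: "p > 0"
  shows "AE x in \<mu>. pn (u \<ominus>\<^bsub>V\<^esub> v) x \<le> pn (w \<ominus>\<^bsub>V\<^esub> u) x + pn (w \<ominus>\<^bsub>V\<^esub> v) x"
proof -
  have eq: "u \<ominus>\<^bsub>V\<^esub> v = \<ominus>\<^bsub>V\<^esub> (w \<ominus>\<^bsub>V\<^esub> u) \<oplus>\<^bsub>V\<^esub> (w \<ominus>\<^bsub>V\<^esub> v)"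
  proof -
    have "\<ominus>\<^bsub>V\<^esub> (w \<ominus>\<^bsub>V\<^esub> u) = u \<oplus>\<^bsub>V\<^esub> \<ominus>\<^bsub>V\<^esub> w"
      using u w by (simp add: a_minus_def M.minus_add M.a_comm)
    then show ?thesis using u v w by (simp add: a_minus_def M.a_assoc M.r_neg1)
  qed
  have c: "w \<ominus>\<^bsub>V\<^esub> u \<in> carrier V" "w \<ominus>\<^bsub>V\<^esub> v \<in> carrier V" using u v w by simp_all
  show ?thesis unfolding eq
    using pn_triangle[OF M.a_inv_closed[OF c(1)] c(2) p] pn_uminus[OF c(1)] by eventually_elim simp
qed

lemma AE_pn_tendsto_0:
  assumes "\<And>n. w n \<in> carrier V" "\<And>n. nrm V (w n) \<le> (1 / 4) ^ n" "1 \<le> p"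
  shows "AE x in \<mu>. (\<lambda>n. pn (w n) x) \<longlonglongrightarrow> 0"
  by (rule geometric_decay_AE_tendsto_0[OF pn_lp assms(3)]) (use assms nrm_lp in auto)

end

text \<open>Two records that describe the same module may still have different norms outside the carrier.\<close>

lemma Lp_normed_module_cong:
  fixes V W :: "('a fclass, 'm) normed_mod"
  assumes V: "Lp_normed_module p \<mu> V"
    and eq: "carrier W = carrier V" "\<zero>\<^bsub>W\<^esub> = \<zero>\<^bsub>V\<^esub>" "add W = add V" "smult W = smult V"
    and n: "\<And>v. v \<in> carrier V \<Longrightarrow> nrm W v = nrm V v" "\<And>v. v \<in> carrier V \<Longrightarrow> pnorm W v = pnorm V v"
  shows "Lp_normed_module p \<mu> W"
proof -
  interpret V: Lp_normed_module p \<mu> V by (rule V)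
  have monoid: "add_monoid W = add_monoid V" using eq by simp
  have minus: "v \<ominus>\<^bsub>W\<^esub> w = v \<ominus>\<^bsub>V\<^esub> w" for v w by (simp add: a_minus_def a_inv_def monoid eq)
  have ag: "abelian_group W"
    using V.M.abelian_group_axioms
    by (simp add: abelian_group_def abelian_monoid_def abelian_group_axioms_def monoid)
  have md: "Module.module (Linf \<mu>) W"
    using V.R.cring_axioms ag
  proof (rule moduleI)
  qed (simp_all add: eq V.smult_l_distr V.smult_r_distr V.smult_assoc1 V.smult_one[simplified] del: Linf_simps)
  show ?thesis
  proof (intro Lp_normed_module.intro banach_Linf_module.intro md
      Lp_normed_module_axioms.intro banach_Linf_module_axioms.intro)
    fix v assume "v \<in> carrier W"
    then have v: "v \<in> carrier V" by (simp add: eq)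
    show "nrm W v = 0 \<longleftrightarrow> v = \<zero>\<^bsub>W\<^esub>" using V.nrm_eq_0_iff v by (simp add: n eq)
    show "nrm W (rscale \<mu> W c v) = \<bar>c\<bar> * nrm W v" for c
      using V.nrm_rscale[OF v, of c] v by (simp add: n eq rscale_def const_Linf)
    show "nrm W (v \<oplus>\<^bsub>W\<^esub> w) \<le> nrm W v + nrm W w" if "w \<in> carrier W" for w
      using V.nrm_triangle[OF v] v that by (simp add: n eq)
    show "pnorm W v \<in> Lp_pos p \<mu>" "nrm W v = Lp_norm p \<mu> (pnorm W v)"
      using V.pnorm_in V.nrm_eq v by (simp_all add: n)
    show "pnorm W (f \<odot>\<^bsub>W\<^esub> v) = mult_cls \<mu> (abs_cls \<mu> f) (pnorm W v)" if "f \<in> carrier (Linf \<mu>)" for f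
      using V.pnorm_smult[OF that v] v that by (simp add: n eq)
  next
    fix u :: "nat \<Rightarrow> 'm"
    assume "range u \<subseteq> carrier W" and c: "\<And>e. e > 0 \<Longrightarrow> \<exists>N. \<forall>m\<ge>N. \<forall>n\<ge>N. nrm W (u m \<ominus>\<^bsub>W\<^esub> u n) < e"
    then have u: "range u \<subseteq> carrier V" by (simp add: eq)
    then have uV: "u n \<in> carrier V" for n by auto
    obtain l where l: "l \<in> carrier V" "(\<lambda>n. nrm V (u n \<ominus>\<^bsub>V\<^esub> l)) \<longlonglongrightarrow> 0"
      using V.complete[OF u] c by (auto simp: n minus V.M.minus_closed[OF uV uV])
    then show "\<exists>l\<in>carrier W. (\<lambda>n. nrm W (u n \<ominus>\<^bsub>W\<^esub> l)) \<longlonglongrightarrow> 0"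
      by (auto simp: n minus V.M.minus_closed[OF uV] eq)
  qed
qed

section \<open>Local maps form a normed module\<close>

text \<open>That \<open>\<bar>v\<bar> \<circ> \<phi>\<close> lies in \<open>L\<^sup>p\<close> holds whenever a pullback exists, where it is the norm of \<open>\<Phi> v\<close>; it
pairs with local bounds in \<open>L\<^sup>q\<close>. The setting covers the identity map, and hence duals, as well.\<close>

locale local_maps = M: Module.module "Linf \<mu>X" M
  for \<mu>X :: "'x measure" and M :: "('x fclass, 'm) normed_mod" +
  fixes \<mu>Y :: "'y measure" and \<phi> :: "'y \<Rightarrow> 'x" and p q :: real
  assumes ring: "cring (Linf \<mu>Y)" and sf: "sigma_finite_measure \<mu>Y"
    and pq: "1 < p" "1 < q" "1 / p + 1 / q = 1"
    and comp_Lp: "v \<in> carrier M \<Longrightarrow> comp_cls \<mu>Y \<phi> (pnorm M v) \<in> Lp_pos p \<mu>Y"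
begin

abbreviation P :: "'m \<Rightarrow> 'y \<Rightarrow> real" where "P v \<equiv> rep (comp_cls \<mu>Y \<phi> (pnorm M v))"
abbreviation H :: "('y fclass, 'm \<Rightarrow> 'y fclass) normed_mod" where "H \<equiv> Hom_loc q \<mu>X \<mu>Y \<phi> M"

lemma rscale_closed: "v \<in> carrier M \<Longrightarrow> rscale \<mu>X M c v \<in> carrier M"
  by (simp add: rscale_def const_Linf)

lemma P_nonneg: "v \<in> carrier M \<Longrightarrow> AE y in \<mu>Y. 0 \<le> P v y"
  and P_lp: "v \<in> carrier M \<Longrightarrow> lp_fun p \<mu>Y (P v)"
  using comp_Lp[of v] by (auto simp: Lp_pos_iff)

definition bound :: "('m \<Rightarrow> 'y fclass) \<Rightarrow> ('y \<Rightarrow> real) \<Rightarrow> bool" where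
  "bound T g \<longleftrightarrow> lp_fun q \<mu>Y g \<and> (AE y in \<mu>Y. 0 \<le> g y) \<and>
     (\<forall>v\<in>carrier M. AE y in \<mu>Y. \<bar>rep (T v) y\<bar> \<le> g y * P v y)"

lemma boundD:
  assumes "bound T g"
  shows "lp_fun q \<mu>Y g" "g \<in> borel_measurable \<mu>Y" "AE y in \<mu>Y. 0 \<le> g y"
    "v \<in> carrier M \<Longrightarrow> AE y in \<mu>Y. \<bar>rep (T v) y\<bar> \<le> g y * P v y"
  using assms by (auto simp: bound_def lp_fun_meas)

lemma local_bounds_iff:
  assumes T: "\<And>v. v \<in> carrier M \<Longrightarrow> T v \<in> L0 \<mu>Y"
  shows "g \<in> local_bounds q \<mu>Y \<phi> M T \<longleftrightarrow> g \<in> L0 \<mu>Y \<and> bound T (rep g)"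
proof -
  have "le_cls \<mu>Y (abs_cls \<mu>Y (T v)) (mult_cls \<mu>Y g (comp_cls \<mu>Y \<phi> (pnorm M v))) \<longleftrightarrow>
      (AE y in \<mu>Y. \<bar>rep (T v) y\<bar> \<le> rep g y * P v y)"
    if g: "g \<in> L0 \<mu>Y" and v: "v \<in> carrier M" for v
    unfolding le_cls_def
  proof (rule AE_cong_AE)
    show "AE y in \<mu>Y. (rep (abs_cls \<mu>Y (T v)) y \<le> rep (mult_cls \<mu>Y g (comp_cls \<mu>Y \<phi> (pnorm M v))) y) =
        (\<bar>rep (T v) y\<bar> \<le> rep g y * P v y)"
      using AE_abs_cls[OF T[OF v]] AE_mult_cls[OF g Lp_pos_L0[OF comp_Lp[OF v]]]
      by eventually_elim simp
  qed
  then have "(\<forall>v\<in>carrier M. le_cls \<mu>Y (abs_cls \<mu>Y (T v)) (mult_cls \<mu>Y g (comp_cls \<mu>Y \<phi> (pnorm M v)))) \<longleftrightarrow>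
      (\<forall>v\<in>carrier M. AE y in \<mu>Y. \<bar>rep (T v) y\<bar> \<le> rep g y * P v y)" if "g \<in> L0 \<mu>Y"
    using that by (intro ball_cong refl) blast
  then show ?thesis unfolding local_bounds_def Lp_pos_iff bound_def mem_Collect_eq by blast
qed

lemma bound_cls:
  assumes "bound T g" shows "bound T (rep (cls \<mu>Y g))"
proof -
  note b = boundD[OF assms]
  have r: "AE y in \<mu>Y. rep (cls \<mu>Y g) y = g y" using b(2) by (rule AE_rep_cls)
  have "AE y in \<mu>Y. \<bar>rep (T v) y\<bar> \<le> rep (cls \<mu>Y g) y * P v y" if "v \<in> carrier M" for v
    using b(4)[OF that] r by eventually_elim simp
  moreover have "cls \<mu>Y g \<in> Lp_pos q \<mu>Y" using b(1,3) by (rule cls_Lp_pos)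
  ultimately show ?thesis by (auto simp: bound_def Lp_pos_iff)
qed

lemma local_bounds_nonempty_iff:
  assumes T: "\<And>v. v \<in> carrier M \<Longrightarrow> T v \<in> L0 \<mu>Y"
  shows "local_bounds q \<mu>Y \<phi> M T \<noteq> {} \<longleftrightarrow> (\<exists>g. bound T g)"
proof
  assume "local_bounds q \<mu>Y \<phi> M T \<noteq> {}"
  then obtain g where "g \<in> local_bounds q \<mu>Y \<phi> M T" by auto
  then have "bound T (rep g)" by (simp add: local_bounds_iff[OF T])
  then show "\<exists>g. bound T g" by blast
next
  assume "\<exists>g. bound T g"
  then obtain g where g: "bound T g" by blast
  have "cls \<mu>Y g \<in> local_bounds q \<mu>Y \<phi> M T"
    by (subst local_bounds_iff[OF T]) (auto intro: bound_cls[OF g] cls_in_L0[OF boundD(2)[OF g]])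
  then show "local_bounds q \<mu>Y \<phi> M T \<noteq> {}" by blast
qed

text \<open>Local bounds are stable under minima, so their negatives form a directed family. The limit of a
decreasing sequence of bounds is again a bound, which makes the infimum a minimum.\<close>

lemma minimal_bound:
  assumes "\<exists>g. bound T g"
  obtains g where "bound T g" "\<And>h. bound T h \<Longrightarrow> AE y in \<mu>Y. g y \<le> h y"
proof -
  interpret sigma_finite_measure \<mu>Y by (rule sf)
  define F where "F = {\<lambda>y. - g y | g. bound T g}"
  have F: "F \<noteq> {}" "F \<subseteq> borel_measurable \<mu>Y"
    using assms by (auto simp: F_def boundD)
  have dir: "\<exists>h\<in>F. AE x in \<mu>Y. f x \<le> h x \<and> g x \<le> h x" if fg: "f \<in> F" "g \<in> F" for f g
  proof -
    obtain a b where a: "f = (\<lambda>y. - a y)" "bound T a" and b: "g = (\<lambda>y. - b y)" "bound T b"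
      using fg unfolding F_def by blast
    note [measurable] = boundD(2)[OF a(2)] boundD(2)[OF b(2)]
    have "bound T (\<lambda>y. min (a y) (b y))"
      unfolding bound_def
    proof (intro conjI ballI)
      show "lp_fun q \<mu>Y (\<lambda>y. min (a y) (b y))"
      proof (rule lp_fun_mono(1)[OF boundD(1)[OF a(2)]])
        show "AE y in \<mu>Y. \<bar>min (a y) (b y)\<bar> \<le> \<bar>a y\<bar>"
          using boundD(3)[OF a(2)] boundD(3)[OF b(2)] by eventually_elim auto
      qed (use pq in auto)
      show "AE y in \<mu>Y. 0 \<le> min (a y) (b y)"
        using boundD(3)[OF a(2)] boundD(3)[OF b(2)] by eventually_elim auto
      fix v assume v: "v \<in> carrier M"
      show "AE y in \<mu>Y. \<bar>rep (T v) y\<bar> \<le> min (a y) (b y) * P v y"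
        using boundD(4)[OF a(2) v] boundD(4)[OF b(2) v] by eventually_elim (auto simp: min_def)
    qed
    then show ?thesis unfolding a(1) b(1) F_def by (intro bexI[of _ "\<lambda>y. - min (a y) (b y)"]) auto
  qed
  obtain u where u: "range u \<subseteq> F" and inc: "AE x in \<mu>Y. incseq (\<lambda>n. u n x)"
    and sup: "\<And>f. f \<in> F \<Longrightarrow> AE x in \<mu>Y. ereal (f x) \<le> (SUP n. ereal (u n x))"
    using directed_sup_sequence[OF F dir] by blast
  have um: "u n \<in> borel_measurable \<mu>Y" for n using u F by auto
  have ub: "bound T (\<lambda>y. - u n y)" for n
  proof -
    have "u n \<in> F" using u by auto
    then show ?thesis by (auto simp: F_def)
  qed
  define g where "g y = - lim (\<lambda>n. u n y)" for y
  have [measurable]: "g \<in> borel_measurable \<mu>Y" unfolding g_def using um by measurable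
  have "AE y in \<mu>Y. \<forall>n. 0 \<le> - u n y" unfolding AE_all_countable using boundD(3)[OF ub] by blast
  then have lim: "AE y in \<mu>Y. (\<lambda>n. u n y) \<longlonglongrightarrow> - g y \<and> (\<forall>n. u n y \<le> - g y) \<and> 0 \<le> g y"
    using inc
  proof eventually_elim
    case (elim y)
    have b: "u n y \<le> 0" for n using elim(1) by (simp add: le_minus_iff)
    obtain l where l: "(\<lambda>n. u n y) \<longlonglongrightarrow> l" "\<And>n. u n y \<le> l"
      using incseq_convergent[OF elim(2), of 0] b by blast
    have "l \<le> 0" using l(1) b by (intro LIMSEQ_le_const2) auto
    moreover have "- g y = l" unfolding g_def using limI[OF l(1)] by simp
    ultimately show ?case using l by auto
  qed
  have "bound T g"
    unfolding bound_def
  proof (intro conjI ballI)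
    show "lp_fun q \<mu>Y g"
    proof (rule lp_fun_mono(1)[OF boundD(1)[OF ub[of 0]]])
      show "AE y in \<mu>Y. \<bar>g y\<bar> \<le> \<bar>- u 0 y\<bar>"
        using lim
      proof eventually_elim
        case (elim y)
        then have "u 0 y \<le> - g y" by blast
        then show ?case using elim by linarith
      qed
    qed (use pq in auto)
    show "AE y in \<mu>Y. 0 \<le> g y" using lim by eventually_elim simp
    fix v assume v: "v \<in> carrier M"
    have "AE y in \<mu>Y. \<forall>n. \<bar>rep (T v) y\<bar> \<le> - u n y * P v y"
      unfolding AE_all_countable using boundD(4)[OF ub v] by blast
    then show "AE y in \<mu>Y. \<bar>rep (T v) y\<bar> \<le> g y * P v y"
      using lim
    proof eventually_elim
      case (elim y)
      have "(\<lambda>n. - u n y * P v y) \<longlonglongrightarrow> - (- g y) * P v y"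
        using elim by (intro tendsto_mult tendsto_minus tendsto_const) auto
      then show ?case using elim(1) by (intro LIMSEQ_le_const) auto
    qed
  qed
  moreover have "AE y in \<mu>Y. g y \<le> h y" if "bound T h" for h
  proof -
    have "(\<lambda>y. - h y) \<in> F" using that by (auto simp: F_def)
    from sup[OF this] lim show ?thesis
    proof eventually_elim
      case (elim y)
      have "(SUP n. ereal (u n y)) \<le> ereal (- g y)" using elim(2) by (intro SUP_least) simp
      with elim(1) have "ereal (- h y) \<le> ereal (- g y)" by (rule order_trans)
      then show ?case by simp
    qed
  qed
  ultimately show thesis by (rule that)
qed

lemma ess_inf_local_bounds:
  assumes T: "\<And>v. v \<in> carrier M \<Longrightarrow> T v \<in> L0 \<mu>Y" and b: "\<exists>g. bound T g"
  defines "G \<equiv> ess_inf \<mu>Y (local_bounds q \<mu>Y \<phi> M T)"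
  shows "G \<in> L0 \<mu>Y" "bound T (rep G)" "\<And>h. bound T h \<Longrightarrow> AE y in \<mu>Y. rep G y \<le> h y"
proof -
  obtain g where g: "bound T g" "\<And>h. bound T h \<Longrightarrow> AE y in \<mu>Y. g y \<le> h y"
    using minimal_bound[OF b] by blast
  note gm = boundD(2)[OF g(1)]
  have r: "AE y in \<mu>Y. rep (cls \<mu>Y g) y = g y" using gm by (rule AE_rep_cls)
  have min: "AE y in \<mu>Y. rep (cls \<mu>Y g) y \<le> h y" if "bound T h" for h
    using g(2)[OF that] r by eventually_elim simp
  have G: "G = cls \<mu>Y g"
    unfolding G_def
  proof (rule ess_inf_eqI)
    show "cls \<mu>Y g \<in> local_bounds q \<mu>Y \<phi> M T"
      by (subst local_bounds_iff[OF T]) (auto intro: bound_cls[OF g(1)] cls_in_L0[OF gm])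
    show "local_bounds q \<mu>Y \<phi> M T \<subseteq> L0 \<mu>Y" by (auto simp: local_bounds_iff[OF T])
    fix F assume "F \<in> local_bounds q \<mu>Y \<phi> M T"
    then show "le_cls \<mu>Y (cls \<mu>Y g) F"
      unfolding le_cls_def by (simp add: local_bounds_iff[OF T] min)
  qed
  show "G \<in> L0 \<mu>Y" unfolding G using gm by (rule cls_in_L0)
  show "bound T (rep G)" unfolding G using g(1) by (rule bound_cls)
  show "\<And>h. bound T h \<Longrightarrow> AE y in \<mu>Y. rep G y \<le> h y" unfolding G by (rule min)
qed

lemma H_carrier: "T \<in> carrier H \<longleftrightarrow> T \<in> extensional (carrier M) \<and> (\<forall>v\<in>carrier M. T v \<in> Lp_set 1 \<mu>Y) \<and>
    (\<forall>v\<in>carrier M. \<forall>w\<in>carrier M. AE y in \<mu>Y. rep (T (v \<oplus>\<^bsub>M\<^esub> w)) y = rep (T v) y + rep (T w) y) \<and>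
    (\<forall>c. \<forall>v\<in>carrier M. AE y in \<mu>Y. rep (T (rscale \<mu>X M c v)) y = c * rep (T v) y) \<and> (\<exists>g. bound T g)"
proof (cases "\<forall>v\<in>carrier M. T v \<in> Lp_set 1 \<mu>Y")
  case True
  then have L0: "\<And>v. v \<in> carrier M \<Longrightarrow> T v \<in> L0 \<mu>Y" using Lp_set_L0 by blast
  have add: "T (v \<oplus>\<^bsub>M\<^esub> w) = add_cls \<mu>Y (T v) (T w) \<longleftrightarrow> (AE y in \<mu>Y. rep (T (v \<oplus>\<^bsub>M\<^esub> w)) y = rep (T v) y + rep (T w) y)"
    (is "?l \<longleftrightarrow> ?r") if v: "v \<in> carrier M" and w: "w \<in> carrier M" for v w
  proof
    assume ?l then show ?r using AE_add_cls[OF L0[OF v] L0[OF w]] by simp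
  next
    assume r: ?r
    have "AE y in \<mu>Y. rep (T (v \<oplus>\<^bsub>M\<^esub> w)) y = rep (add_cls \<mu>Y (T v) (T w)) y"
      using r AE_add_cls[OF L0[OF v] L0[OF w]] by eventually_elim simp
    then show ?l by (rule L0_eqI[OF L0[OF M.M.add.m_closed[OF v w]] add_cls_L0[OF L0[OF v] L0[OF w]]])
  qed
  have scale: "T (rscale \<mu>X M c v) = mult_cls \<mu>Y (const_cls \<mu>Y c) (T v) \<longleftrightarrow> (AE y in \<mu>Y. rep (T (rscale \<mu>X M c v)) y = c * rep (T v) y)"
    (is "?l \<longleftrightarrow> ?r") if v: "v \<in> carrier M" for c v
  proof -
    have e: "AE y in \<mu>Y. rep (mult_cls \<mu>Y (const_cls \<mu>Y c) (T v)) y = c * rep (T v) y"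
      using AE_mult_cls[OF const_cls_L0[of \<mu>Y c] L0[OF v]] AE_const_cls[of \<mu>Y c] by eventually_elim simp
    show ?thesis
    proof
      assume ?l then show ?r using e by simp
    next
      assume r: ?r
      have "AE y in \<mu>Y. rep (T (rscale \<mu>X M c v)) y = rep (mult_cls \<mu>Y (const_cls \<mu>Y c) (T v)) y"
        using r e by eventually_elim simp
      then show ?l by (rule L0_eqI[OF L0[OF rscale_closed[OF v]] mult_cls_L0[OF const_cls_L0 L0[OF v]]])
    qed
  qed
  show ?thesis
    using True local_bounds_nonempty_iff[OF L0]
    by (auto simp: Hom_loc_def real_linear_map_def additive_map_def rscale_def[of _ "Lp 1 \<mu>Y"] add scale Pi_iff)
next
  case False
  then show ?thesis by (auto simp: Hom_loc_def real_linear_map_def additive_map_def)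
qed

lemma H_simps: "\<zero>\<^bsub>H\<^esub> = (\<lambda>v\<in>carrier M. const_cls \<mu>Y 0)"
  "T \<oplus>\<^bsub>H\<^esub> T' = (\<lambda>v\<in>carrier M. add_cls \<mu>Y (T v) (T' v))"
  "f \<odot>\<^bsub>H\<^esub> T = (\<lambda>v\<in>carrier M. mult_cls \<mu>Y f (T v))"
  "nrm H T = Lp_norm q \<mu>Y (pnorm H T)" "pnorm H T = ess_inf \<mu>Y (local_bounds q \<mu>Y \<phi> M T)"
  by (simp_all add: Hom_loc_def)

lemma H_D:
  assumes "T \<in> carrier H"
  shows "T \<in> extensional (carrier M)" "v \<in> carrier M \<Longrightarrow> T v \<in> Lp_set 1 \<mu>Y"
    "v \<in> carrier M \<Longrightarrow> T v \<in> L0 \<mu>Y" "v \<in> carrier M \<Longrightarrow> rep (T v) \<in> borel_measurable \<mu>Y"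
    "v \<in> carrier M \<Longrightarrow> w \<in> carrier M \<Longrightarrow> AE y in \<mu>Y. rep (T (v \<oplus>\<^bsub>M\<^esub> w)) y = rep (T v) y + rep (T w) y"
    "v \<in> carrier M \<Longrightarrow> AE y in \<mu>Y. rep (T (rscale \<mu>X M c v)) y = c * rep (T v) y"
    "\<exists>g. bound T g"
  using assms Lp_set_L0 rep_meas unfolding H_carrier by blast+

lemma H_eqI:
  assumes "T \<in> carrier H" "T' \<in> carrier H" "\<And>v. v \<in> carrier M \<Longrightarrow> AE y in \<mu>Y. rep (T v) y = rep (T' v) y"
  shows "T = T'"
proof (rule extensionalityI[OF H_D(1)[OF assms(1)] H_D(1)[OF assms(2)]])
  fix v assume v: "v \<in> carrier M"
  show "T v = T' v" using H_D(3)[OF assms(1) v] H_D(3)[OF assms(2) v] assms(3)[OF v] by (rule L0_eqI)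
qed

abbreviation hn :: "('m \<Rightarrow> 'y fclass) \<Rightarrow> 'y \<Rightarrow> real" where "hn T \<equiv> rep (pnorm H T)"

lemma hn_props:
  assumes "T \<in> carrier H"
  shows "pnorm H T \<in> L0 \<mu>Y" "bound T (hn T)" "\<And>h. bound T h \<Longrightarrow> AE y in \<mu>Y. hn T y \<le> h y"
    "AE y in \<mu>Y. 0 \<le> hn T y" "lp_fun q \<mu>Y (hn T)" "pnorm H T \<in> Lp_pos q \<mu>Y"
    "hn T \<in> borel_measurable \<mu>Y" "nrm H T = lp_norm q \<mu>Y (hn T)"
proof -
  note b = ess_inf_local_bounds[of T, OF H_D(3)[OF assms] H_D(7)[OF assms], folded H_simps]
  then show "pnorm H T \<in> L0 \<mu>Y" "bound T (hn T)" "\<And>h. bound T h \<Longrightarrow> AE y in \<mu>Y. hn T y \<le> h y" by auto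
  then show "AE y in \<mu>Y. 0 \<le> hn T y" "lp_fun q \<mu>Y (hn T)" "pnorm H T \<in> Lp_pos q \<mu>Y" "hn T \<in> borel_measurable \<mu>Y"
    by (auto simp: bound_def Lp_pos_iff lp_fun_meas)
  show "nrm H T = lp_norm q \<mu>Y (hn T)" by (simp add: H_simps(4) Lp_norm_eq)
qed

text \<open>Local maps are usually given by representatives. Integrability of the values need not be checked:
it follows from the bound by Hoelder's inequality.\<close>

lemma H_memI:
  fixes S :: "'m \<Rightarrow> 'y \<Rightarrow> real"
  assumes S: "\<And>v. v \<in> carrier M \<Longrightarrow> S v \<in> borel_measurable \<mu>Y"
    and add: "\<And>v w. v \<in> carrier M \<Longrightarrow> w \<in> carrier M \<Longrightarrow> AE y in \<mu>Y. S (v \<oplus>\<^bsub>M\<^esub> w) y = S v y + S w y"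
    and scale: "\<And>c v. v \<in> carrier M \<Longrightarrow> AE y in \<mu>Y. S (rscale \<mu>X M c v) y = c * S v y"
    and g: "lp_fun q \<mu>Y g" "AE y in \<mu>Y. 0 \<le> g y"
    and le: "\<And>v. v \<in> carrier M \<Longrightarrow> AE y in \<mu>Y. \<bar>S v y\<bar> \<le> g y * P v y"
  shows "(\<lambda>v\<in>carrier M. cls \<mu>Y (S v)) \<in> carrier H \<and> bound (\<lambda>v\<in>carrier M. cls \<mu>Y (S v)) g \<and>
    (\<forall>v\<in>carrier M. AE y in \<mu>Y. rep ((\<lambda>v\<in>carrier M. cls \<mu>Y (S v)) v) y = S v y)"
    (is "?T \<in> _ \<and> _ \<and> _")
proof -
  have r: "\<And>v. v \<in> carrier M \<Longrightarrow> AE y in \<mu>Y. rep (?T v) y = S v y"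
    using AE_rep_cls[OF S] by simp
  have b: "bound ?T g"
    unfolding bound_def
  proof (intro conjI ballI g)
    fix v assume v: "v \<in> carrier M"
    show "AE y in \<mu>Y. \<bar>rep (?T v) y\<bar> \<le> g y * P v y"
      using r[OF v] le[OF v] by eventually_elim simp
  qed
  have "?T \<in> carrier H"
    unfolding H_carrier
  proof (intro conjI ballI allI)
    show "\<exists>g. bound ?T g" using b by blast
    fix v assume v: "v \<in> carrier M"
    have "integrable \<mu>Y (S v)"
    proof (rule Bochner_Integration.integrable_bound[OF Holder(1)[OF g(1) P_lp[OF v] pq] S[OF v]])
      show "AE y in \<mu>Y. norm (S v y) \<le> norm (g y * P v y)"
        using le[OF v] by eventually_elim simp
    qed
    then show "?T v \<in> Lp_set 1 \<mu>Y" using v by (simp add: cls_Lp_set lp_fun_1)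
    show "AE y in \<mu>Y. rep (?T (v \<oplus>\<^bsub>M\<^esub> w)) y = rep (?T v) y + rep (?T w) y" if w: "w \<in> carrier M" for w
      using r[OF v] r[OF w] r[OF M.M.add.m_closed[OF v w]] add[OF v w] by eventually_elim simp
    show "AE y in \<mu>Y. rep (?T (rscale \<mu>X M c v)) y = c * rep (?T v) y" for c
      using r[OF rscale_closed[OF v], of c] r[OF v] scale[OF v, of c]
      by eventually_elim (simp add: rscale_closed v)
  qed simp
  with r b show ?thesis by blast
qed

lemma H_zero: "\<zero>\<^bsub>H\<^esub> \<in> carrier H" "bound \<zero>\<^bsub>H\<^esub> (\<lambda>y. 0)"
  "v \<in> carrier M \<Longrightarrow> AE y in \<mu>Y. rep (\<zero>\<^bsub>H\<^esub> v) y = 0"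
  using H_memI[of "\<lambda>v y. 0" "\<lambda>y. 0"] unfolding H_simps const_cls_def
  by (auto simp: lp_fun_def)

lemma H_add:
  assumes T: "T \<in> carrier H" and T': "T' \<in> carrier H"
  shows "T \<oplus>\<^bsub>H\<^esub> T' \<in> carrier H" "bound T g \<Longrightarrow> bound T' g' \<Longrightarrow> bound (T \<oplus>\<^bsub>H\<^esub> T') (\<lambda>y. g y + g' y)"
    "v \<in> carrier M \<Longrightarrow> AE y in \<mu>Y. rep ((T \<oplus>\<^bsub>H\<^esub> T') v) y = rep (T v) y + rep (T' v) y"
proof -
  have *: "T \<oplus>\<^bsub>H\<^esub> T' \<in> carrier H \<and> bound (T \<oplus>\<^bsub>H\<^esub> T') (\<lambda>y. g y + g' y) \<and>
      (\<forall>v\<in>carrier M. AE y in \<mu>Y. rep ((T \<oplus>\<^bsub>H\<^esub> T') v) y = rep (T v) y + rep (T' v) y)"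
    if b: "bound T g" "bound T' g'" for g g'
    unfolding H_simps add_cls_def
  proof (rule H_memI)
    show "(\<lambda>y. rep (T v) y + rep (T' v) y) \<in> borel_measurable \<mu>Y" if "v \<in> carrier M" for v
      using H_D(4)[OF T that] H_D(4)[OF T' that] by measurable
    show "lp_fun q \<mu>Y (\<lambda>y. g y + g' y)" by (rule Minkowski(1)[OF boundD(1)[OF b(1)] boundD(1)[OF b(2)]]) (use pq in simp)
    show "AE y in \<mu>Y. 0 \<le> g y + g' y" using boundD(3)[OF b(1)] boundD(3)[OF b(2)] by eventually_elim simp
    fix v assume v: "v \<in> carrier M"
    show "AE y in \<mu>Y. \<bar>rep (T v) y + rep (T' v) y\<bar> \<le> (g y + g' y) * P v y"
      using boundD(4)[OF b(1) v] boundD(4)[OF b(2) v] by eventually_elim (simp add: distrib_right)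
    show "AE y in \<mu>Y. rep (T (rscale \<mu>X M c v)) y + rep (T' (rscale \<mu>X M c v)) y = c * (rep (T v) y + rep (T' v) y)" for c
      using H_D(6)[OF T v, where c=c] H_D(6)[OF T' v, where c=c] by eventually_elim (simp add: distrib_left)
    fix w assume w: "w \<in> carrier M"
    show "AE y in \<mu>Y. rep (T (v \<oplus>\<^bsub>M\<^esub> w)) y + rep (T' (v \<oplus>\<^bsub>M\<^esub> w)) y = rep (T v) y + rep (T' v) y + (rep (T w) y + rep (T' w) y)"
      using H_D(5)[OF T v w] H_D(5)[OF T' v w] by eventually_elim simp
  qed
  then show "T \<oplus>\<^bsub>H\<^esub> T' \<in> carrier H"
    "v \<in> carrier M \<Longrightarrow> AE y in \<mu>Y. rep ((T \<oplus>\<^bsub>H\<^esub> T') v) y = rep (T v) y + rep (T' v) y"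
    using H_D(7)[OF T] H_D(7)[OF T'] by blast+
  show "bound T g \<Longrightarrow> bound T' g' \<Longrightarrow> bound (T \<oplus>\<^bsub>H\<^esub> T') (\<lambda>y. g y + g' y)" using * by blast
qed

lemma H_smult:
  assumes f: "f \<in> carrier (Linf \<mu>Y)" and T: "T \<in> carrier H"
  shows "f \<odot>\<^bsub>H\<^esub> T \<in> carrier H" "bound T g \<Longrightarrow> bound (f \<odot>\<^bsub>H\<^esub> T) (\<lambda>y. \<bar>rep f y\<bar> * g y)"
    "v \<in> carrier M \<Longrightarrow> AE y in \<mu>Y. rep ((f \<odot>\<^bsub>H\<^esub> T) v) y = rep f y * rep (T v) y"
proof -
  note [measurable] = rep_meas[OF Linf_L0[OF f]]
  have *: "f \<odot>\<^bsub>H\<^esub> T \<in> carrier H \<and> bound (f \<odot>\<^bsub>H\<^esub> T) (\<lambda>y. \<bar>rep f y\<bar> * g y) \<and>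
      (\<forall>v\<in>carrier M. AE y in \<mu>Y. rep ((f \<odot>\<^bsub>H\<^esub> T) v) y = rep f y * rep (T v) y)"
    if b: "bound T g" for g
    unfolding H_simps mult_cls_def
  proof (rule H_memI)
    show "(\<lambda>y. rep f y * rep (T v) y) \<in> borel_measurable \<mu>Y" if "v \<in> carrier M" for v
      using H_D(4)[OF T that] by measurable
    obtain C where C: "C > 0" "AE x in \<mu>Y. \<bar>rep f x\<bar> \<le> C" using f by (rule Linf_boundE)
    show "lp_fun q \<mu>Y (\<lambda>y. \<bar>rep f y\<bar> * g y)"
    proof (rule lp_fun_mono(1)[OF lp_scale(1)[OF boundD(1)[OF b], of C]])
      show "AE y in \<mu>Y. \<bar>\<bar>rep f y\<bar> * g y\<bar> \<le> \<bar>C * g y\<bar>"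
        using C(2) by eventually_elim (use C(1) in \<open>auto simp: abs_mult intro: mult_right_mono\<close>)
    qed (use pq boundD(2)[OF b] in auto)
    show "AE y in \<mu>Y. 0 \<le> \<bar>rep f y\<bar> * g y" using boundD(3)[OF b] by eventually_elim simp
    fix v assume v: "v \<in> carrier M"
    show "AE y in \<mu>Y. \<bar>rep f y * rep (T v) y\<bar> \<le> \<bar>rep f y\<bar> * g y * P v y"
      using boundD(4)[OF b v] by eventually_elim (simp add: abs_mult mult.assoc mult_left_mono)
    show "AE y in \<mu>Y. rep f y * rep (T (rscale \<mu>X M c v)) y = c * (rep f y * rep (T v) y)" for c
      using H_D(6)[OF T v, where c=c] by eventually_elim simp
    fix w assume w: "w \<in> carrier M"
    show "AE y in \<mu>Y. rep f y * rep (T (v \<oplus>\<^bsub>M\<^esub> w)) y = rep f y * rep (T v) y + rep f y * rep (T w) y"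
      using H_D(5)[OF T v w] by eventually_elim (simp add: distrib_left)
  qed
  then show "f \<odot>\<^bsub>H\<^esub> T \<in> carrier H"
    "v \<in> carrier M \<Longrightarrow> AE y in \<mu>Y. rep ((f \<odot>\<^bsub>H\<^esub> T) v) y = rep f y * rep (T v) y"
    using H_D(7)[OF T] by blast+
  show "bound T g \<Longrightarrow> bound (f \<odot>\<^bsub>H\<^esub> T) (\<lambda>y. \<bar>rep f y\<bar> * g y)" using * by blast
qed

lemma H_abelian_group: "abelian_group H"
proof (rule abelian_groupI)
  fix S T U assume S: "S \<in> carrier H"
  show "\<zero>\<^bsub>H\<^esub> \<oplus>\<^bsub>H\<^esub> S = S"
  proof (rule H_eqI[OF H_add(1)[OF H_zero(1) S] S])
    fix v assume v: "v \<in> carrier M"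
    show "AE y in \<mu>Y. rep ((\<zero>\<^bsub>H\<^esub> \<oplus>\<^bsub>H\<^esub> S) v) y = rep (S v) y"
      using H_add(3)[OF H_zero(1) S v] H_zero(3)[OF v] by eventually_elim simp
  qed
  have n: "const_cls \<mu>Y (- 1) \<odot>\<^bsub>H\<^esub> S \<in> carrier H" by (rule H_smult(1)[OF const_Linf S])
  have "const_cls \<mu>Y (- 1) \<odot>\<^bsub>H\<^esub> S \<oplus>\<^bsub>H\<^esub> S = \<zero>\<^bsub>H\<^esub>"
  proof (rule H_eqI[OF H_add(1)[OF n S] H_zero(1)])
    fix v assume v: "v \<in> carrier M"
    show "AE y in \<mu>Y. rep ((const_cls \<mu>Y (- 1) \<odot>\<^bsub>H\<^esub> S \<oplus>\<^bsub>H\<^esub> S) v) y = rep (\<zero>\<^bsub>H\<^esub> v) y"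
      using H_add(3)[OF n S v] H_smult(3)[OF const_Linf S v, of "-1"] AE_const_cls[of \<mu>Y "-1"] H_zero(3)[OF v]
      by eventually_elim simp
  qed
  then show "\<exists>T\<in>carrier H. T \<oplus>\<^bsub>H\<^esub> S = \<zero>\<^bsub>H\<^esub>" using n by blast
  assume T: "T \<in> carrier H"
  show "S \<oplus>\<^bsub>H\<^esub> T \<in> carrier H" using S T by (rule H_add(1))
  show "S \<oplus>\<^bsub>H\<^esub> T = T \<oplus>\<^bsub>H\<^esub> S" unfolding H_simps add_cls_def by (simp add: add.commute)
  assume U: "U \<in> carrier H"
  show "S \<oplus>\<^bsub>H\<^esub> T \<oplus>\<^bsub>H\<^esub> U = S \<oplus>\<^bsub>H\<^esub> (T \<oplus>\<^bsub>H\<^esub> U)"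
  proof (rule H_eqI[OF H_add(1)[OF H_add(1)[OF S T] U] H_add(1)[OF S H_add(1)[OF T U]]])
    fix v assume v: "v \<in> carrier M"
    show "AE y in \<mu>Y. rep ((S \<oplus>\<^bsub>H\<^esub> T \<oplus>\<^bsub>H\<^esub> U) v) y = rep ((S \<oplus>\<^bsub>H\<^esub> (T \<oplus>\<^bsub>H\<^esub> U)) v) y"
      using H_add(3)[OF H_add(1)[OF S T] U v] H_add(3)[OF S H_add(1)[OF T U] v] H_add(3)[OF S T v] H_add(3)[OF T U v]
      by eventually_elim simp
  qed
qed (rule H_zero(1))

lemma H_module: "Module.module (Linf \<mu>Y) H"
proof (rule moduleI[OF ring H_abelian_group])
  fix f g S T assume S: "S \<in> carrier H"
  have one: "const_cls \<mu>Y 1 \<odot>\<^bsub>H\<^esub> S \<in> carrier H" using const_Linf S by (rule H_smult(1))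
  show "\<one>\<^bsub>Linf \<mu>Y\<^esub> \<odot>\<^bsub>H\<^esub> S = S"
    unfolding Linf_simps
  proof (rule H_eqI[OF one S])
    fix v assume v: "v \<in> carrier M"
    show "AE y in \<mu>Y. rep ((const_cls \<mu>Y 1 \<odot>\<^bsub>H\<^esub> S) v) y = rep (S v) y"
      using H_smult(3)[OF const_Linf S v, of 1] AE_const_cls[of \<mu>Y 1] by eventually_elim simp
  qed
  assume f: "f \<in> carrier (Linf \<mu>Y)"
  show fS: "f \<odot>\<^bsub>H\<^esub> S \<in> carrier H" using f S by (rule H_smult(1))
  {
    assume T: "T \<in> carrier H"
    have fT: "f \<odot>\<^bsub>H\<^esub> T \<in> carrier H" using f T by (rule H_smult(1))
    note ST = H_add(1)[OF S T]
    show "f \<odot>\<^bsub>H\<^esub> (S \<oplus>\<^bsub>H\<^esub> T) = f \<odot>\<^bsub>H\<^esub> S \<oplus>\<^bsub>H\<^esub> f \<odot>\<^bsub>H\<^esub> T"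
    proof (rule H_eqI[OF H_smult(1)[OF f ST] H_add(1)[OF fS fT]])
      fix v assume v: "v \<in> carrier M"
      show "AE y in \<mu>Y. rep ((f \<odot>\<^bsub>H\<^esub> (S \<oplus>\<^bsub>H\<^esub> T)) v) y = rep ((f \<odot>\<^bsub>H\<^esub> S \<oplus>\<^bsub>H\<^esub> f \<odot>\<^bsub>H\<^esub> T) v) y"
        using H_smult(3)[OF f ST v] H_add(3)[OF S T v] H_add(3)[OF fS fT v] H_smult(3)[OF f S v] H_smult(3)[OF f T v]
        by eventually_elim (simp add: distrib_left)
    qed
  }
  assume g: "g \<in> carrier (Linf \<mu>Y)"
  have gS: "g \<odot>\<^bsub>H\<^esub> S \<in> carrier H" using g S by (rule H_smult(1))
  interpret R: cring "Linf \<mu>Y" by (rule ring)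
  have fg: "add_cls \<mu>Y f g \<in> carrier (Linf \<mu>Y)" "mult_cls \<mu>Y f g \<in> carrier (Linf \<mu>Y)"
    using R.a_closed[OF f g] R.m_closed[OF f g] by simp_all
  show "(f \<oplus>\<^bsub>Linf \<mu>Y\<^esub> g) \<odot>\<^bsub>H\<^esub> S = f \<odot>\<^bsub>H\<^esub> S \<oplus>\<^bsub>H\<^esub> g \<odot>\<^bsub>H\<^esub> S"
    unfolding Linf_simps
  proof (rule H_eqI[OF H_smult(1)[OF fg(1) S] H_add(1)[OF fS gS]])
    fix v assume v: "v \<in> carrier M"
    show "AE y in \<mu>Y. rep ((add_cls \<mu>Y f g \<odot>\<^bsub>H\<^esub> S) v) y = rep ((f \<odot>\<^bsub>H\<^esub> S \<oplus>\<^bsub>H\<^esub> g \<odot>\<^bsub>H\<^esub> S) v) y"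
      using H_smult(3)[OF fg(1) S v] H_add(3)[OF fS gS v] H_smult(3)[OF f S v] H_smult(3)[OF g S v]
        AE_add_cls[OF Linf_L0[OF f] Linf_L0[OF g]]
      by eventually_elim (simp add: distrib_right)
  qed
  show "(f \<otimes>\<^bsub>Linf \<mu>Y\<^esub> g) \<odot>\<^bsub>H\<^esub> S = f \<odot>\<^bsub>H\<^esub> (g \<odot>\<^bsub>H\<^esub> S)"
    unfolding Linf_simps
  proof (rule H_eqI[OF H_smult(1)[OF fg(2) S] H_smult(1)[OF f gS]])
    fix v assume v: "v \<in> carrier M"
    show "AE y in \<mu>Y. rep ((mult_cls \<mu>Y f g \<odot>\<^bsub>H\<^esub> S) v) y = rep ((f \<odot>\<^bsub>H\<^esub> (g \<odot>\<^bsub>H\<^esub> S)) v) y"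
      using H_smult(3)[OF fg(2) S v] H_smult(3)[OF f gS v] H_smult(3)[OF g S v]
        AE_mult_cls[OF Linf_L0[OF f] Linf_L0[OF g]]
      by eventually_elim simp
  qed
qed

lemma hn_smult:
  assumes f: "f \<in> carrier (Linf \<mu>Y)" and T: "T \<in> carrier H"
  shows "AE y in \<mu>Y. hn (f \<odot>\<^bsub>H\<^esub> T) y = \<bar>rep f y\<bar> * hn T y"
proof -
  have fT: "f \<odot>\<^bsub>H\<^esub> T \<in> carrier H" using f T by (rule H_smult(1))
  note [measurable] = rep_meas[OF Linf_L0[OF f]] hn_props(7)[OF T] hn_props(7)[OF fT]
  have le: "AE y in \<mu>Y. hn (f \<odot>\<^bsub>H\<^esub> T) y \<le> \<bar>rep f y\<bar> * hn T y"
    by (rule hn_props(3)[OF fT H_smult(2)[OF f T hn_props(2)[OF T]]])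
  \<comment> \<open>Dividing a bound of \<open>f \<odot> T\<close> by \<open>\<bar>f\<bar>\<close> where \<open>f \<noteq> 0\<close> gives a bound of \<open>T\<close>; the minimum with
    the norm of \<open>T\<close> keeps it in \<open>L\<^sup>q\<close>.\<close>
  define g where "g y = (if rep f y = 0 then hn T y else min (hn T y) (hn (f \<odot>\<^bsub>H\<^esub> T) y / \<bar>rep f y\<bar>))" for y
  have g: "AE y in \<mu>Y. 0 \<le> g y \<and> g y \<le> hn T y"
    using hn_props(4)[OF T] hn_props(4)[OF fT] by eventually_elim (auto simp: g_def)
  have "bound T g"
    unfolding bound_def
  proof (intro conjI ballI)
    show "lp_fun q \<mu>Y g"
    proof (rule lp_fun_mono(1)[OF hn_props(5)[OF T]])
      show "g \<in> borel_measurable \<mu>Y" unfolding g_def by measurable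
      show "AE y in \<mu>Y. \<bar>g y\<bar> \<le> \<bar>hn T y\<bar>" using g by eventually_elim auto
    qed (use pq in auto)
    show "AE y in \<mu>Y. 0 \<le> g y" using g by eventually_elim simp
    fix v assume v: "v \<in> carrier M"
    show "AE y in \<mu>Y. \<bar>rep (T v) y\<bar> \<le> g y * P v y"
      using boundD(4)[OF hn_props(2)[OF T] v] boundD(4)[OF hn_props(2)[OF fT] v] H_smult(3)[OF f T v]
      by eventually_elim (auto simp: g_def min_def abs_mult field_simps)
  qed
  from hn_props(3)[OF T this] hn_props(4)[OF fT] le show ?thesis
  proof eventually_elim
    case (elim y)
    show ?case
    proof (cases "rep f y = 0")
      case False
      then have "hn T y \<le> hn (f \<odot>\<^bsub>H\<^esub> T) y / \<bar>rep f y\<bar>" using elim(1) by (simp add: g_def)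
      then show ?thesis using elim(3) False by (simp add: field_simps)
    qed (use elim in auto)
  qed
qed

lemma H_minus:
  assumes S: "S \<in> carrier H" and T: "T \<in> carrier H"
  shows "S \<ominus>\<^bsub>H\<^esub> T \<in> carrier H"
    "v \<in> carrier M \<Longrightarrow> AE y in \<mu>Y. rep ((S \<ominus>\<^bsub>H\<^esub> T) v) y = rep (S v) y - rep (T v) y"
proof -
  interpret A: abelian_group H by (rule H_abelian_group)
  show ST: "S \<ominus>\<^bsub>H\<^esub> T \<in> carrier H" using A.minus_closed[OF S T] .
  have eq: "(S \<ominus>\<^bsub>H\<^esub> T) \<oplus>\<^bsub>H\<^esub> T = S"
    using S T A.a_inv_closed[OF T] by (simp add: a_minus_def A.a_assoc A.l_neg del: H_simps)
  show "AE y in \<mu>Y. rep ((S \<ominus>\<^bsub>H\<^esub> T) v) y = rep (S v) y - rep (T v) y" if "v \<in> carrier M"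
    using H_add(3)[OF ST T that] unfolding eq by eventually_elim simp
qed

lemma H_nrm_le:
  assumes T: "T \<in> carrier H" and b: "bound T g"
  shows "nrm H T \<le> lp_norm q \<mu>Y g"
  unfolding hn_props(8)[OF T]
proof (rule lp_fun_mono(2)[OF boundD(1)[OF b] hn_props(7)[OF T]])
  show "AE y in \<mu>Y. \<bar>hn T y\<bar> \<le> \<bar>g y\<bar>"
    using hn_props(3)[OF T b] hn_props(4)[OF T] by eventually_elim simp
qed (use pq in simp)

lemma H_nrm_triangle:
  assumes S: "S \<in> carrier H" and T: "T \<in> carrier H"
  shows "nrm H (S \<oplus>\<^bsub>H\<^esub> T) \<le> nrm H S + nrm H T"
proof -
  have "nrm H (S \<oplus>\<^bsub>H\<^esub> T) \<le> lp_norm q \<mu>Y (\<lambda>y. hn S y + hn T y)"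
    by (rule H_nrm_le[OF H_add(1)[OF S T] H_add(2)[OF S T hn_props(2)[OF S] hn_props(2)[OF T]]])
  also have "\<dots> \<le> nrm H S + nrm H T"
    unfolding hn_props(8)[OF S] hn_props(8)[OF T] using pq by (intro Minkowski(2) hn_props(5) S T) simp
  finally show ?thesis .
qed

text \<open>Along a subsequence with increments of norm at most \<open>(1 / 4)\<^sup>k\<close>, the pointwise norms of the increments
are below \<open>(1 / 2)\<^sup>k G\<close> for one \<open>G\<close> in \<open>L\<^sup>q\<close>. Hence every value \<open>w\<^sub>k v\<close> converges almost everywhere, and the
remainders have the local bounds \<open>2 (1 / 2)\<^sup>k G\<close>, whose norms tend to zero.\<close>

lemma H_complete:
  fixes u :: "nat \<Rightarrow> 'm \<Rightarrow> 'y fclass"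
  assumes u: "range u \<subseteq> carrier H"
    and cauchy: "\<And>e. e > 0 \<Longrightarrow> \<exists>N. \<forall>m\<ge>N. \<forall>n\<ge>N. nrm H (u m \<ominus>\<^bsub>H\<^esub> u n) < e"
  shows "\<exists>l\<in>carrier H. (\<lambda>n. nrm H (u n \<ominus>\<^bsub>H\<^esub> l)) \<longlonglongrightarrow> 0"
proof -
  interpret A: abelian_group H by (rule H_abelian_group)
  have uH: "u n \<in> carrier H" for n using u by auto
  have "\<exists>N. \<forall>m\<ge>N. \<forall>n\<ge>N. nrm H (u m \<ominus>\<^bsub>H\<^esub> u n) < (1 / 4) ^ k" for k :: nat
    by (rule cauchy) simp
  then obtain N where N: "\<And>k m n. N k \<le> m \<Longrightarrow> N k \<le> n \<Longrightarrow> nrm H (u m \<ominus>\<^bsub>H\<^esub> u n) < (1 / 4) ^ k"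
    by metis
  define r where "r k = (\<Sum>i\<le>k. N i)" for k
  have rN: "N k \<le> r k" "r k \<le> r (Suc k)" for k by (auto simp: r_def intro!: member_le_sum)
  define w where "w k = u (r k)" for k
  have wH: "w k \<in> carrier H" for k by (simp add: w_def uH)
  define h where "h k = hn (w (Suc k) \<ominus>\<^bsub>H\<^esub> w k)" for k
  have dH: "w (Suc k) \<ominus>\<^bsub>H\<^esub> w k \<in> carrier H" for k by (rule H_minus(1)[OF wH wH])
  have "lp_norm q \<mu>Y (h k) \<le> (1 / 4) ^ k" for k
    using N[of k "r (Suc k)" "r k"] rN[of k] by (simp add: h_def w_def hn_props(8)[OF dH, symmetric, unfolded w_def])
  then obtain G where G: "lp_fun q \<mu>Y G" "AE y in \<mu>Y. 0 \<le> G y \<and> (\<forall>n. \<bar>h n y\<bar> \<le> (1 / 2) ^ n * G y)"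
    using geometric_decay_dominated[of q \<mu>Y h] hn_props(5)[OF dH] pq by (auto simp: h_def)
  define S where "S v y = lim (\<lambda>k. rep (w k v) y)" for v y
  have S_meas: "S v \<in> borel_measurable \<mu>Y" if "v \<in> carrier M" for v
    unfolding S_def using H_D(4)[OF wH that] by measurable
  have S_lim: "AE y in \<mu>Y. (\<lambda>k. rep (w k v) y) \<longlonglongrightarrow> S v y \<and>
      (\<forall>n. \<bar>rep (w n v) y - S v y\<bar> \<le> 2 * (1 / 2) ^ n * (G y * P v y))" if v: "v \<in> carrier M" for v
  proof -
    have "AE y in \<mu>Y. \<forall>k. \<bar>rep ((w (Suc k) \<ominus>\<^bsub>H\<^esub> w k) v) y\<bar> \<le> h k y * P v y"
      unfolding AE_all_countable h_def using boundD(4)[OF hn_props(2)[OF dH] v] by blast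
    moreover have "AE y in \<mu>Y. \<forall>k. rep ((w (Suc k) \<ominus>\<^bsub>H\<^esub> w k) v) y = rep (w (Suc k) v) y - rep (w k v) y"
      unfolding AE_all_countable using H_minus(2)[OF wH wH v] by blast
    ultimately show ?thesis using G(2) P_nonneg[OF v]
    proof eventually_elim
      case (elim y)
      define a where "a k = rep (w k v) y" for k
      define C where "C = G y * P v y"
      have ab: "\<bar>a (Suc k) - a k\<bar> \<le> C * (1 / 2) ^ k" for k
      proof -
        have "\<bar>a (Suc k) - a k\<bar> \<le> h k y * P v y"
          using elim(1,2) by (simp add: a_def)
        also have "\<dots> \<le> (1 / 2) ^ k * G y * P v y"
          using elim(3,4) by (intro mult_right_mono) (auto intro: order_trans[OF abs_ge_self])
        finally show ?thesis by (simp add: C_def mult_ac)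
      qed
      have sum_g: "(\<lambda>k. C * (1 / 2) ^ k) sums (C * 2)"
        using sums_mult[OF geometric_sums[of "1/2 :: real"], of C] by simp
      have tail: "\<bar>a (n + m) - a n\<bar> \<le> 2 * (1 / 2) ^ n * C" for n m
      proof -
        have "\<bar>a (n + m) - a n\<bar> \<le> C * (1 / 2) ^ n * (2 - 2 * (1 / 2) ^ m)"
        proof (induction m)
          case (Suc m)
          have "\<bar>a (n + Suc m) - a n\<bar> \<le> C * (1 / 2) ^ n * (2 - 2 * (1 / 2) ^ m) + C * (1 / 2) ^ (n + m)"
            using Suc.IH ab[of "n + m"] by simp
          also have "\<dots> = C * (1 / 2) ^ n * (2 - 2 * (1 / 2) ^ Suc m)"
            by (simp add: power_add algebra_simps)
          finally show ?case .
        qed simp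
        also have "\<dots> \<le> C * (1 / 2) ^ n * 2"
          using elim(3,4) by (intro mult_left_mono) (auto simp: C_def)
        finally show ?thesis by (simp add: mult_ac)
      qed
      have "summable (\<lambda>k. a (Suc k) - a k)"
        by (rule summable_comparison_test'[OF sums_summable[OF sum_g]]) (use ab in auto)
      then have "(\<lambda>n. \<Sum>k<n. a (Suc k) - a k) \<longlonglongrightarrow> (\<Sum>k. a (Suc k) - a k)"
        by (rule summable_LIMSEQ)
      then have "(\<lambda>n. a n - a 0) \<longlonglongrightarrow> (\<Sum>k. a (Suc k) - a k)"
        by (simp add: sum_lessThan_telescope)
      from tendsto_add[OF this tendsto_const[of "a 0"]]
      have conv: "a \<longlonglongrightarrow> (\<Sum>k. a (Suc k) - a k) + a 0" by simp
      then have lim: "a \<longlonglongrightarrow> S v y"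
        using limI[OF conv] by (simp add: S_def a_def[abs_def])
      have "\<bar>a n - S v y\<bar> \<le> 2 * (1 / 2) ^ n * C" for n
      proof (rule LIMSEQ_le_const2)
        show "(\<lambda>m. \<bar>a n - a (m + n)\<bar>) \<longlonglongrightarrow> \<bar>a n - S v y\<bar>"
          by (intro tendsto_rabs tendsto_diff tendsto_const LIMSEQ_ignore_initial_segment lim)
        show "\<exists>N. \<forall>m\<ge>N. \<bar>a n - a (m + n)\<bar> \<le> 2 * (1 / 2) ^ n * C"
          using tail[of n] by (simp add: abs_minus_commute add.commute)
      qed
      then show ?case using lim by (simp add: a_def[abs_def] C_def)
    qed
  qed
  \<comment> \<open>The difference between the limit and \<open>w 0\<close> has the local bound \<open>2 G\<close>.\<close>
  define g0 where "g0 y = \<bar>hn (w 0) y\<bar> + \<bar>2 * G y\<bar>" for y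
  have G': "lp_fun q \<mu>Y (\<lambda>y. c * G y)" for c using lp_scale(1)[OF G(1)] pq by simp
  have abs_lp: "lp_fun q \<mu>Y (\<lambda>y. \<bar>f y\<bar>)" if "lp_fun q \<mu>Y f" for f
    using that by (auto simp: lp_fun_def)
  have g0: "lp_fun q \<mu>Y g0" unfolding g0_def[abs_def]
    using pq by (intro Minkowski(1) abs_lp hn_props(5) wH G') simp
  have S_add: "AE y in \<mu>Y. S (v \<oplus>\<^bsub>M\<^esub> x) y = S v y + S x y" if v: "v \<in> carrier M" and x: "x \<in> carrier M" for v x
  proof -
    have "AE y in \<mu>Y. \<forall>k. rep (w k (v \<oplus>\<^bsub>M\<^esub> x)) y = rep (w k v) y + rep (w k x) y"
      unfolding AE_all_countable using H_D(5)[OF wH v x] by blast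
    then show ?thesis using S_lim[OF v] S_lim[OF x] S_lim[OF M.M.add.m_closed[OF v x]]
    proof eventually_elim
      case (elim y)
      have "(\<lambda>k. rep (w k v) y + rep (w k x) y) \<longlonglongrightarrow> S v y + S x y"
        using elim(2,3) by (intro tendsto_add) auto
      then show ?case using elim(1,4) by (auto intro: LIMSEQ_unique)
    qed
  qed
  have S_scale: "AE y in \<mu>Y. S (rscale \<mu>X M c v) y = c * S v y" if v: "v \<in> carrier M" for c v
  proof -
    have "AE y in \<mu>Y. \<forall>k. rep (w k (rscale \<mu>X M c v)) y = c * rep (w k v) y"
      unfolding AE_all_countable using H_D(6)[OF wH v] by blast
    then show ?thesis using S_lim[OF v] S_lim[OF rscale_closed[OF v, of c]]
    proof eventually_elim
      case (elim y)
      have "(\<lambda>k. c * rep (w k v) y) \<longlonglongrightarrow> c * S v y"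
        using elim(2) by (intro tendsto_mult tendsto_const) auto
      then show ?case using elim(1,3) by (auto intro: LIMSEQ_unique)
    qed
  qed
  have S_le: "AE y in \<mu>Y. \<bar>S v y\<bar> \<le> g0 y * P v y" if v: "v \<in> carrier M" for v
    using S_lim[OF v] boundD(4)[OF hn_props(2)[OF wH] v, of 0] hn_props(4)[OF wH, of 0] G(2)
  proof eventually_elim
    case (elim y)
    have "\<bar>rep (w 0 v) y - S v y\<bar> \<le> 2 * (1 / 2) ^ 0 * (G y * P v y)" using elim(1) by blast
    then have "\<bar>S v y\<bar> \<le> hn (w 0) y * P v y + 2 * G y * P v y" using elim(2) by (simp add: mult.assoc)
    then show ?case using elim(3,4) by (simp add: g0_def distrib_right)
  qed
  define L where "L = (\<lambda>v\<in>carrier M. cls \<mu>Y (S v))"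
  have L: "L \<in> carrier H" and L_rep: "\<And>v. v \<in> carrier M \<Longrightarrow> AE y in \<mu>Y. rep (L v) y = S v y"
    using H_memI[where S=S and g=g0, OF S_meas S_add S_scale g0 _ S_le] unfolding L_def
    by (simp_all add: g0_def)
  have wL: "nrm H (w n \<ominus>\<^bsub>H\<^esub> L) \<le> 2 * (1 / 2) ^ n * lp_norm q \<mu>Y G" for n
  proof -
    have "bound (w n \<ominus>\<^bsub>H\<^esub> L) (\<lambda>y. 2 * (1 / 2) ^ n * G y)"
      unfolding bound_def
    proof (intro conjI ballI G')
      show "AE y in \<mu>Y. 0 \<le> 2 * (1 / 2) ^ n * G y" using G(2) by eventually_elim simp
      fix v assume v: "v \<in> carrier M"
      show "AE y in \<mu>Y. \<bar>rep ((w n \<ominus>\<^bsub>H\<^esub> L) v) y\<bar> \<le> 2 * (1 / 2) ^ n * G y * P v y"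
        using H_minus(2)[OF wH L v, of n] L_rep[OF v] S_lim[OF v] by eventually_elim (simp add: mult.assoc)
    qed
    from H_nrm_le[OF H_minus(1)[OF wH L] this] show ?thesis
      using lp_scale(2)[OF G(1), of "2 * (1 / 2) ^ n"] pq by simp
  qed
  have "(\<lambda>n. nrm H (u n \<ominus>\<^bsub>H\<^esub> L)) \<longlonglongrightarrow> 0"
  proof (rule LIMSEQ_I)
    fix e :: real assume e: "e > 0"
    have "(\<lambda>n. (1 / 4) ^ n + 2 * (1 / 2) ^ n * lp_norm q \<mu>Y G) \<longlonglongrightarrow> 0 + 2 * 0 * lp_norm q \<mu>Y G"
      by (intro tendsto_add tendsto_mult tendsto_const LIMSEQ_power_zero) auto
    then have "eventually (\<lambda>n. (1 / 4) ^ n + 2 * (1 / 2) ^ n * lp_norm q \<mu>Y G < e) sequentially"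
      using e by (intro order_tendstoD(2)[of _ 0]) auto
    then obtain k where k: "(1 / 4) ^ k + 2 * (1 / 2) ^ k * lp_norm q \<mu>Y G < e"
      by (auto simp: eventually_sequentially)
    have "norm (nrm H (u n \<ominus>\<^bsub>H\<^esub> L) - 0) < e" if n: "n \<ge> r k" for n
    proof -
      have c: "u n \<ominus>\<^bsub>H\<^esub> w k \<in> carrier H" "w k \<ominus>\<^bsub>H\<^esub> L \<in> carrier H" "u n \<ominus>\<^bsub>H\<^esub> L \<in> carrier H"
        using H_minus(1) uH wH L by auto
      have "u n \<ominus>\<^bsub>H\<^esub> L = (u n \<ominus>\<^bsub>H\<^esub> w k) \<oplus>\<^bsub>H\<^esub> (w k \<ominus>\<^bsub>H\<^esub> L)"
        using uH[of n] wH[of k] L A.a_inv_closed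
        by (simp add: a_minus_def A.a_assoc A.r_neg1)
      then have "nrm H (u n \<ominus>\<^bsub>H\<^esub> L) \<le> nrm H (u n \<ominus>\<^bsub>H\<^esub> w k) + nrm H (w k \<ominus>\<^bsub>H\<^esub> L)"
        using H_nrm_triangle[OF c(1,2)] by simp
      also have "\<dots> < (1 / 4) ^ k + 2 * (1 / 2) ^ k * lp_norm q \<mu>Y G"
        using N[of k n "r k"] rN(1)[of k] n wL[of k] by (simp add: w_def)
      finally show ?thesis using k lp_norm_nonneg[of q \<mu>Y "hn (u n \<ominus>\<^bsub>H\<^esub> L)"] hn_props(8)[OF c(3)] by simp
    qed
    then show "\<exists>no. \<forall>n\<ge>no. norm (nrm H (u n \<ominus>\<^bsub>H\<^esub> L) - 0) < e" by blast
  qed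
  then show ?thesis using L by blast
qed

lemma Hom_loc_normed_module: "Lp_normed_module q \<mu>Y H"
proof (intro Lp_normed_module.intro banach_Linf_module.intro H_module
    Lp_normed_module_axioms.intro banach_Linf_module_axioms.intro)
  fix T assume T: "T \<in> carrier H"
  show "pnorm H T \<in> Lp_pos q \<mu>Y" by (rule hn_props(6)[OF T])
  show "nrm H T = Lp_norm q \<mu>Y (pnorm H T)" by (rule H_simps(4))
  show sm: "pnorm H (f \<odot>\<^bsub>H\<^esub> T) = mult_cls \<mu>Y (abs_cls \<mu>Y f) (pnorm H T)" if f: "f \<in> carrier (Linf \<mu>Y)" for f
  proof (rule L0_eqI[OF hn_props(1)[OF H_smult(1)[OF f T]] mult_cls_L0[OF abs_cls_L0[OF Linf_L0[OF f]] hn_props(1)[OF T]]])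
    show "AE y in \<mu>Y. hn (f \<odot>\<^bsub>H\<^esub> T) y = rep (mult_cls \<mu>Y (abs_cls \<mu>Y f) (pnorm H T)) y"
      using hn_smult[OF f T] AE_mult_cls[OF abs_cls_L0[OF Linf_L0[OF f]] hn_props(1)[OF T]] AE_abs_cls[OF Linf_L0[OF f]]
      by eventually_elim simp
  qed
  show "nrm H (rscale \<mu>Y H c T) = \<bar>c\<bar> * nrm H T" for c
  proof -
    have cT: "const_cls \<mu>Y c \<odot>\<^bsub>H\<^esub> T \<in> carrier H" using const_Linf T by (rule H_smult(1))
    have "nrm H (rscale \<mu>Y H c T) = lp_norm q \<mu>Y (hn (const_cls \<mu>Y c \<odot>\<^bsub>H\<^esub> T))"
      unfolding rscale_def by (rule hn_props(8)[OF cT])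
    also have "\<dots> = lp_norm q \<mu>Y (\<lambda>y. \<bar>c\<bar> * hn T y)"
    proof (rule lp_norm_cong[OF hn_props(7)[OF cT]])
      show "AE y in \<mu>Y. hn (const_cls \<mu>Y c \<odot>\<^bsub>H\<^esub> T) y = \<bar>c\<bar> * hn T y"
        using hn_smult[OF const_Linf T, of c] AE_const_cls[of \<mu>Y c] by eventually_elim simp
    qed (use hn_props(7)[OF T] in measurable)
    also have "\<dots> = \<bar>c\<bar> * nrm H T"
      using lp_scale(2)[OF hn_props(5)[OF T], of "\<bar>c\<bar>"] pq by (simp add: hn_props(8)[OF T])
    finally show ?thesis .
  qed
  show "nrm H T = 0 \<longleftrightarrow> T = \<zero>\<^bsub>H\<^esub>"
  proof
    assume "nrm H T = 0"
    then have z: "AE y in \<mu>Y. hn T y = 0"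
      using lp_norm_eq_0[OF hn_props(5)[OF T]] pq by (simp add: hn_props(8)[OF T])
    show "T = \<zero>\<^bsub>H\<^esub>"
    proof (rule H_eqI[OF T H_zero(1)])
      fix v assume v: "v \<in> carrier M"
      show "AE y in \<mu>Y. rep (T v) y = rep (\<zero>\<^bsub>H\<^esub> v) y"
        using H_zero(3)[OF v] z boundD(4)[OF hn_props(2)[OF T] v] by eventually_elim simp
    qed
  next
    assume "T = \<zero>\<^bsub>H\<^esub>"
    then have "nrm H T \<le> lp_norm q \<mu>Y (\<lambda>y. 0)" using H_nrm_le[OF H_zero(1,2)] by simp
    moreover have "lp_norm q \<mu>Y (\<lambda>y. 0) = 0" by (simp add: lp_norm_def)
    ultimately show "nrm H T = 0" using lp_norm_nonneg[of q \<mu>Y "hn T"] by (simp add: hn_props(8)[OF T])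
  qed
  show "nrm H (T \<oplus>\<^bsub>H\<^esub> S) \<le> nrm H T + nrm H S" if "S \<in> carrier H" for S
    using T that by (rule H_nrm_triangle)
next
  fix u :: "nat \<Rightarrow> 'm \<Rightarrow> 'y fclass"
  assume "range u \<subseteq> carrier H" "\<And>e. e > 0 \<Longrightarrow> \<exists>N. \<forall>m\<ge>N. \<forall>n\<ge>N. nrm H (u m \<ominus>\<^bsub>H\<^esub> u n) < e"
  then show "\<exists>l\<in>carrier H. (\<lambda>n. nrm H (u n \<ominus>\<^bsub>H\<^esub> l)) \<longlonglongrightarrow> 0" by (rule H_complete)
qed

end

section \<open>The dual as a module of local maps\<close>

locale dual_exponent_module = Lp_normed_module p \<mu> V
  for p :: real and \<mu> :: "'a measure" and V :: "('a fclass, 'm) normed_mod" +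
  fixes q :: real
  assumes sf: "sigma_finite_measure \<mu>" and pq: "1 < p" "1 < q" "1 / p + 1 / q = 1"
begin

lemma comp_id: "v \<in> carrier V \<Longrightarrow> comp_cls \<mu> (\<lambda>x. x) (pnorm V v) = pnorm V v"
  unfolding comp_cls_def by (rule cls_rep[OF pn_L0])

sublocale D: local_maps \<mu> V \<mu> "\<lambda>x. x" p q
  by (rule local_maps.intro[OF module_axioms local_maps_axioms.intro[OF R.cring_axioms sf pq]])
    (simp add: comp_id pnorm_in)

lemma D_boundD:
  assumes "D.bound T g" "v \<in> carrier V" shows "AE x in \<mu>. \<bar>rep (T v) x\<bar> \<le> g x * pn v x"
  using D.boundD(4)[OF assms] by (simp add: comp_id assms)

lemma D_boundI:
  assumes "lp_fun q \<mu> g" "AE x in \<mu>. 0 \<le> g x"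
    "\<And>v. v \<in> carrier V \<Longrightarrow> AE x in \<mu>. \<bar>rep (T v) x\<bar> \<le> g x * pn v x"
  shows "D.bound T g"
  unfolding D.bound_def using assms by (simp add: comp_id)

lemma D_minus:
  assumes T: "T \<in> carrier D.H" and v: "v \<in> carrier V" and w: "w \<in> carrier V"
  shows "AE x in \<mu>. rep (T (v \<ominus>\<^bsub>V\<^esub> w)) x = rep (T v) x - rep (T w) x"
proof -
  have "(v \<ominus>\<^bsub>V\<^esub> w) \<oplus>\<^bsub>V\<^esub> w = v" using v w by (simp add: a_minus_def M.a_assoc M.l_neg)
  then have "AE x in \<mu>. rep (T v) x = rep (T (v \<ominus>\<^bsub>V\<^esub> w)) x + rep (T w) x"
    using D.H_D(5)[OF T M.minus_closed[OF v w] w] by simp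
  then show ?thesis by eventually_elim simp
qed

text \<open>For a constant \<open>c\<close>, the bound at \<open>(f - c) v\<close> reads \<open>\<bar>T (f v) - c T v\<bar> \<le> g \<bar>f - c\<bar> \<bar>v\<bar>\<close>; letting rational
\<open>c\<close> tend to the value of \<open>f\<close> at the point gives \<open>T (f v) = f T v\<close>.\<close>

lemma D_Linf_linear:
  assumes T: "T \<in> carrier D.H" and f: "f \<in> carrier (Linf \<mu>)" and v: "v \<in> carrier V"
  shows "AE x in \<mu>. rep (T (f \<odot>\<^bsub>V\<^esub> v)) x = rep f x * rep (T v) x"
proof -
  obtain g where g: "D.bound T g" using D.H_D(7)[OF T] by blast
  have "AE x in \<mu>. \<bar>rep (T (f \<odot>\<^bsub>V\<^esub> v)) x + c * - rep (T v) x\<bar> \<le> 0 + \<bar>rep f x - c\<bar> * (g x * pn v x)" for c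
  proof -
    define z where "z = add_cls \<mu> f (const_cls \<mu> (- c))"
    have z: "z \<in> carrier (Linf \<mu>)" using R.a_closed[OF f const_Linf[of \<mu> "-c"]] by (simp add: z_def)
    have eq: "z \<odot>\<^bsub>V\<^esub> v = f \<odot>\<^bsub>V\<^esub> v \<oplus>\<^bsub>V\<^esub> rscale \<mu> V (- c) v"
      unfolding z_def rscale_def using smult_l_distr[OF f const_Linf v, of "-c"] by simp
    show ?thesis
      using D_boundD[OF g smult_closed[OF z v]] pn_smult[OF z v]
        AE_add_cls[OF Linf_L0[OF f] const_cls_L0[of \<mu> "-c"], folded z_def] AE_const_cls[of \<mu> "-c"]
        D.H_D(5)[OF T smult_closed[OF f v] D.rscale_closed[OF v, of "-c"], folded eq] D.H_D(6)[OF T v, where c="-c"]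
      by eventually_elim (simp add: mult_ac)
  qed
  then have "AE x in \<mu>. \<forall>c\<in>\<rat>. \<bar>rep (T (f \<odot>\<^bsub>V\<^esub> v)) x + c * - rep (T v) x\<bar> \<le> 0 + \<bar>rep f x - c\<bar> * (g x * pn v x)"
    by (intro AE_all_rats)
  then show ?thesis
  proof eventually_elim
    case (elim x)
    have "\<bar>rep (T (f \<odot>\<^bsub>V\<^esub> v)) x + rep f x * - rep (T v) x\<bar> \<le> 0"
      by (rule le_rat_approx) (use elim in blast)
    then show ?case by simp
  qed
qed

lemma D_L1_le:
  assumes T: "T \<in> carrier D.H" and g: "D.bound T g" and v: "v \<in> carrier V"
  shows "Lp_norm 1 \<mu> (T v) \<le> lp_norm q \<mu> g * nrm V v"
proof -
  have "Lp_norm 1 \<mu> (T v) = (\<integral>x. \<bar>rep (T v) x\<bar> \<partial>\<mu>)" by (simp add: Lp_norm_eq lp_norm_1)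
  also have "\<dots> \<le> (\<integral>x. \<bar>g x * pn v x\<bar> \<partial>\<mu>)"
  proof (rule integral_mono_AE)
    show "AE x in \<mu>. \<bar>rep (T v) x\<bar> \<le> \<bar>g x * pn v x\<bar>"
      using D_boundD[OF g v] by eventually_elim simp
  qed (use D.H_D(2)[OF T v] Holder(1)[OF D.boundD(1)[OF g] pn_lp[OF v] pq] in \<open>auto simp: Lp1_iff\<close>)
  also have "\<dots> \<le> lp_norm q \<mu> g * nrm V v"
    unfolding nrm_lp[OF v] by (rule Holder(2)[OF D.boundD(1)[OF g] pn_lp[OF v] pq])
  finally show ?thesis .
qed

lemma Linf_linearD:
  assumes L: "Linf_linear_map \<mu> V (Lp 1 \<mu>) L"
  shows "v \<in> carrier V \<Longrightarrow> L v \<in> Lp_set 1 \<mu>"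
    "v \<in> carrier V \<Longrightarrow> w \<in> carrier V \<Longrightarrow> AE x in \<mu>. rep (L (v \<oplus>\<^bsub>V\<^esub> w)) x = rep (L v) x + rep (L w) x"
    "f \<in> carrier (Linf \<mu>) \<Longrightarrow> v \<in> carrier V \<Longrightarrow> AE x in \<mu>. rep (L (f \<odot>\<^bsub>V\<^esub> v)) x = rep f x * rep (L v) x"
proof -
  have c: "v \<in> carrier V \<Longrightarrow> L v \<in> Lp_set 1 \<mu>" for v
    using L by (auto simp: Linf_linear_map_def additive_map_def)
  then show "v \<in> carrier V \<Longrightarrow> L v \<in> Lp_set 1 \<mu>" .
  show "AE x in \<mu>. rep (L (v \<oplus>\<^bsub>V\<^esub> w)) x = rep (L v) x + rep (L w) x" if "v \<in> carrier V" "w \<in> carrier V"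
    using AE_add_cls[OF Lp_set_L0[OF c] Lp_set_L0[OF c], OF that] L that
    by (simp add: Linf_linear_map_def additive_map_def)
  show "AE x in \<mu>. rep (L (f \<odot>\<^bsub>V\<^esub> v)) x = rep f x * rep (L v) x" if "f \<in> carrier (Linf \<mu>)" "v \<in> carrier V"
    using AE_mult_cls[OF Linf_L0[OF that(1)] Lp_set_L0[OF c[OF that(2)]]] L that
    by (simp add: Linf_linear_map_def)
qed

text \<open>The values \<open>L v\<close> with \<open>\<bar>v\<bar> \<le> 1\<close> form a directed family, because the maximum of \<open>L v\<close> and \<open>L w\<close> is the
value of \<open>L\<close> at the element that equals \<open>v\<close> where \<open>L v \<ge> L w\<close> and \<open>w\<close> elsewhere. Its supremum \<open>g\<close> lies in
\<open>L\<^sup>q\<close> by duality. Since \<open>v / \<bar>v\<bar>\<close> need not belong to the module, \<open>\<bar>L v\<bar> \<le> g \<bar>v\<bar>\<close> is obtained on the sets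
where \<open>\<bar>v\<bar> > 1 / (n + 1)\<close>, and on \<open>\<bar>v\<bar> = 0\<close> from the locality of \<open>L\<close>.\<close>

lemma dual_representing_bound:
  assumes L: "Linf_linear_map \<mu> V (Lp 1 \<mu>) L" and C: "0 \<le> C"
    and LC: "\<And>v. v \<in> carrier V \<Longrightarrow> Lp_norm 1 \<mu> (L v) \<le> C * nrm V v"
  obtains g where "D.bound L g" "lp_norm q \<mu> g \<le> C"
    "\<And>h. (\<And>v. v \<in> carrier V \<Longrightarrow> AE x in \<mu>. pn v x \<le> 1 \<Longrightarrow> AE x in \<mu>. rep (L v) x \<le> h x) \<Longrightarrow>
      AE x in \<mu>. g x \<le> h x"
proof -
  interpret S: sigma_finite_measure \<mu> by (rule sf)
  note LD = Linf_linearD[OF L]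
  have p0: "p > 0" using pq by simp
  have Lm: "rep (L v) \<in> borel_measurable \<mu>" if "v \<in> carrier V" for v
    using LD(1)[OF that] by (auto simp: Lp1_iff)
  have L0: "AE x in \<mu>. rep (L \<zero>\<^bsub>V\<^esub>) x = 0"
    using LD(2)[OF M.zero_closed M.zero_closed] by simp
  define F where "F = {rep (L v) | v. v \<in> carrier V \<and> (AE x in \<mu>. pn v x \<le> 1)}"
  have zF: "rep (L \<zero>\<^bsub>V\<^esub>) \<in> F"
  proof -
    have "AE x in \<mu>. pn \<zero>\<^bsub>V\<^esub> x \<le> 1" using pn_zero by eventually_elim simp
    then show ?thesis unfolding F_def by blast
  qed
  have Fm: "F \<subseteq> borel_measurable \<mu>" using Lm by (auto simp: F_def)
  have dir: "\<exists>h\<in>F. AE x in \<mu>. f x \<le> h x \<and> g x \<le> h x" if f: "f \<in> F" and g: "g \<in> F" for f g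
  proof -
    obtain v where v: "f = rep (L v)" "v \<in> carrier V" "AE x in \<mu>. pn v x \<le> 1" using f unfolding F_def by blast
    obtain w where w: "g = rep (L w)" "w \<in> carrier V" "AE x in \<mu>. pn w x \<le> 1" using g unfolding F_def by blast
    note [measurable] = Lm[OF v(2)] Lm[OF w(2)]
    define a where "a x = (if rep (L w) x \<le> rep (L v) x then 1 else 0 :: real)" for x
    have am[measurable]: "a \<in> borel_measurable \<mu>" "(\<lambda>x. 1 - a x) \<in> borel_measurable \<mu>" unfolding a_def by measurable
    define e e' where "e = cls \<mu> a" and "e' = cls \<mu> (\<lambda>x. 1 - a x)"
    have e: "e \<in> carrier (Linf \<mu>)" "e' \<in> carrier (Linf \<mu>)"
      unfolding e_def e'_def by (rule cls_Linf[of _ _ 1]; use am in \<open>simp add: a_def\<close>)+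
    have re: "AE x in \<mu>. rep e x = a x" "AE x in \<mu>. rep e' x = 1 - a x"
      unfolding e_def e'_def by (rule AE_rep_cls; use am in simp)+
    define z where "z = e \<odot>\<^bsub>V\<^esub> v \<oplus>\<^bsub>V\<^esub> e' \<odot>\<^bsub>V\<^esub> w"
    have ev: "e \<odot>\<^bsub>V\<^esub> v \<in> carrier V" "e' \<odot>\<^bsub>V\<^esub> w \<in> carrier V" using e v w by simp_all
    have z: "z \<in> carrier V" using ev by (simp add: z_def)
    have "AE x in \<mu>. pn z x \<le> 1"
      using pn_triangle[OF ev p0, folded z_def] pn_smult[OF e(1) v(2)] pn_smult[OF e(2) w(2)] re v(3) w(3)
      by eventually_elim (auto simp: a_def split: if_splits)
    then have "rep (L z) \<in> F" using z unfolding F_def by blast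
    moreover have "AE x in \<mu>. f x \<le> rep (L z) x \<and> g x \<le> rep (L z) x"
      using LD(2)[OF ev, folded z_def] LD(3)[OF e(1) v(2)] LD(3)[OF e(2) w(2)] re
      unfolding v(1) w(1) by eventually_elim (auto simp: a_def)
    ultimately show ?thesis by blast
  qed
  obtain u where u: "range u \<subseteq> F" and inc: "AE x in \<mu>. incseq (\<lambda>n. u n x)"
    and sup: "\<And>f. f \<in> F \<Longrightarrow> AE x in \<mu>. ereal (f x) \<le> (SUP n. ereal (u n x))"
    using S.directed_sup_sequence[OF _ Fm dir] zF by blast
  have "\<exists>v. u n = rep (L v) \<and> v \<in> carrier V \<and> (AE x in \<mu>. pn v x \<le> 1)" for n
    using u unfolding F_def by auto
  then obtain v where v: "\<And>n. u n = rep (L (v n))" "\<And>n. v n \<in> carrier V" "\<And>n. AE x in \<mu>. pn (v n) x \<le> 1"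
    by metis
  have um: "u n \<in> borel_measurable \<mu>" for n using u Fm by auto
  have test: "integrable \<mu> (\<lambda>x. h x * u n x) \<and> (\<integral>x. h x * u n x \<partial>\<mu>) \<le> C * lp_norm p \<mu> h"
    if h: "lp_fun p \<mu> h" and hK: "\<forall>x. 0 \<le> h x \<and> h x \<le> K" for n h K
  proof -
    have hm[measurable]: "h \<in> borel_measurable \<mu>" using h by (rule lp_fun_meas)
    define k where "k = cls \<mu> h"
    have k: "k \<in> carrier (Linf \<mu>)" unfolding k_def by (rule cls_Linf[of _ _ K]) (use hm hK in auto)
    have rk: "AE x in \<mu>. rep k x = h x" unfolding k_def using hm by (rule AE_rep_cls)
    have kv: "k \<odot>\<^bsub>V\<^esub> v n \<in> carrier V" using k v by simp
    have eq: "AE x in \<mu>. rep (L (k \<odot>\<^bsub>V\<^esub> v n)) x = h x * u n x"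
      using LD(3)[OF k v(2)[of n]] rk unfolding v(1) by eventually_elim simp
    have int: "integrable \<mu> (rep (L (k \<odot>\<^bsub>V\<^esub> v n)))" using LD(1)[OF kv] by (simp add: Lp1_iff)
    then have int': "integrable \<mu> (\<lambda>x. h x * u n x)"
      by (rule integrable_cong_AE_imp) (use eq um hm in auto)
    have "(\<integral>x. h x * u n x \<partial>\<mu>) = (\<integral>x. rep (L (k \<odot>\<^bsub>V\<^esub> v n)) x \<partial>\<mu>)"
      by (rule integral_cong_AE) (use eq um hm Lm[OF kv] in \<open>auto simp: AE_symmetric\<close>)
    also have "\<dots> \<le> (\<integral>x. \<bar>rep (L (k \<odot>\<^bsub>V\<^esub> v n)) x\<bar> \<partial>\<mu>)"
      using int by (intro integral_mono) auto
    also have "\<dots> \<le> C * nrm V (k \<odot>\<^bsub>V\<^esub> v n)"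
      using LC[OF kv] by (simp add: Lp_norm_eq lp_norm_1)
    also have "nrm V (k \<odot>\<^bsub>V\<^esub> v n) \<le> lp_norm p \<mu> h"
      unfolding nrm_lp[OF kv]
    proof (rule lp_fun_mono(2)[OF h pn_meas[OF kv]])
      show "AE x in \<mu>. \<bar>pn (k \<odot>\<^bsub>V\<^esub> v n) x\<bar> \<le> \<bar>h x\<bar>"
        using pn_smult[OF k v(2)[of n]] rk v(3)[of n] pn_nonneg[OF v(2)[of n]]
        by eventually_elim (auto simp: abs_mult intro: mult_left_le)
    qed (use pq in simp)
    finally have "(\<integral>x. h x * u n x \<partial>\<mu>) \<le> C * lp_norm p \<mu> h"
      using C by (simp add: mult_left_mono)
    with int' show ?thesis by blast
  qed
  obtain g where g: "lp_fun q \<mu> g" "lp_norm q \<mu> g \<le> C" "\<forall>x. 0 \<le> g x"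
    and gl: "AE x in \<mu>. (\<forall>n. u n x \<le> g x) \<and> (\<forall>b\<ge>0. (\<forall>n. u n x \<le> b) \<longrightarrow> g x \<le> b)"
    by (rule S.Lq_limit_by_duality[OF pq C um inc test])
  have gF: "AE x in \<mu>. rep (L w) x \<le> g x" if w: "w \<in> carrier V" "AE x in \<mu>. pn w x \<le> 1" for w
  proof -
    have "rep (L w) \<in> F" using w unfolding F_def by blast
    from sup[OF this] gl show ?thesis
    proof eventually_elim
      case (elim x)
      have "(SUP n. ereal (u n x)) \<le> ereal (g x)" using elim(2) by (intro SUP_least) simp
      with elim(1) have "ereal (rep (L w) x) \<le> ereal (g x)" by (rule order_trans)
      then show ?case by simp
    qed
  qed
  have one_sided: "AE x in \<mu>. rep (L w) x \<le> g x * pn w x" if w: "w \<in> carrier V" for w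
  proof -
    note [measurable] = pn_meas[OF w]
    \<comment> \<open>Normalising \<open>w\<close> where its norm is not too small keeps the coefficient bounded.\<close>
    define a where "a n x = (if pn w x > 1 / Suc n then 1 / pn w x else 0)" for n x
    have am: "a n \<in> borel_measurable \<mu>" for n unfolding a_def by measurable
    have al: "\<bar>a n x\<bar> \<le> Suc n" for n x
    proof (cases "pn w x > 1 / Suc n")
      case True
      moreover from this have "pn w x > 0" by (rule less_trans[rotated]) simp
      ultimately show ?thesis by (simp add: a_def field_simps)
    qed (simp add: a_def)
    have aL: "cls \<mu> (a n) \<in> carrier (Linf \<mu>)" for n by (rule cls_Linf[OF am, where C="real (Suc n)"]) (use al in simp)
    have ar: "AE x in \<mu>. rep (cls \<mu> (a n)) x = a n x" for n using am by (rule AE_rep_cls)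
    have "AE x in \<mu>. a n x * rep (L w) x \<le> g x" for n
    proof -
      have "AE x in \<mu>. pn (cls \<mu> (a n) \<odot>\<^bsub>V\<^esub> w) x \<le> 1"
        using pn_smult[OF aL w, of n] ar[of n] pn_nonneg[OF w] by eventually_elim (auto simp: a_def)
      from gF[OF smult_closed[OF aL w] this] LD(3)[OF aL w, of n] ar[of n]
      show ?thesis by eventually_elim simp
    qed
    then have A: "AE x in \<mu>. \<forall>n. a n x * rep (L w) x \<le> g x" unfolding AE_all_countable by blast
    define b where "b x = (if pn w x = 0 then 1 else 0 :: real)" for x
    have bm: "b \<in> borel_measurable \<mu>" unfolding b_def by measurable
    have bL: "cls \<mu> b \<in> carrier (Linf \<mu>)" by (rule cls_Linf[OF bm, where C=1]) (simp add: b_def)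
    have br: "AE x in \<mu>. rep (cls \<mu> b) x = b x" using bm by (rule AE_rep_cls)
    have "AE x in \<mu>. pn (cls \<mu> b \<odot>\<^bsub>V\<^esub> w) x = 0"
      using pn_smult[OF bL w] br by eventually_elim (simp add: b_def)
    then have "cls \<mu> b \<odot>\<^bsub>V\<^esub> w = \<zero>\<^bsub>V\<^esub>"
      using p0 by (intro eq_zero_if_pn_zero smult_closed[OF bL w])
    then have "AE x in \<mu>. rep (L \<zero>\<^bsub>V\<^esub>) x = rep (cls \<mu> b) x * rep (L w) x"
      using LD(3)[OF bL w] by simp
    then have "AE x in \<mu>. b x * rep (L w) x = 0"
      using br L0 by eventually_elim simp
    with A pn_nonneg[OF w] show ?thesis
    proof eventually_elim
      case (elim x)
      show ?case
      proof (cases "pn w x = 0")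
        case False
        then have pos: "pn w x > 0" using elim by simp
        then obtain n where "1 / Suc n < pn w x" using nat_approx_posE by blast
        then have "rep (L w) x / pn w x \<le> g x" using elim(1)[rule_format, of n] by (simp add: a_def)
        then show ?thesis using pos by (simp add: divide_le_eq)
      qed (use elim in \<open>simp add: b_def\<close>)
    qed
  qed
  have "D.bound L g"
  proof (rule D_boundI[OF g(1)])
    fix w assume w: "w \<in> carrier V"
    have nw: "const_cls \<mu> (- 1) \<odot>\<^bsub>V\<^esub> w \<in> carrier V" using w const_Linf[of \<mu> "-1"] by simp
    show "AE x in \<mu>. \<bar>rep (L w) x\<bar> \<le> g x * pn w x"
      using one_sided[OF w] one_sided[OF nw] LD(3)[OF const_Linf w, of "-1"]
        pn_smult[OF const_Linf w, of "-1"] AE_const_cls[of \<mu> "-1"]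
      by eventually_elim auto
  qed (use g in simp)
  moreover have "AE x in \<mu>. g x \<le> h x"
    if h: "\<And>v. v \<in> carrier V \<Longrightarrow> AE x in \<mu>. pn v x \<le> 1 \<Longrightarrow> AE x in \<mu>. rep (L v) x \<le> h x" for h
  proof -
    have "AE x in \<mu>. \<forall>n. u n x \<le> h x" unfolding AE_all_countable v(1) using h v by blast
    moreover have "AE x in \<mu>. pn \<zero>\<^bsub>V\<^esub> x \<le> 1" using pn_zero by eventually_elim simp
    note h[OF M.zero_closed this]
    ultimately show ?thesis using gl L0
    proof eventually_elim
      case (elim x)
      then have "0 \<le> h x" by simp
      then show ?case using elim by blast
    qed
  qed
  ultimately show thesis using g(2) that by blast
qed

lemma dual_simps:
  "carrier (dual_module \<mu> V) = {L \<in> extensional (carrier V). Linf_linear_map \<mu> V (Lp 1 \<mu>) L \<and> continuous_map_nrm V (Lp 1 \<mu>) L}"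
  "pnorm (dual_module \<mu> V) L = ess_sup \<mu> {L v | v. v \<in> carrier V \<and> le_cls \<mu> (pnorm V v) (const_cls \<mu> 1)}"
  "nrm (dual_module \<mu> V) L = (SUP v\<in>{v \<in> carrier V. nrm V v \<le> 1}. nrm (Lp 1 \<mu>) (L v))"
  by (simp_all add: dual_module_def)

lemma L1_norm_scale:
  assumes L: "Linf_linear_map \<mu> V (Lp 1 \<mu>) L" and v: "v \<in> carrier V"
  shows "Lp_norm 1 \<mu> (L (rscale \<mu> V c v)) = \<bar>c\<bar> * Lp_norm 1 \<mu> (L v)"
proof -
  have Lv: "L v \<in> Lp_set 1 \<mu>" by (rule Linf_linearD(1)[OF L v])
  have Lc: "L (rscale \<mu> V c v) \<in> Lp_set 1 \<mu>" by (rule Linf_linearD(1)[OF L D.rscale_closed[OF v]])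
  have "lp_norm 1 \<mu> (rep (L (rscale \<mu> V c v))) = lp_norm 1 \<mu> (\<lambda>x. c * rep (L v) x)"
  proof (rule lp_norm_cong)
    show "AE x in \<mu>. rep (L (rscale \<mu> V c v)) x = c * rep (L v) x"
      using Linf_linearD(3)[OF L const_Linf v, of c] AE_const_cls[of \<mu> c]
      unfolding rscale_def by eventually_elim simp
  qed (use Lv Lc in \<open>auto simp: Lp1_iff\<close>)
  then show ?thesis
    using lp_scale(2)[of 1 \<mu> "rep (L v)" c] Lv by (simp add: Lp_norm_eq Lp_set_iff)
qed

lemma bounded_of_unit_ball:
  assumes L: "Linf_linear_map \<mu> V (Lp 1 \<mu>) L" and d: "d > 0"
    and b: "\<And>v. v \<in> carrier V \<Longrightarrow> nrm V v \<le> d \<Longrightarrow> Lp_norm 1 \<mu> (L v) \<le> B" and v: "v \<in> carrier V"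
  shows "Lp_norm 1 \<mu> (L v) \<le> B / d * nrm V v"
proof (cases "nrm V v = 0")
  case True
  have "Lp_norm 1 \<mu> (L (rscale \<mu> V 0 v)) = 0" using L1_norm_scale[OF L v, of 0] by simp
  moreover have "rscale \<mu> V 0 v = v"
    using True nrm_eq_0_iff[OF v] smult_l_null[OF v] by (simp add: rscale_def)
  ultimately show ?thesis using True by simp
next
  case False
  then have n: "nrm V v > 0" using nrm_nonneg[OF v] by simp
  define c where "c = d / nrm V v"
  have "nrm V (rscale \<mu> V c v) = d" using n d nrm_rscale[OF v, of c] by (simp add: c_def)
  then have "c * Lp_norm 1 \<mu> (L v) \<le> B"
    using b[OF D.rscale_closed[OF v, of c]] L1_norm_scale[OF L v, of c] n d by (simp add: c_def)
  then show ?thesis using n d by (simp add: c_def field_simps)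
qed

lemma dual_bounded:
  assumes L: "Linf_linear_map \<mu> V (Lp 1 \<mu>) L" and cont: "continuous_map_nrm V (Lp 1 \<mu>) L"
  obtains C where "0 \<le> C" "\<And>v. v \<in> carrier V \<Longrightarrow> Lp_norm 1 \<mu> (L v) \<le> C * nrm V v"
proof -
  note LD = Linf_linearD[OF L]
  obtain d where d: "d > 0"
    "\<And>w. w \<in> carrier V \<Longrightarrow> nrm V (w \<ominus>\<^bsub>V\<^esub> \<zero>\<^bsub>V\<^esub>) < d \<Longrightarrow> Lp_norm 1 \<mu> (L w \<ominus>\<^bsub>Lp 1 \<mu>\<^esub> L \<zero>\<^bsub>V\<^esub>) < 1"
    using cont[unfolded continuous_map_nrm_def, rule_format, OF M.zero_closed, of 1] by auto
  have L0: "AE x in \<mu>. rep (L \<zero>\<^bsub>V\<^esub>) x = 0"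
    using LD(2)[OF M.zero_closed M.zero_closed] by simp
  have "Lp_norm 1 \<mu> (L w) \<le> 1" if w: "w \<in> carrier V" "nrm V w \<le> d / 2" for w
  proof -
    have z: "w \<ominus>\<^bsub>V\<^esub> \<zero>\<^bsub>V\<^esub> = w" using w by (simp add: a_minus_def)
    note m = Lp1_minus[OF LD(1)[OF w(1)] LD(1)[OF M.zero_closed]]
    have "Lp_norm 1 \<mu> (L w \<ominus>\<^bsub>Lp 1 \<mu>\<^esub> L \<zero>\<^bsub>V\<^esub>) = Lp_norm 1 \<mu> (L w)"
      unfolding Lp_norm_eq
    proof (rule lp_norm_cong)
      show "AE x in \<mu>. rep (L w \<ominus>\<^bsub>Lp 1 \<mu>\<^esub> L \<zero>\<^bsub>V\<^esub>) x = rep (L w) x"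
        using m(2) L0 by eventually_elim simp
    qed (use m(1) LD(1)[OF w(1)] in \<open>auto simp: Lp1_iff\<close>)
    then show ?thesis using d(2)[OF w(1)] d(1) w(2) z by simp
  qed
  then have "Lp_norm 1 \<mu> (L v) \<le> 1 / (d / 2) * nrm V v" if "v \<in> carrier V" for v
    using bounded_of_unit_ball[OF L _ _ that, of "d / 2" 1] d(1) by simp
  moreover have "0 \<le> 1 / (d / 2)" using d(1) by simp
  ultimately show thesis by (rule that[rotated])
qed

lemma dual_carrier: "carrier (dual_module \<mu> V) = carrier D.H"
proof (intro Set.set_eqI iffI)
  fix L assume "L \<in> carrier (dual_module \<mu> V)"
  then have ext: "L \<in> extensional (carrier V)" and L: "Linf_linear_map \<mu> V (Lp 1 \<mu>) L"
    and cont: "continuous_map_nrm V (Lp 1 \<mu>) L" by (auto simp: dual_simps)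
  obtain C where "0 \<le> C" "\<And>v. v \<in> carrier V \<Longrightarrow> Lp_norm 1 \<mu> (L v) \<le> C * nrm V v"
    using dual_bounded[OF L cont] by blast
  then obtain g where "D.bound L g" using dual_representing_bound[OF L] by blast
  moreover have "AE x in \<mu>. rep (L (rscale \<mu> V c v)) x = c * rep (L v) x" if "v \<in> carrier V" for c v
    using Linf_linearD(3)[OF L const_Linf that, of c] AE_const_cls[of \<mu> c]
    unfolding rscale_def by eventually_elim simp
  ultimately show "L \<in> carrier D.H"
    unfolding D.H_carrier using ext Linf_linearD[OF L] by blast
next
  fix T assume T: "T \<in> carrier D.H"
  obtain g where g: "D.bound T g" using D.H_D(7)[OF T] by blast
  have lin: "Linf_linear_map \<mu> V (Lp 1 \<mu>) T"
    unfolding Linf_linear_map_def additive_map_def Lp_simps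
  proof (intro conjI ballI)
    show "T \<in> carrier V \<rightarrow> Lp_set 1 \<mu>" using D.H_D(2)[OF T] by blast
    fix v assume v: "v \<in> carrier V"
    note Tv = D.H_D(3)[OF T v]
    show "T (v \<oplus>\<^bsub>V\<^esub> w) = add_cls \<mu> (T v) (T w)" if w: "w \<in> carrier V" for w
    proof (rule L0_eqI[OF D.H_D(3)[OF T M.a_closed[OF v w]] add_cls_L0[OF Tv D.H_D(3)[OF T w]]])
      show "AE x in \<mu>. rep (T (v \<oplus>\<^bsub>V\<^esub> w)) x = rep (add_cls \<mu> (T v) (T w)) x"
        using D.H_D(5)[OF T v w] AE_add_cls[OF Tv D.H_D(3)[OF T w]] by eventually_elim simp
    qed
    show "T (f \<odot>\<^bsub>V\<^esub> v) = mult_cls \<mu> f (T v)" if f: "f \<in> carrier (Linf \<mu>)" for f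
    proof (rule L0_eqI[OF D.H_D(3)[OF T smult_closed[OF f v]] mult_cls_L0[OF Linf_L0[OF f] Tv]])
      show "AE x in \<mu>. rep (T (f \<odot>\<^bsub>V\<^esub> v)) x = rep (mult_cls \<mu> f (T v)) x"
        using D_Linf_linear[OF T f v] AE_mult_cls[OF Linf_L0[OF f] Tv] by eventually_elim simp
    qed
  qed
  have "continuous_map_nrm V (Lp 1 \<mu>) T"
    unfolding continuous_map_nrm_def Lp_simps
  proof (intro ballI allI impI)
    fix v and e :: real assume v: "v \<in> carrier V" and e: "0 < e"
    define k where "k = lp_norm q \<mu> g + 1"
    have k: "0 < k" "lp_norm q \<mu> g \<le> k" using lp_norm_nonneg[of q \<mu> g] by (auto simp: k_def)
    have "Lp_norm 1 \<mu> (T w \<ominus>\<^bsub>Lp 1 \<mu>\<^esub> T v) < e" if w: "w \<in> carrier V" and d: "nrm V (w \<ominus>\<^bsub>V\<^esub> v) < e / k" for w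
    proof -
      have wv: "w \<ominus>\<^bsub>V\<^esub> v \<in> carrier V" using w v by simp
      note m = Lp1_minus[OF D.H_D(2)[OF T w] D.H_D(2)[OF T v]]
      have "Lp_norm 1 \<mu> (T w \<ominus>\<^bsub>Lp 1 \<mu>\<^esub> T v) = Lp_norm 1 \<mu> (T (w \<ominus>\<^bsub>V\<^esub> v))"
        unfolding Lp_norm_eq
      proof (rule lp_norm_cong)
        show "AE x in \<mu>. rep (T w \<ominus>\<^bsub>Lp 1 \<mu>\<^esub> T v) x = rep (T (w \<ominus>\<^bsub>V\<^esub> v)) x"
          using m(2) D_minus[OF T w v] by eventually_elim simp
      qed (use m(1) D.H_D(4)[OF T wv] in \<open>auto simp: Lp1_iff\<close>)
      also have "\<dots> \<le> lp_norm q \<mu> g * nrm V (w \<ominus>\<^bsub>V\<^esub> v)" by (rule D_L1_le[OF T g wv])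
      also have "\<dots> \<le> k * nrm V (w \<ominus>\<^bsub>V\<^esub> v)" using k nrm_nonneg[OF wv] by (intro mult_right_mono)
      also have "\<dots> < e" using d k by (simp add: field_simps)
      finally show ?thesis .
    qed
    then show "\<exists>d>0. \<forall>w\<in>carrier V. nrm V (w \<ominus>\<^bsub>V\<^esub> v) < d \<longrightarrow> Lp_norm 1 \<mu> (T w \<ominus>\<^bsub>Lp 1 \<mu>\<^esub> T v) < e"
      using e k by (intro exI[of _ "e / k"]) auto
  qed
  then show "T \<in> carrier (dual_module \<mu> V)" using lin D.H_D(1)[OF T] by (simp add: dual_simps)
qed

lemma dual_Linf_linear: "L \<in> carrier D.H \<Longrightarrow> Linf_linear_map \<mu> V (Lp 1 \<mu>) L"
  unfolding dual_carrier[symmetric] by (simp add: dual_simps)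

lemma dual_norms:
  assumes L: "L \<in> carrier D.H"
  shows "pnorm (dual_module \<mu> V) L = pnorm D.H L" "nrm (dual_module \<mu> V) L = nrm D.H L"
proof -
  note lin = dual_Linf_linear[OF L]
  note h = D.hn_props[OF L]
  define B where "B = {v \<in> carrier V. nrm V v \<le> 1}"
  have zB: "\<zero>\<^bsub>V\<^esub> \<in> B" using nrm_eq_0_iff[OF M.zero_closed] by (simp add: B_def)
  have up: "Lp_norm 1 \<mu> (L v) \<le> nrm D.H L" if "v \<in> B" for v
  proof -
    have "Lp_norm 1 \<mu> (L v) \<le> lp_norm q \<mu> (D.hn L) * nrm V v"
      using that by (intro D_L1_le[OF L h(2)]) (simp add: B_def)
    also have "\<dots> \<le> lp_norm q \<mu> (D.hn L) * 1"
      using that by (intro mult_left_mono lp_norm_nonneg) (simp add: B_def)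
    finally show ?thesis by (simp add: h(8))
  qed
  have bdd: "bdd_above ((\<lambda>v. Lp_norm 1 \<mu> (L v)) ` B)" using up by (intro bdd_aboveI2)
  define C where "C = (SUP v\<in>B. Lp_norm 1 \<mu> (L v))"
  have C_up: "Lp_norm 1 \<mu> (L v) \<le> C" if "v \<in> B" for v unfolding C_def using that bdd by (rule cSUP_upper)
  have C0: "0 \<le> C" using C_up[OF zB] lp_norm_nonneg[of 1 \<mu> "rep (L \<zero>\<^bsub>V\<^esub>)"] by (simp add: Lp_norm_eq)
  have LC: "Lp_norm 1 \<mu> (L v) \<le> C * nrm V v" if "v \<in> carrier V" for v
    using bounded_of_unit_ball[OF lin zero_less_one _ that, of C] C_up by (simp add: B_def)
  obtain g where g: "D.bound L g" "lp_norm q \<mu> g \<le> C"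
    and gl: "\<And>h. (\<And>v. v \<in> carrier V \<Longrightarrow> AE x in \<mu>. pn v x \<le> 1 \<Longrightarrow> AE x in \<mu>. rep (L v) x \<le> h x) \<Longrightarrow>
      AE x in \<mu>. g x \<le> h x"
    using dual_representing_bound[OF lin C0 LC] by blast
  have "C \<le> nrm D.H L" unfolding C_def using zB up by (intro cSUP_least) auto
  moreover have "nrm D.H L \<le> C" using D.H_nrm_le[OF L g(1)] g(2) by simp
  ultimately show "nrm (dual_module \<mu> V) L = nrm D.H L"
    by (simp add: dual_simps C_def B_def)
  show "pnorm (dual_module \<mu> V) L = pnorm D.H L"
    unfolding dual_simps
  proof (rule ess_sup_eqI[OF h(1)])
    fix F assume "F \<in> {L v | v. v \<in> carrier V \<and> le_cls \<mu> (pnorm V v) (const_cls \<mu> 1)}"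
    then obtain v where v: "F = L v" "v \<in> carrier V" "AE x in \<mu>. pn v x \<le> 1"
      by (auto simp: le_const_cls_iff)
    show "le_cls \<mu> F (pnorm D.H L)"
      unfolding le_cls_def v(1) using D_boundD[OF h(2) v(2)] v(3) h(4)
    proof eventually_elim
      case (elim x)
      have "D.hn L x * pn v x \<le> D.hn L x" using elim by (simp add: mult_left_le)
      then show ?case using elim(1) by linarith
    qed
  next
    fix K assume K: "\<And>F. F \<in> {L v | v. v \<in> carrier V \<and> le_cls \<mu> (pnorm V v) (const_cls \<mu> 1)} \<Longrightarrow> le_cls \<mu> F K"
    have "AE x in \<mu>. rep (L v) x \<le> rep K x" if "v \<in> carrier V" "AE x in \<mu>. pn v x \<le> 1" for v
    proof -
      have "L v \<in> {L v | v. v \<in> carrier V \<and> le_cls \<mu> (pnorm V v) (const_cls \<mu> 1)}"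
        unfolding le_const_cls_iff using that by blast
      from K[OF this] show ?thesis by (simp add: le_cls_def)
    qed
    then have "AE x in \<mu>. g x \<le> rep K x" by (rule gl)
    then show "le_cls \<mu> (pnorm D.H L) K"
      unfolding le_cls_def using h(3)[OF g(1)] by eventually_elim simp
  qed
qed

lemma dual_normed_module: "Lp_normed_module q \<mu> (dual_module \<mu> V)"
  by (rule Lp_normed_module_cong[OF D.Hom_loc_normed_module])
    (use dual_norms in \<open>simp_all add: dual_carrier, simp_all add: dual_module_def Hom_loc_def\<close>)

end

section \<open>Extension from the generators of the pullback\<close>

locale pullback_setting =
  M: Lp_normed_module p \<mu>X M + dual_exponent_module p \<mu>Y N q
  for p q :: real and \<mu>X :: "'x measure" and M :: "('x fclass, 'm) normed_mod"
    and \<mu>Y :: "'y measure" and N :: "('y fclass, 'n) normed_mod" +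
  fixes \<phi> :: "'y \<Rightarrow> 'x" and \<Phi> :: "'m \<Rightarrow> 'n"
  assumes pullback: "is_pullback p \<mu>X \<mu>Y \<phi> M N \<Phi>"
begin

lemma \<Phi>_closed: "v \<in> carrier M \<Longrightarrow> \<Phi> v \<in> carrier N"
  and \<Phi>_add: "v \<in> carrier M \<Longrightarrow> w \<in> carrier M \<Longrightarrow> \<Phi> (v \<oplus>\<^bsub>M\<^esub> w) = \<Phi> v \<oplus>\<^bsub>N\<^esub> \<Phi> w"
  and \<Phi>_scale: "v \<in> carrier M \<Longrightarrow> \<Phi> (rscale \<mu>X M c v) = rscale \<mu>Y N c (\<Phi> v)"
  and \<Phi>_norm: "v \<in> carrier M \<Longrightarrow> pnorm N (\<Phi> v) = comp_cls \<mu>Y \<phi> (pnorm M v)"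
  and \<Phi>_generates: "generates \<mu>Y N (\<Phi> ` carrier M)"
  using pullback by (auto simp: is_pullback_def real_linear_map_def additive_map_def)

sublocale X: local_maps \<mu>X M \<mu>Y \<phi> p q
  by (rule local_maps.intro[OF M.module_axioms local_maps_axioms.intro[OF R.cring_axioms sf pq]])
    (metis \<Phi>_norm \<Phi>_closed pnorm_in)

lemma \<Phi>_zero: "\<Phi> \<zero>\<^bsub>M\<^esub> = \<zero>\<^bsub>N\<^esub>"
  using \<Phi>_add[of "\<zero>\<^bsub>M\<^esub>" "\<zero>\<^bsub>M\<^esub>"] \<Phi>_closed[of "\<zero>\<^bsub>M\<^esub>"] by simp

lemma p_pos: "p > 0" using pq by simp

lemma X_boundD: "X.bound T g \<Longrightarrow> v \<in> carrier M \<Longrightarrow> AE y in \<mu>Y. \<bar>rep (T v) y\<bar> \<le> g y * pn (\<Phi> v) y"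
  using X.boundD(4) by (simp add: \<Phi>_norm)

text \<open>The pairs \<open>(\<Sum> f\<^sub>i \<Phi> v\<^sub>i, \<Sum> f\<^sub>i T v\<^sub>i)\<close>, built one summand at a time so that estimates can be
proved by induction. A relation is used because the value of the extension at an element of the span
is not yet known to be independent of its representation. The second component is a function,
and the rules allow it to be changed on null sets.\<close>

inductive_set span_graph :: "('m \<Rightarrow> 'y fclass) \<Rightarrow> ('n \<times> ('y \<Rightarrow> real)) set" for T where
  zero: "h \<in> borel_measurable \<mu>Y \<Longrightarrow> AE y in \<mu>Y. h y = 0 \<Longrightarrow> (\<zero>\<^bsub>N\<^esub>, h) \<in> span_graph T"
| step: "(u, h) \<in> span_graph T \<Longrightarrow> f \<in> carrier (Linf \<mu>Y) \<Longrightarrow> v \<in> carrier M \<Longrightarrow> h' \<in> borel_measurable \<mu>Y \<Longrightarrow>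
    AE y in \<mu>Y. h' y = h y + rep f y * rep (T v) y \<Longrightarrow> (u \<oplus>\<^bsub>N\<^esub> f \<odot>\<^bsub>N\<^esub> \<Phi> v, h') \<in> span_graph T"

lemma span_graph_carrier: "(u, h) \<in> span_graph T \<Longrightarrow> u \<in> carrier N \<and> h \<in> borel_measurable \<mu>Y"
  by (induction rule: span_graph.induct) (auto simp: \<Phi>_closed)

lemma span_graph_cong:
  assumes "(u, h) \<in> span_graph T" "h' \<in> borel_measurable \<mu>Y" "AE y in \<mu>Y. h' y = h y"
  shows "(u, h') \<in> span_graph T"
  using assms(1)
proof cases
  case zero
  have "AE y in \<mu>Y. h' y = 0" using assms(3) zero(3) by eventually_elim simp
  then show ?thesis unfolding zero(1) using assms(2) by (intro span_graph.zero)
next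
  case (step u0 h0 f v)
  have "AE y in \<mu>Y. h' y = h0 y + rep f y * rep (T v) y" using assms(3) step(6) by eventually_elim simp
  then show ?thesis unfolding step(1) using step assms(2) by (intro span_graph.step)
qed

lemma span_graph_add:
  assumes "(u', h') \<in> span_graph T" "(u, h) \<in> span_graph T"
  shows "(u \<oplus>\<^bsub>N\<^esub> u', \<lambda>y. h y + h' y) \<in> span_graph T"
  using assms(1)
proof (induction rule: span_graph.induct)
  case (zero h')
  note c = span_graph_carrier[OF assms(2)]
  have "AE y in \<mu>Y. h y + h' y = h y" using zero(2) by eventually_elim simp
  moreover have "(\<lambda>y. h y + h' y) \<in> borel_measurable \<mu>Y" using c zero by (intro borel_measurable_add) auto
  ultimately show ?case using span_graph_cong[OF assms(2)] c by simp
next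
  case (step u' h' f v h'')
  have c: "u \<in> carrier N" "u' \<in> carrier N" "h \<in> borel_measurable \<mu>Y"
    using span_graph_carrier[OF assms(2)] span_graph_carrier[OF step(1)] by auto
  have "(u \<oplus>\<^bsub>N\<^esub> u' \<oplus>\<^bsub>N\<^esub> f \<odot>\<^bsub>N\<^esub> \<Phi> v, \<lambda>y. h y + h'' y) \<in> span_graph T"
  proof (rule span_graph.step[OF step(6) step(2,3)])
    show "AE y in \<mu>Y. h y + h'' y = h y + h' y + rep f y * rep (T v) y"
      using step(5) by eventually_elim simp
  qed (use c step(4) in simp)
  moreover have "u \<oplus>\<^bsub>N\<^esub> u' \<oplus>\<^bsub>N\<^esub> f \<odot>\<^bsub>N\<^esub> \<Phi> v = u \<oplus>\<^bsub>N\<^esub> (u' \<oplus>\<^bsub>N\<^esub> f \<odot>\<^bsub>N\<^esub> \<Phi> v)"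
    using c step(2,3) \<Phi>_closed by (intro M.a_assoc) auto
  ultimately show ?case by simp
qed

lemma span_graph_smult:
  assumes k: "k \<in> carrier (Linf \<mu>Y)" and "(u, h) \<in> span_graph T"
  shows "(k \<odot>\<^bsub>N\<^esub> u, \<lambda>y. rep k y * h y) \<in> span_graph T"
  using assms(2)
proof (induction rule: span_graph.induct)
  case (zero h)
  have "AE y in \<mu>Y. rep k y * h y = 0" using zero(2) by eventually_elim simp
  moreover have "(\<lambda>y. rep k y * h y) \<in> borel_measurable \<mu>Y" using zero(1) rep_meas[OF Linf_L0[OF k]] by simp
  ultimately show ?case using span_graph.zero smult_r_null[OF k] by simp
next
  case (step u h f v h')
  have c: "u \<in> carrier N" "\<Phi> v \<in> carrier N"
    using span_graph_carrier[OF step(1)] \<Phi>_closed step(3) by auto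
  have kf: "mult_cls \<mu>Y k f \<in> carrier (Linf \<mu>Y)" using R.m_closed[OF k step(2)] by simp
  have "(k \<odot>\<^bsub>N\<^esub> u \<oplus>\<^bsub>N\<^esub> mult_cls \<mu>Y k f \<odot>\<^bsub>N\<^esub> \<Phi> v, \<lambda>y. rep k y * h' y) \<in> span_graph T"
  proof (rule span_graph.step[OF step(6) kf step(3)])
    show "AE y in \<mu>Y. rep k y * h' y = rep k y * h y + rep (mult_cls \<mu>Y k f) y * rep (T v) y"
      using step(5) AE_mult_cls[OF Linf_L0[OF k] Linf_L0[OF step(2)]]
      by eventually_elim (simp add: distrib_left)
  qed (use rep_meas[OF Linf_L0[OF k]] step(4) in simp)
  moreover have "k \<odot>\<^bsub>N\<^esub> (u \<oplus>\<^bsub>N\<^esub> f \<odot>\<^bsub>N\<^esub> \<Phi> v) = k \<odot>\<^bsub>N\<^esub> u \<oplus>\<^bsub>N\<^esub> mult_cls \<mu>Y k f \<odot>\<^bsub>N\<^esub> \<Phi> v"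
    using smult_r_distr[OF k c(1) smult_closed[OF step(2) c(2)]] smult_assoc1[OF k step(2) c(2)] by simp
  ultimately show ?case by simp
qed

lemma span_graph_gen:
  assumes T: "T \<in> carrier X.H" and v: "v \<in> carrier M"
  shows "(\<Phi> v, rep (T v)) \<in> span_graph T"
proof -
  have "(\<zero>\<^bsub>N\<^esub> \<oplus>\<^bsub>N\<^esub> const_cls \<mu>Y 1 \<odot>\<^bsub>N\<^esub> \<Phi> v, rep (T v)) \<in> span_graph T"
  proof (rule span_graph.step[OF span_graph.zero[of "\<lambda>y. 0"] const_Linf v X.H_D(4)[OF T v]])
    show "AE y in \<mu>Y. rep (T v) y = 0 + rep (const_cls \<mu>Y 1) y * rep (T v) y"
      using AE_const_cls[of \<mu>Y 1] by eventually_elim simp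
  qed auto
  then show ?thesis using smult_one[OF \<Phi>_closed[OF v]] \<Phi>_closed[OF v] by simp
qed

text \<open>The free summand \<open>\<Phi> v\<close> makes the induction work: if the new coefficient \<open>f\<close> of \<open>\<Phi> w\<close> is
replaced by a constant \<open>r\<close>, then \<open>r w\<close> is absorbed into \<open>v\<close> and the induction hypothesis
applies. The error of this replacement is at most \<open>g \<bar>f - r\<bar> \<bar>\<Phi> w\<bar>\<close>, and at almost every point the
rational \<open>r\<close> may tend to the value of \<open>f\<close>.\<close>

lemma span_graph_bound_shifted:
  assumes T: "T \<in> carrier X.H" and g: "X.bound T g" and "(u, h) \<in> span_graph T" and "v \<in> carrier M"
  shows "AE y in \<mu>Y. \<bar>h y + rep (T v) y\<bar> \<le> g y * pn (u \<oplus>\<^bsub>N\<^esub> \<Phi> v) y"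
  using assms(3,4)
proof (induction arbitrary: v rule: span_graph.induct)
  case (zero h)
  show ?case
    unfolding M.l_zero[OF \<Phi>_closed[OF zero(3)]]
    using X_boundD[OF g zero(3)] zero(2) by eventually_elim simp
next
  case (step u h f w h')
  note f = step(2) and w = step(3) and v = step(7)
  have c: "u \<in> carrier N" "\<Phi> w \<in> carrier N" "\<Phi> v \<in> carrier N"
    using span_graph_carrier[OF step(1)] \<Phi>_closed v w by auto
  define s where "s = u \<oplus>\<^bsub>N\<^esub> f \<odot>\<^bsub>N\<^esub> \<Phi> w \<oplus>\<^bsub>N\<^esub> \<Phi> v"
  have s: "s \<in> carrier N" using c f by (simp add: s_def)
  have "AE y in \<mu>Y. \<bar>(h y + rep (T v) y) + r * rep (T w) y\<bar> \<le> g y * pn s y + \<bar>rep f y - r\<bar> * (g y * pn (\<Phi> w) y)" for r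
  proof -
    have rw: "rscale \<mu>X M r w \<in> carrier M" by (rule X.rscale_closed[OF w])
    \<comment> \<open>\<open>z = r - f\<close>, so that adding \<open>z \<Phi> w\<close> turns the coefficient \<open>f\<close> into \<open>r\<close>.\<close>
    define z where "z = add_cls \<mu>Y (mult_cls \<mu>Y (const_cls \<mu>Y (- 1)) f) (const_cls \<mu>Y r)"
    have mf: "mult_cls \<mu>Y (const_cls \<mu>Y (- 1)) f \<in> carrier (Linf \<mu>Y)"
      using R.m_closed[OF const_Linf[of \<mu>Y "-1"] f] by simp
    have z: "z \<in> carrier (Linf \<mu>Y)" using R.a_closed[OF mf const_Linf[of \<mu>Y r]] by (simp add: z_def)
    have rz: "AE y in \<mu>Y. rep z y = r - rep f y"
      using AE_add_cls[OF Linf_L0[OF mf] const_cls_L0[of \<mu>Y r], folded z_def] AE_const_cls[of \<mu>Y r]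
        AE_mult_cls[OF const_cls_L0[of \<mu>Y "-1"] Linf_L0[OF f]] AE_const_cls[of \<mu>Y "-1"]
      by eventually_elim simp
    have zw: "z \<odot>\<^bsub>N\<^esub> \<Phi> w = \<ominus>\<^bsub>N\<^esub> (f \<odot>\<^bsub>N\<^esub> \<Phi> w) \<oplus>\<^bsub>N\<^esub> rscale \<mu>Y N r (\<Phi> w)"
      unfolding z_def rscale_def
      using smult_l_distr[OF mf const_Linf c(2), of r] smult_assoc1[OF const_Linf[of \<mu>Y "-1"] f c(2)]
        minus_eq_smult[OF smult_closed[OF f c(2)]] by simp
    have fw: "f \<odot>\<^bsub>N\<^esub> \<Phi> w \<in> carrier N" using f c by simp
    have rc: "rscale \<mu>Y N r (\<Phi> w) \<in> carrier N" using c by (simp add: rscale_def const_Linf)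
    have eq: "u \<oplus>\<^bsub>N\<^esub> \<Phi> (rscale \<mu>X M r w \<oplus>\<^bsub>M\<^esub> v) = s \<oplus>\<^bsub>N\<^esub> z \<odot>\<^bsub>N\<^esub> \<Phi> w"
    proof -
      have "s \<oplus>\<^bsub>N\<^esub> z \<odot>\<^bsub>N\<^esub> \<Phi> w = (u \<oplus>\<^bsub>N\<^esub> (rscale \<mu>Y N r (\<Phi> w) \<oplus>\<^bsub>N\<^esub> \<Phi> v)) \<oplus>\<^bsub>N\<^esub> (f \<odot>\<^bsub>N\<^esub> \<Phi> w \<oplus>\<^bsub>N\<^esub> \<ominus>\<^bsub>N\<^esub> (f \<odot>\<^bsub>N\<^esub> \<Phi> w))"
        unfolding zw s_def using c fw rc by (simp add: M.a_ac del: M.r_neg)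
      then show ?thesis using c fw rc by (simp add: M.r_neg \<Phi>_add[OF rw v] \<Phi>_scale[OF w])
    qed
    show ?thesis
      using step(6)[OF M.M.a_closed[OF rw v]] X.H_D(5)[OF T rw v] X.H_D(6)[OF T w, where c=r]
        pn_triangle[OF s smult_closed[OF z c(2)] p_pos] pn_smult[OF z c(2)] rz X.boundD(3)[OF g]
      unfolding eq
    proof eventually_elim
      case (elim y)
      have "\<bar>(h y + rep (T v) y) + r * rep (T w) y\<bar> \<le> g y * pn (s \<oplus>\<^bsub>N\<^esub> z \<odot>\<^bsub>N\<^esub> \<Phi> w) y"
        using elim(1,2,3) by (simp add: algebra_simps)
      also have "\<dots> \<le> g y * (pn s y + \<bar>rep f y - r\<bar> * pn (\<Phi> w) y)"
        using elim(4-7) by (intro mult_left_mono) (auto simp: abs_minus_commute)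
      finally show ?case by (simp add: algebra_simps)
    qed
  qed
  then have "AE y in \<mu>Y. \<forall>r\<in>\<rat>. \<bar>(h y + rep (T v) y) + r * rep (T w) y\<bar> \<le> g y * pn s y + \<bar>rep f y - r\<bar> * (g y * pn (\<Phi> w) y)"
    by (intro AE_all_rats)
  then show ?case using step(5) unfolding s_def[symmetric]
  proof eventually_elim
    case (elim y)
    have "\<bar>(h y + rep (T v) y) + rep f y * rep (T w) y\<bar> \<le> g y * pn s y"
      by (rule le_rat_approx) (use elim(1) in blast)
    then show ?case using elim(2) by (simp add: algebra_simps)
  qed
qed

lemma span_graph_bound:
  assumes T: "T \<in> carrier X.H" and g: "X.bound T g" and uh: "(u, h) \<in> span_graph T"
  shows "AE y in \<mu>Y. \<bar>h y\<bar> \<le> g y * pn u y"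
proof -
  have "AE y in \<mu>Y. rep (T \<zero>\<^bsub>M\<^esub>) y = 0"
    using X.H_D(5)[OF T M.M.zero_closed M.M.zero_closed] by simp
  moreover have "AE y in \<mu>Y. \<bar>h y + rep (T \<zero>\<^bsub>M\<^esub>) y\<bar> \<le> g y * pn u y"
    using span_graph_bound_shifted[OF T g uh M.M.zero_closed] span_graph_carrier[OF uh] by (simp add: \<Phi>_zero)
  ultimately show ?thesis by eventually_elim simp
qed

lemma span_graph_dense:
  assumes T: "T \<in> carrier X.H" and w: "w \<in> carrier N"
  obtains u h where "\<And>n. (u n, h n) \<in> span_graph T" "\<And>n. u n \<in> carrier N"
    "AE y in \<mu>Y. (\<lambda>n. pn (w \<ominus>\<^bsub>N\<^esub> u n) y) \<longlonglongrightarrow> 0"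
proof -
  have dom: "\<exists>h. (finsum N (\<lambda>s. a s \<odot>\<^bsub>N\<^esub> s) A, h) \<in> span_graph T"
    if "finite A" "A \<subseteq> \<Phi> ` carrier M" "a \<in> A \<rightarrow> carrier (Linf \<mu>Y)" for A a
    using that
  proof (induction rule: finite_induct)
    case empty
    have "(\<zero>\<^bsub>N\<^esub>, \<lambda>y. 0) \<in> span_graph T" by (rule span_graph.zero) auto
    then show ?case by auto
  next
    case (insert s A)
    then obtain h where h: "(finsum N (\<lambda>s. a s \<odot>\<^bsub>N\<^esub> s) A, h) \<in> span_graph T" by auto
    obtain v where v: "s = \<Phi> v" "v \<in> carrier M" using insert.prems by auto
    have as: "a s \<in> carrier (Linf \<mu>Y)" using insert.prems by auto
    have cl: "(\<lambda>s. a s \<odot>\<^bsub>N\<^esub> s) \<in> A \<rightarrow> carrier N"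
      using insert.prems \<Phi>_closed by (auto intro!: smult_closed)
    have sc: "a s \<odot>\<^bsub>N\<^esub> s \<in> carrier N" using as v \<Phi>_closed by simp
    have eq: "finsum N (\<lambda>s. a s \<odot>\<^bsub>N\<^esub> s) (insert s A) = finsum N (\<lambda>s. a s \<odot>\<^bsub>N\<^esub> s) A \<oplus>\<^bsub>N\<^esub> a s \<odot>\<^bsub>N\<^esub> \<Phi> v"
      using M.finsum_insert[OF insert.hyps cl sc] M.a_comm[OF sc M.finsum_closed[OF cl]] by (simp add: v(1))
    have hm: "h \<in> borel_measurable \<mu>Y" using span_graph_carrier[OF h] by blast
    have "(finsum N (\<lambda>s. a s \<odot>\<^bsub>N\<^esub> s) A \<oplus>\<^bsub>N\<^esub> a s \<odot>\<^bsub>N\<^esub> \<Phi> v, \<lambda>y. h y + rep (a s) y * rep (T v) y) \<in> span_graph T"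
      by (rule span_graph.step[OF h as v(2)]) (use hm rep_meas[OF Linf_L0[OF as]] X.H_D(4)[OF T v(2)] in auto)
    then show ?case unfolding eq by blast
  qed
  have "\<exists>u h. (u, h) \<in> span_graph T \<and> nrm N (w \<ominus>\<^bsub>N\<^esub> u) \<le> (1 / 4) ^ n" for n :: nat
  proof -
    have "(1 / 4 :: real) ^ n > 0" by simp
    then obtain A a where A: "finite A" "A \<subseteq> \<Phi> ` carrier M" "a \<in> A \<rightarrow> carrier (Linf \<mu>Y)"
      "nrm N (w \<ominus>\<^bsub>N\<^esub> finsum N (\<lambda>s. a s \<odot>\<^bsub>N\<^esub> s) A) < (1 / 4) ^ n"
      using \<Phi>_generates w unfolding generates_def by blast
    then show ?thesis using dom[OF A(1-3)] less_imp_le by blast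
  qed
  then obtain u h where uh: "\<And>n. (u n, h n) \<in> span_graph T" "\<And>n. nrm N (w \<ominus>\<^bsub>N\<^esub> u n) \<le> (1 / 4) ^ n"
    by metis
  have c: "u n \<in> carrier N" for n using span_graph_carrier[OF uh(1)] by blast
  have "AE y in \<mu>Y. (\<lambda>n. pn (w \<ominus>\<^bsub>N\<^esub> u n) y) \<longlonglongrightarrow> 0"
    by (rule AE_pn_tendsto_0[OF M.minus_closed[OF w c] uh(2)]) (use pq in simp)
  then show thesis by (rule that[OF uh(1) c])
qed

text \<open>The graph of the extension. Closing under almost everywhere limits, rather than in \<open>L\<^sup>1\<close>, reduces
all limit arguments to real sequences.\<close>

definition closure_graph :: "('m \<Rightarrow> 'y fclass) \<Rightarrow> ('n \<times> ('y \<Rightarrow> real)) set" where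
  "closure_graph T = {(w, k). w \<in> carrier N \<and> k \<in> borel_measurable \<mu>Y \<and> (\<exists>u h. (\<forall>n. (u n, h n) \<in> span_graph T) \<and>
     (AE y in \<mu>Y. (\<lambda>n. pn (w \<ominus>\<^bsub>N\<^esub> u n) y) \<longlonglongrightarrow> 0) \<and> (AE y in \<mu>Y. (\<lambda>n. h n y) \<longlonglongrightarrow> k y))}"

lemma closure_graphE:
  assumes "(w, k) \<in> closure_graph T"
  obtains u h where "w \<in> carrier N" "k \<in> borel_measurable \<mu>Y" "\<forall>n. (u n, h n) \<in> span_graph T"
    "\<forall>n. u n \<in> carrier N" "AE y in \<mu>Y. (\<lambda>n. pn (w \<ominus>\<^bsub>N\<^esub> u n) y) \<longlonglongrightarrow> 0"
    "AE y in \<mu>Y. (\<lambda>n. h n y) \<longlonglongrightarrow> k y"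
proof -
  obtain u h where *: "w \<in> carrier N" "k \<in> borel_measurable \<mu>Y" "\<forall>n. (u n, h n) \<in> span_graph T"
    "AE y in \<mu>Y. (\<lambda>n. pn (w \<ominus>\<^bsub>N\<^esub> u n) y) \<longlonglongrightarrow> 0" "AE y in \<mu>Y. (\<lambda>n. h n y) \<longlonglongrightarrow> k y"
    using assms unfolding closure_graph_def by auto
  have "\<forall>n. u n \<in> carrier N" using span_graph_carrier *(3) by blast
  then show thesis by (rule that[OF *(1-3) _ *(4,5)])
qed

lemma closure_graphI:
  assumes "w \<in> carrier N" "k \<in> borel_measurable \<mu>Y" "\<And>n. (u n, h n) \<in> span_graph T"
    "AE y in \<mu>Y. (\<lambda>n. pn (w \<ominus>\<^bsub>N\<^esub> u n) y) \<longlonglongrightarrow> 0" "AE y in \<mu>Y. (\<lambda>n. h n y) \<longlonglongrightarrow> k y"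
  shows "(w, k) \<in> closure_graph T"
  using assms unfolding closure_graph_def by blast

lemma span_graph_subset_closure_graph:
  assumes "(w, k) \<in> span_graph T" shows "(w, k) \<in> closure_graph T"
proof -
  have c: "w \<in> carrier N" "k \<in> borel_measurable \<mu>Y" using span_graph_carrier[OF assms] by auto
  have "AE y in \<mu>Y. (\<lambda>n::nat. pn (w \<ominus>\<^bsub>N\<^esub> w) y) \<longlonglongrightarrow> 0"
    using pn_zero unfolding a_minus_def M.r_neg[OF c(1)] by eventually_elim simp
  then show ?thesis by (rule closure_graphI[OF c assms]) simp
qed

lemma closure_graph_add:
  assumes "(w, k) \<in> closure_graph T" "(w', k') \<in> closure_graph T"
  shows "(w \<oplus>\<^bsub>N\<^esub> w', \<lambda>y. k y + k' y) \<in> closure_graph T"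
proof -
  obtain u h where 1: "w \<in> carrier N" "k \<in> borel_measurable \<mu>Y" "\<forall>n. (u n, h n) \<in> span_graph T"
    "\<forall>n. u n \<in> carrier N" "AE y in \<mu>Y. (\<lambda>n. pn (w \<ominus>\<^bsub>N\<^esub> u n) y) \<longlonglongrightarrow> 0"
    "AE y in \<mu>Y. (\<lambda>n. h n y) \<longlonglongrightarrow> k y"
    using assms(1) by (rule closure_graphE)
  note 1 = 1(1,2) 1(3,4)[rule_format] 1(5,6)
  obtain u' h' where 2: "w' \<in> carrier N" "k' \<in> borel_measurable \<mu>Y" "\<forall>n. (u' n, h' n) \<in> span_graph T"
    "\<forall>n. u' n \<in> carrier N" "AE y in \<mu>Y. (\<lambda>n. pn (w' \<ominus>\<^bsub>N\<^esub> u' n) y) \<longlonglongrightarrow> 0"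
    "AE y in \<mu>Y. (\<lambda>n. h' n y) \<longlonglongrightarrow> k' y"
    using assms(2) by (rule closure_graphE)
  note 2 = 2(1,2) 2(3,4)[rule_format] 2(5,6)
  have d: "w \<ominus>\<^bsub>N\<^esub> u n \<in> carrier N" "w' \<ominus>\<^bsub>N\<^esub> u' n \<in> carrier N" for n using 1 2 by auto
  have eq: "(w \<oplus>\<^bsub>N\<^esub> w') \<ominus>\<^bsub>N\<^esub> (u n \<oplus>\<^bsub>N\<^esub> u' n) = (w \<ominus>\<^bsub>N\<^esub> u n) \<oplus>\<^bsub>N\<^esub> (w' \<ominus>\<^bsub>N\<^esub> u' n)" for n
    using 1 2 by (simp add: a_minus_def M.minus_add M.a_ac)
  have "AE y in \<mu>Y. \<forall>n. pn ((w \<ominus>\<^bsub>N\<^esub> u n) \<oplus>\<^bsub>N\<^esub> (w' \<ominus>\<^bsub>N\<^esub> u' n)) y \<le> pn (w \<ominus>\<^bsub>N\<^esub> u n) y + pn (w' \<ominus>\<^bsub>N\<^esub> u' n) y"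
    unfolding AE_all_countable using pn_triangle[OF d p_pos] by blast
  moreover have "AE y in \<mu>Y. \<forall>n. 0 \<le> pn ((w \<ominus>\<^bsub>N\<^esub> u n) \<oplus>\<^bsub>N\<^esub> (w' \<ominus>\<^bsub>N\<^esub> u' n)) y"
    unfolding AE_all_countable using pn_nonneg[OF M.a_closed[OF d]] by blast
  ultimately have "AE y in \<mu>Y. (\<lambda>n. pn ((w \<oplus>\<^bsub>N\<^esub> w') \<ominus>\<^bsub>N\<^esub> (u n \<oplus>\<^bsub>N\<^esub> u' n)) y) \<longlonglongrightarrow> 0"
    unfolding eq using 1(5) 2(5)
  proof eventually_elim
    case (elim y)
    have "(\<lambda>n. pn (w \<ominus>\<^bsub>N\<^esub> u n) y + pn (w' \<ominus>\<^bsub>N\<^esub> u' n) y) \<longlonglongrightarrow> 0"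
      using tendsto_add[OF elim(3,4)] by simp
    with _ _ tendsto_const show ?case
      by (rule tendsto_sandwich) (use elim(1,2) in simp_all)
  qed
  moreover have "AE y in \<mu>Y. (\<lambda>n. h n y + h' n y) \<longlonglongrightarrow> k y + k' y"
    using 1(6) 2(6) by eventually_elim (rule tendsto_add)
  ultimately show ?thesis
    using 1(1,2) 2(1,2) by (intro closure_graphI[OF _ _ span_graph_add[OF 2(3) 1(3)]]) auto
qed

lemma closure_graph_smult:
  assumes f: "f \<in> carrier (Linf \<mu>Y)" and "(w, k) \<in> closure_graph T"
  shows "(f \<odot>\<^bsub>N\<^esub> w, \<lambda>y. rep f y * k y) \<in> closure_graph T"
proof -
  obtain u h where 1: "w \<in> carrier N" "k \<in> borel_measurable \<mu>Y" "\<forall>n. (u n, h n) \<in> span_graph T"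
    "\<forall>n. u n \<in> carrier N" "AE y in \<mu>Y. (\<lambda>n. pn (w \<ominus>\<^bsub>N\<^esub> u n) y) \<longlonglongrightarrow> 0"
    "AE y in \<mu>Y. (\<lambda>n. h n y) \<longlonglongrightarrow> k y"
    using assms(2) by (rule closure_graphE)
  note 1 = 1(1,2) 1(3,4)[rule_format] 1(5,6)
  have d: "w \<ominus>\<^bsub>N\<^esub> u n \<in> carrier N" for n using 1 by auto
  have eq: "f \<odot>\<^bsub>N\<^esub> w \<ominus>\<^bsub>N\<^esub> f \<odot>\<^bsub>N\<^esub> u n = f \<odot>\<^bsub>N\<^esub> (w \<ominus>\<^bsub>N\<^esub> u n)" for n
    unfolding a_minus_def using smult_r_distr[OF f 1(1) M.a_inv_closed[OF 1(4)]] smult_r_minus[OF f 1(4)] by simp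
  have "AE y in \<mu>Y. \<forall>n. pn (f \<odot>\<^bsub>N\<^esub> (w \<ominus>\<^bsub>N\<^esub> u n)) y = \<bar>rep f y\<bar> * pn (w \<ominus>\<^bsub>N\<^esub> u n) y"
    unfolding AE_all_countable using pn_smult[OF f d] by blast
  then have "AE y in \<mu>Y. (\<lambda>n. pn (f \<odot>\<^bsub>N\<^esub> w \<ominus>\<^bsub>N\<^esub> f \<odot>\<^bsub>N\<^esub> u n) y) \<longlonglongrightarrow> 0"
    unfolding eq using 1(5)
  proof eventually_elim
    case (elim y)
    then show ?case using tendsto_mult[OF tendsto_const[of "\<bar>rep f y\<bar>"] elim(2)] by simp
  qed
  moreover have "AE y in \<mu>Y. (\<lambda>n. rep f y * h n y) \<longlonglongrightarrow> rep f y * k y"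
    using 1(6) by eventually_elim (intro tendsto_mult tendsto_const)
  ultimately show ?thesis
    using 1(1,2) f rep_meas[OF Linf_L0[OF f]] by (intro closure_graphI[OF _ _ span_graph_smult[OF f 1(3)]]) auto
qed

lemma closure_graph_bound:
  assumes T: "T \<in> carrier X.H" and g: "X.bound T g" and wk: "(w, k) \<in> closure_graph T"
  shows "AE y in \<mu>Y. \<bar>k y\<bar> \<le> g y * pn w y"
proof -
  obtain u h where 1: "w \<in> carrier N" "k \<in> borel_measurable \<mu>Y" "\<forall>n. (u n, h n) \<in> span_graph T"
    "\<forall>n. u n \<in> carrier N" "AE y in \<mu>Y. (\<lambda>n. pn (w \<ominus>\<^bsub>N\<^esub> u n) y) \<longlonglongrightarrow> 0"
    "AE y in \<mu>Y. (\<lambda>n. h n y) \<longlonglongrightarrow> k y"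
    using wk by (rule closure_graphE)
  note 1 = 1(1,2) 1(3,4)[rule_format] 1(5,6)
  have z: "v \<ominus>\<^bsub>N\<^esub> \<zero>\<^bsub>N\<^esub> = v" if "v \<in> carrier N" for v using that by (simp add: a_minus_def)
  have "AE y in \<mu>Y. \<forall>n. pn (u n) y \<le> pn (w \<ominus>\<^bsub>N\<^esub> u n) y + pn w y"
    unfolding AE_all_countable using pn_minus_triangle[OF 1(4) M.zero_closed 1(1) p_pos] by (simp add: z 1)
  moreover have "AE y in \<mu>Y. \<forall>n. \<bar>h n y\<bar> \<le> g y * pn (u n) y"
    unfolding AE_all_countable using span_graph_bound[OF T g 1(3)] by blast
  ultimately show ?thesis using 1(5,6) X.boundD(3)[OF g]
  proof eventually_elim
    case (elim y)
    have "(\<lambda>n. g y * (pn (w \<ominus>\<^bsub>N\<^esub> u n) y + pn w y)) \<longlonglongrightarrow> g y * (0 + pn w y)"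
      using elim(3) by (intro tendsto_mult tendsto_add tendsto_const)
    moreover have "(\<lambda>n. \<bar>h n y\<bar>) \<longlonglongrightarrow> \<bar>k y\<bar>" using elim(4) by (rule tendsto_rabs)
    moreover have "\<bar>h n y\<bar> \<le> g y * (pn (w \<ominus>\<^bsub>N\<^esub> u n) y + pn w y)" for n
    proof -
      have "\<bar>h n y\<bar> \<le> g y * pn (u n) y" using elim(2) by blast
      also have "\<dots> \<le> g y * (pn (w \<ominus>\<^bsub>N\<^esub> u n) y + pn w y)"
        using elim(1,5) by (intro mult_left_mono) auto
      finally show ?thesis .
    qed
    ultimately have "\<bar>k y\<bar> \<le> g y * (0 + pn w y)" by (intro LIMSEQ_le[of "\<lambda>n. \<bar>h n y\<bar>"]) auto
    then show ?case by simp
  qed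
qed

lemma closure_graph_unique:
  assumes T: "T \<in> carrier X.H" and k: "(w, k) \<in> closure_graph T" and k': "(w, k') \<in> closure_graph T"
  shows "AE y in \<mu>Y. k y = k' y"
proof -
  obtain g where g: "X.bound T g" using X.H_D(7)[OF T] by blast
  have w: "w \<in> carrier N" using k by (rule closure_graphE)
  have "(w \<oplus>\<^bsub>N\<^esub> const_cls \<mu>Y (- 1) \<odot>\<^bsub>N\<^esub> w, \<lambda>y. k y + rep (const_cls \<mu>Y (- 1)) y * k' y) \<in> closure_graph T"
    by (rule closure_graph_add[OF k closure_graph_smult[OF const_Linf k']])
  then have "(\<zero>\<^bsub>N\<^esub>, \<lambda>y. k y + rep (const_cls \<mu>Y (- 1)) y * k' y) \<in> closure_graph T"
    using minus_eq_smult[OF w, symmetric] M.r_neg[OF w] by simp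
  from closure_graph_bound[OF T g this] pn_zero AE_const_cls[of \<mu>Y "-1"] show ?thesis
    by eventually_elim simp
qed

lemma closure_graph_total:
  assumes T: "T \<in> carrier X.H" and w: "w \<in> carrier N"
  shows "\<exists>k. (w, k) \<in> closure_graph T"
proof -
  obtain g where g: "X.bound T g" using X.H_D(7)[OF T] by blast
  obtain u h where u: "\<And>n. (u n, h n) \<in> span_graph T" "\<And>n. u n \<in> carrier N"
    "AE y in \<mu>Y. (\<lambda>n. pn (w \<ominus>\<^bsub>N\<^esub> u n) y) \<longlonglongrightarrow> 0"
    using span_graph_dense[OF T w] by blast
  have hm: "h n \<in> borel_measurable \<mu>Y" for n using span_graph_carrier[OF u(1)] by blast
  define k where "k y = lim (\<lambda>n. h n y)" for y
  have km: "k \<in> borel_measurable \<mu>Y" unfolding k_def using hm by measurable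
  have "AE y in \<mu>Y. \<bar>h n y - h m y\<bar> \<le> g y * (pn (w \<ominus>\<^bsub>N\<^esub> u n) y + pn (w \<ominus>\<^bsub>N\<^esub> u m) y)" for n m
  proof -
    have "(u n \<oplus>\<^bsub>N\<^esub> const_cls \<mu>Y (- 1) \<odot>\<^bsub>N\<^esub> u m, \<lambda>y. h n y + rep (const_cls \<mu>Y (- 1)) y * h m y) \<in> span_graph T"
      by (rule span_graph_add[OF span_graph_smult[OF const_Linf u(1)] u(1)])
    then have "(u n \<ominus>\<^bsub>N\<^esub> u m, \<lambda>y. h n y + rep (const_cls \<mu>Y (- 1)) y * h m y) \<in> span_graph T"
      using minus_eq_smult[OF u(2), symmetric] by (simp add: a_minus_def)
    from span_graph_bound[OF T g this] pn_minus_triangle[OF u(2)[of n] u(2)[of m] w p_pos]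
      AE_const_cls[of \<mu>Y "-1"] X.boundD(3)[OF g]
    show ?thesis
    proof eventually_elim
      case (elim y)
      have "g y * pn (u n \<ominus>\<^bsub>N\<^esub> u m) y \<le> g y * (pn (w \<ominus>\<^bsub>N\<^esub> u n) y + pn (w \<ominus>\<^bsub>N\<^esub> u m) y)"
        using elim(2,4) by (rule mult_left_mono)
      then show ?case using elim(1,3) by simp
    qed
  qed
  then have "AE y in \<mu>Y. \<forall>n m. \<bar>h n y - h m y\<bar> \<le> g y * (pn (w \<ominus>\<^bsub>N\<^esub> u n) y + pn (w \<ominus>\<^bsub>N\<^esub> u m) y)"
    unfolding AE_all_countable by blast
  then have "AE y in \<mu>Y. (\<lambda>n. h n y) \<longlonglongrightarrow> k y"
    using u(3)
  proof eventually_elim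
    case (elim y)
    define d where "d n = g y * pn (w \<ominus>\<^bsub>N\<^esub> u n) y" for n
    have d: "d \<longlonglongrightarrow> 0" unfolding d_def using tendsto_mult[OF tendsto_const[of "g y"] elim(2)] by simp
    have "Cauchy (\<lambda>n. h n y)"
    proof (rule CauchyI)
      fix e :: real assume "e > 0"
      then obtain N0 where N0: "\<And>n. n \<ge> N0 \<Longrightarrow> d n < e / 2"
        using order_tendstoD(2)[OF d, of "e / 2"] by (auto simp: eventually_sequentially)
      have "norm (h m y - h n y) < e" if "m \<ge> N0" "n \<ge> N0" for m n
      proof -
        have "\<bar>h m y - h n y\<bar> \<le> d m + d n" using elim(1) by (simp add: d_def distrib_left)
        then show ?thesis using N0[OF that(1)] N0[OF that(2)] by simp
      qed
      then show "\<exists>N0. \<forall>m\<ge>N0. \<forall>n\<ge>N0. norm (h m y - h n y) < e" by blast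
    qed
    then show ?case unfolding k_def by (simp add: Cauchy_convergent_iff convergent_LIMSEQ_iff)
  qed
  then show ?thesis using closure_graphI[OF w km u(1,3)] by blast
qed

lemma extension:
  assumes T: "T \<in> carrier X.H" and g: "X.bound T g"
  shows "\<exists>L\<in>carrier D.H. D.bound L g \<and> (\<forall>v\<in>carrier M. L (\<Phi> v) = T v)"
proof -
  define S where "S w = (SOME k. (w, k) \<in> closure_graph T)" for w
  have S: "(w, S w) \<in> closure_graph T" if "w \<in> carrier N" for w
    unfolding S_def using closure_graph_total[OF T that] by (rule someI_ex)
  define L where "L = (\<lambda>w\<in>carrier N. cls \<mu>Y (S w))"
  have "L \<in> carrier D.H \<and> D.bound L g \<and> (\<forall>v\<in>carrier N. AE y in \<mu>Y. rep (L v) y = S v y)"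
    unfolding L_def
  proof (rule D.H_memI)
    fix w assume w: "w \<in> carrier N"
    show "S w \<in> borel_measurable \<mu>Y" using S[OF w] by (rule closure_graphE)
    show "AE y in \<mu>Y. S (w \<oplus>\<^bsub>N\<^esub> w') y = S w y + S w' y" if w': "w' \<in> carrier N" for w'
      by (rule closure_graph_unique[OF T S[OF M.a_closed[OF w w']] closure_graph_add[OF S[OF w] S[OF w']]])
    show "AE y in \<mu>Y. S (rscale \<mu>Y N c w) y = c * S w y" for c
      using closure_graph_unique[OF T S[OF D.rscale_closed[OF w]] closure_graph_smult[OF const_Linf S[OF w], folded rscale_def], of c]
        AE_const_cls[of \<mu>Y c]
      by eventually_elim simp
    show "AE y in \<mu>Y. \<bar>S w y\<bar> \<le> g y * D.P w y"
      using closure_graph_bound[OF T g S[OF w]] by (simp add: comp_id w)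
  qed (use X.boundD(1,3)[OF g] in auto)
  then have L: "L \<in> carrier D.H" "D.bound L g" and rL: "\<And>v. v \<in> carrier N \<Longrightarrow> AE y in \<mu>Y. rep (L v) y = S v y"
    by auto
  have "L (\<Phi> v) = T v" if v: "v \<in> carrier M" for v
  proof (rule L0_eqI[OF D.H_D(3)[OF L(1) \<Phi>_closed[OF v]] X.H_D(3)[OF T v]])
    show "AE y in \<mu>Y. rep (L (\<Phi> v)) y = rep (T v) y"
      using rL[OF \<Phi>_closed[OF v]]
        closure_graph_unique[OF T S[OF \<Phi>_closed[OF v]] span_graph_subset_closure_graph[OF span_graph_gen[OF T v]]]
      by eventually_elim simp
  qed
  then show ?thesis using L by blast
qed

section \<open>The isomorphism\<close>

abbreviation J :: "('n \<Rightarrow> 'y fclass) \<Rightarrow> 'm \<Rightarrow> 'y fclass" where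
  "J \<equiv> \<lambda>L. \<lambda>v\<in>carrier M. L (\<Phi> v)"

lemma J_bound:
  assumes "D.bound L g" shows "X.bound (J L) g"
  using assms \<Phi>_closed by (auto simp: X.bound_def D.bound_def comp_id \<Phi>_norm[symmetric])

lemma J_closed:
  assumes L: "L \<in> carrier D.H" shows "J L \<in> carrier X.H"
  unfolding X.H_carrier
proof (intro conjI ballI allI)
  show "\<exists>g. X.bound (J L) g" using J_bound D.H_D(7)[OF L] by blast
  fix v assume v: "v \<in> carrier M"
  show "J L v \<in> Lp_set 1 \<mu>Y" using D.H_D(2)[OF L \<Phi>_closed[OF v]] v by simp
  show "AE y in \<mu>Y. rep (J L (v \<oplus>\<^bsub>M\<^esub> w)) y = rep (J L v) y + rep (J L w) y" if w: "w \<in> carrier M" for w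
    using D.H_D(5)[OF L \<Phi>_closed[OF v] \<Phi>_closed[OF w]] v w by (simp add: \<Phi>_add)
  show "AE y in \<mu>Y. rep (J L (rscale \<mu>X M c v)) y = c * rep (J L v) y" for c
    using D.H_D(6)[OF L \<Phi>_closed[OF v], where c=c] v by (simp add: \<Phi>_scale X.rscale_closed)
qed simp

lemma J_graph:
  assumes L: "L \<in> carrier D.H" and "(u, h) \<in> span_graph (J L)"
  shows "AE y in \<mu>Y. h y = rep (L u) y"
  using assms(2)
proof (induction rule: span_graph.induct)
  case (zero h)
  have "AE y in \<mu>Y. rep (L \<zero>\<^bsub>N\<^esub>) y = 0" using D.H_D(5)[OF L M.zero_closed M.zero_closed] by simp
  then show ?case using zero(2) by eventually_elim simp
next
  case (step u h f v h')
  have u: "u \<in> carrier N" using span_graph_carrier[OF step(1)] by blast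
  have Jv: "J L v = L (\<Phi> v)" using step(3) by simp
  show ?case
    using step(5,6) D.H_D(5)[OF L u smult_closed[OF step(2) \<Phi>_closed[OF step(3)]]]
      D_Linf_linear[OF L step(2) \<Phi>_closed[OF step(3)]]
    unfolding Jv by eventually_elim simp
qed

text \<open>Every element of the dual has the closed graph that its restriction along \<open>\<Phi>\<close> determines. As
this graph is single-valued, restriction is injective.\<close>

lemma J_closure_graph:
  assumes L: "L \<in> carrier D.H" and w: "w \<in> carrier N"
  shows "(w, rep (L w)) \<in> closure_graph (J L)"
proof -
  obtain g where g: "D.bound L g" using D.H_D(7)[OF L] by blast
  obtain u h where u: "\<And>n. (u n, h n) \<in> span_graph (J L)" "\<And>n. u n \<in> carrier N"
    "AE y in \<mu>Y. (\<lambda>n. pn (w \<ominus>\<^bsub>N\<^esub> u n) y) \<longlonglongrightarrow> 0"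
    using span_graph_dense[OF J_closed[OF L] w] by blast
  have "AE y in \<mu>Y. \<forall>n. h n y = rep (L (u n)) y"
    unfolding AE_all_countable using J_graph[OF L u(1)] by blast
  moreover have "AE y in \<mu>Y. \<forall>n. rep (L (w \<ominus>\<^bsub>N\<^esub> u n)) y = rep (L w) y - rep (L (u n)) y"
    unfolding AE_all_countable using D_minus[OF L w u(2)] by blast
  moreover have "AE y in \<mu>Y. \<forall>n. \<bar>rep (L (w \<ominus>\<^bsub>N\<^esub> u n)) y\<bar> \<le> g y * pn (w \<ominus>\<^bsub>N\<^esub> u n) y"
    unfolding AE_all_countable using D_boundD[OF g M.minus_closed[OF w u(2)]] by blast
  ultimately have "AE y in \<mu>Y. (\<lambda>n. h n y) \<longlonglongrightarrow> rep (L w) y"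
    using u(3)
  proof eventually_elim
    case (elim y)
    have d: "(\<lambda>n. g y * pn (w \<ominus>\<^bsub>N\<^esub> u n) y) \<longlonglongrightarrow> 0"
      using tendsto_mult[OF tendsto_const[of "g y"] elim(4)] by simp
    have "(\<lambda>n. rep (L w) y - h n y) \<longlonglongrightarrow> 0"
      by (rule Lim_null_comparison[OF _ d]) (use elim(1,2,3) in simp)
    from tendsto_diff[OF tendsto_const[of "rep (L w) y"] this] show ?case by simp
  qed
  then show ?thesis by (rule closure_graphI[OF w D.H_D(4)[OF L w] u(1,3)])
qed

lemma J_injective:
  assumes L: "L \<in> carrier D.H" and L': "L' \<in> carrier D.H" and eq: "J L = J L'"
  shows "L = L'"
proof (rule D.H_eqI[OF L L'])
  fix w assume w: "w \<in> carrier N"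
  show "AE y in \<mu>Y. rep (L w) y = rep (L' w) y"
    using J_closure_graph[OF L' w] unfolding eq[symmetric]
    by (rule closure_graph_unique[OF J_closed[OF L] J_closure_graph[OF L w]])
qed

lemma J_surjective:
  assumes T: "T \<in> carrier X.H" and g: "X.bound T g"
  obtains L where "L \<in> carrier D.H" "D.bound L g" "J L = T"
proof -
  obtain L where L: "L \<in> carrier D.H" "D.bound L g" "\<And>v. v \<in> carrier M \<Longrightarrow> L (\<Phi> v) = T v"
    using extension[OF T g] by blast
  have "J L = T"
    by (rule extensionalityI[OF restrict_extensional X.H_D(1)[OF T]]) (simp add: L(3))
  with L show thesis using that by blast
qed

text \<open>A bound of the restriction is a bound of its extension, which by injectivity is the given map; so
both have the same bounds and hence the same least one.\<close>

lemma J_pnorm: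
  assumes L: "L \<in> carrier D.H"
  shows "pnorm X.H (J L) = pnorm D.H L"
proof (rule L0_eqI[OF X.hn_props(1)[OF J_closed[OF L]] D.hn_props(1)[OF L]])
  note JL = J_closed[OF L]
  obtain L' where L': "L' \<in> carrier D.H" "D.bound L' (X.hn (J L))" "J L' = J L"
    using J_surjective[OF JL X.hn_props(2)[OF JL]] by blast
  have "L' = L" using J_injective[OF L'(1) L L'(3)] .
  then have "AE y in \<mu>Y. D.hn L y \<le> X.hn (J L) y" using D.hn_props(3)[OF L] L'(2) by simp
  moreover have "AE y in \<mu>Y. X.hn (J L) y \<le> D.hn L y"
    by (rule X.hn_props(3)[OF JL J_bound[OF D.hn_props(2)[OF L]]])
  ultimately show "AE y in \<mu>Y. X.hn (J L) y = D.hn L y" by eventually_elim simp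
qed

lemma J_iso: "normed_module_iso q \<mu>Y (dual_module \<mu>Y N) X.H J"
  unfolding normed_module_iso_def Linf_linear_map_def additive_map_def dual_carrier
proof (intro conjI ballI dual_normed_module X.Hom_loc_normed_module)
  show "J \<in> carrier D.H \<rightarrow> carrier X.H" using J_closed by blast
  show "bij_betw J (carrier D.H) (carrier X.H)"
    unfolding bij_betw_def
  proof
    show "inj_on J (carrier D.H)" by (rule inj_onI) (rule J_injective)
    have "T \<in> J ` carrier D.H" if "T \<in> carrier X.H" for T
      using J_surjective[OF that] X.H_D(7)[OF that] by blast
    then show "J ` carrier D.H = carrier X.H" using J_closed by blast
  qed
  fix L assume L: "L \<in> carrier D.H"
  show "pnorm X.H (J L) = pnorm (dual_module \<mu>Y N) L"
    using J_pnorm[OF L] dual_norms(1)[OF L] by simp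
  show "J (L \<oplus>\<^bsub>dual_module \<mu>Y N\<^esub> L') = J L \<oplus>\<^bsub>X.H\<^esub> J L'" for L'
    unfolding X.H_simps dual_module_def by (auto simp: \<Phi>_closed intro!: restrict_ext)
  show "J (f \<odot>\<^bsub>dual_module \<mu>Y N\<^esub> L) = f \<odot>\<^bsub>X.H\<^esub> J L" for f
    unfolding X.H_simps dual_module_def by (auto simp: \<Phi>_closed intro!: restrict_ext)
qed

end

theorem theoremA1:
  fixes \<mu>X :: "'x measure" and \<mu>Y :: "'y measure" and \<phi> :: "'y \<Rightarrow> 'x" and p q :: real
    and M :: "('x fclass, 'm) normed_mod"
    and N :: "('y fclass, 'n) normed_mod" and \<Phi> :: "'m \<Rightarrow> 'n"
  assumes "sigma_finite_measure \<mu>X" and "sigma_finite_measure \<mu>Y"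
    and "\<phi> \<in> measurable \<mu>Y \<mu>X" and "absolutely_continuous \<mu>X (distr \<mu>Y \<mu>X \<phi>)"
    and "1 < p" and "1 < q" and "1 / p + 1 / q = 1"
    and "Lp_normed_module p \<mu>X M"
    and "is_pullback p \<mu>X \<mu>Y \<phi> M N \<Phi>"
  shows "normed_module_iso q \<mu>Y (dual_module \<mu>Y N) (Hom_loc q \<mu>X \<mu>Y \<phi> M)
           (\<lambda>L. \<lambda>v\<in>carrier M. L (\<Phi> v))"
proof -
  have N: "Lp_normed_module p \<mu>Y N" using assms(9) by (simp add: is_pullback_def)
  interpret pullback_setting p q \<mu>X M \<mu>Y N \<phi> \<Phi>
    by (intro pullback_setting.intro dual_exponent_module.intro dual_exponent_module_axioms.intro
        pullback_setting_axioms.intro N assms)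
  show ?thesis by (rule J_iso)
qed

end
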